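(* Let $X$ be an irreducible affine variety over $\mathbb{K}$, let $B=\mathbb{K}[X]$, and let $\delta$ be a maximal LND of $B$. Let $\mathbb{T}$ be a maximal torus in $\mathrm{Aut}(B)_\delta$. Then any $\varphi\in\mathrm{Aut}(B)_\delta$ preserves the set of $\mathbb{T}$-semi-invariants of the algebra $A:=\mathrm{Ker}(\delta)$.
   Context: $\mathbb{K}$ is an algebraically closed field of characteristic zero. A derivation $\delta$ of $B$ is locally nilpotent (LND) if for every $f\in B$ there is $n$ with $\delta^n(f)=0$. Two LNDs are equivalent if their kernels coincide. A nonzero LND $\delta$ is maximal if every nonzero LND of $B$ commuting with $\delta$ is equivalent to $\delta$. The isotropy subgroup of $\delta$ is $\mathrm{Aut}(B)_\delta=\{\varphi\in\mathrm{Aut}(B):\varphi\delta=\delta\varphi\}$; it is a closed subgroup of the ind-group $\mathrm{Aut}(B)=\mathrm{Aut}(X)$. Here $\mathrm{Aut}(X)$ has its standard ind-group structure: for a closed embedding $X\subseteq\mathbb{A}^N$, $\mathrm{End}(X)$ is filtered by degree of the coordinate polynomials and $\mathrm{Aut}(X)$ is identified with the closed subset $\{(f,g):fg=gf=\mathrm{id}\}$ of $\mathrm{End}(X)\times\mathrm{End}(X)$. A torus in $\mathrm{Aut}(B)_\delta$ is a closed algebraic subgroup isomorphic to $(\mathbb{K}^\times)^r$ for some $r\ge 0$; it is maximal if it is not properly contained in another such torus. A $\mathbb{T}$-semi-invariant (equivalently, $\mathbb{T}$-homogeneous element) is an element $f$ such that for every $t\in\mathbb{T}$, $t\cdot f=\lambda(t)f$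 for some $\lambda(t)\in\mathbb{K}$. *)

theory Defs
  imports "HOL-Computational_Algebra.Polynomial" "HOL-Algebra.Product_Groups"
begin

section \<open>Irreducible affine varieties and their coordinate algebras\<close>

text \<open>
  The algebra of functions generated, under pointwise operations, by the constants and a set
  \<open>G\<close> of functions. The ground fields below are infinite, so for a set of coordinate functions
  this is the usual algebra of polynomial functions in these coordinates.
\<close>

inductive_set fun_algebra :: "('a \<Rightarrow> 'k::field) set \<Rightarrow> ('a \<Rightarrow> 'k) set" for G where
  const: "(\<lambda>_. c) \<in> fun_algebra G"
| generator: "f \<in> G \<Longrightarrow> f \<in> fun_algebra G"
| add: "f \<in> fun_algebra G \<Longrightarrow> g \<in> fun_algebra G \<Longrightarrow> (\<lambda>v. f v + g v) \<in> fun_algebra G"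
| mult: "f \<in> fun_algebra G \<Longrightarrow> g \<in> fun_algebra G \<Longrightarrow> (\<lambda>v. f v * g v) \<in> fun_algebra G"

text \<open>Affine \<open>N\<close>-space is the type \<open>'n \<Rightarrow> 'k\<close> with \<open>CARD('n) = N\<close>.\<close>

definition affine_space_funs :: "(('n::finite \<Rightarrow> 'k::field) \<Rightarrow> 'k) set" where
  "affine_space_funs = fun_algebra (range (\<lambda>i v. v i))"

definition zariski_closed :: "('n::finite \<Rightarrow> 'k::field) set \<Rightarrow> bool" where
  "zariski_closed X \<longleftrightarrow> (\<exists>S \<subseteq> affine_space_funs. X = {v. \<forall>f\<in>S. f v = 0})"

definition irreducible_affine_variety :: "('n::finite \<Rightarrow> 'k::field) set \<Rightarrow> bool" where
  "irreducible_affine_variety X \<longleftrightarrow> zariski_closed X \<and> X \<noteq> {} \<and>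
     (\<forall>Y Z. zariski_closed Y \<and> zariski_closed Z \<and> X = Y \<union> Z \<longrightarrow> X = Y \<or> X = Z)"

definition regular_functions :: "('n::finite \<Rightarrow> 'k::field) set \<Rightarrow> (('n \<Rightarrow> 'k) \<Rightarrow> 'k) set" where
  "regular_functions X = (\<lambda>f. restrict f X) ` affine_space_funs"

text \<open>
  The type \<open>'b\<close>, with scalar multiplication \<open>scale\<close>, is the \<open>'k\<close>-algebra of regular functions
  on \<open>X\<close>: evaluation \<open>ev\<close> at the points of \<open>X\<close> is a \<open>'k\<close>-algebra isomorphism from \<open>'b\<close> onto
  \<open>regular_functions X\<close>. (The sort \<open>idom\<close> is no restriction, as \<open>X\<close> is irreducible.)
\<close>

locale coordinate_algebra = vector_space scale
  for scale :: "'k::{alg_closed_field, field_char_0} \<Rightarrow> 'b::idom \<Rightarrow> 'b" +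
  fixes X :: "('n::finite \<Rightarrow> 'k) set"
    and ev :: "'b \<Rightarrow> ('n \<Rightarrow> 'k) \<Rightarrow> 'k"
  assumes variety: "irreducible_affine_variety X"
    and ev_bij: "bij_betw ev UNIV (regular_functions X)"
    and ev_add: "p \<in> X \<Longrightarrow> ev (f + g) p = ev f p + ev g p"
    and ev_mult: "p \<in> X \<Longrightarrow> ev (f * g) p = ev f p * ev g p"
    and ev_scale: "p \<in> X \<Longrightarrow> ev (scale c f) p = c * ev f p"
    and ev_one: "p \<in> X \<Longrightarrow> ev 1 p = 1"

definition coord :: "('n \<Rightarrow> 'k) set \<Rightarrow> ('b \<Rightarrow> ('n \<Rightarrow> 'k) \<Rightarrow> 'k) \<Rightarrow> 'n \<Rightarrow> 'b" where
  "coord X ev i = inv_into UNIV ev (\<lambda>p\<in>X. p i)"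


section \<open>Locally nilpotent derivations\<close>

definition derivation :: "('k::field \<Rightarrow> 'b::idom \<Rightarrow> 'b) \<Rightarrow> ('b \<Rightarrow> 'b) \<Rightarrow> bool" where
  "derivation scale \<delta> \<longleftrightarrow> Vector_Spaces.linear scale scale \<delta> \<and>
     (\<forall>f g. \<delta> (f * g) = \<delta> f * g + f * \<delta> g)"

definition LND :: "('k::field \<Rightarrow> 'b::idom \<Rightarrow> 'b) \<Rightarrow> ('b \<Rightarrow> 'b) \<Rightarrow> bool" where
  "LND scale \<delta> \<longleftrightarrow> derivation scale \<delta> \<and> (\<forall>f. \<exists>n. (\<delta> ^^ n) f = 0)"

definition Ker :: "('b::zero \<Rightarrow> 'b) \<Rightarrow> 'b set" where
  "Ker \<delta> = {f. \<delta> f = 0}"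

definition maximal_LND :: "('k::field \<Rightarrow> 'b::idom \<Rightarrow> 'b) \<Rightarrow> ('b \<Rightarrow> 'b) \<Rightarrow> bool" where
  "maximal_LND scale \<delta> \<longleftrightarrow> LND scale \<delta> \<and> \<delta> \<noteq> (\<lambda>_. 0) \<and>
     (\<forall>\<epsilon>. LND scale \<epsilon> \<and> \<epsilon> \<noteq> (\<lambda>_. 0) \<and> \<epsilon> \<circ> \<delta> = \<delta> \<circ> \<epsilon> \<longrightarrow> Ker \<epsilon> = Ker \<delta>)"


section \<open>The automorphism group as an ind-group\<close>

definition Aut :: "('k::field \<Rightarrow> 'b::idom \<Rightarrow> 'b) \<Rightarrow> ('b \<Rightarrow> 'b) monoid" where
  "Aut scale = \<lparr>carrier = {\<phi>. bij \<phi> \<and> Vector_Spaces.linear scale scale \<phi> \<and>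
       (\<forall>f g. \<phi> (f * g) = \<phi> f * \<phi> g) \<and> \<phi> 1 = 1},
     monoid.mult = (\<circ>), one = id\<rparr>"

definition isotropy :: "('k::field \<Rightarrow> 'b::idom \<Rightarrow> 'b) \<Rightarrow> ('b \<Rightarrow> 'b) \<Rightarrow> ('b \<Rightarrow> 'b) set" where
  "isotropy scale \<delta> = {\<phi> \<in> carrier (Aut scale). \<phi> \<circ> \<delta> = \<delta> \<circ> \<phi>}"

text \<open>The functions on \<open>X\<close> given by polynomials of degree at most \<open>d\<close> in the coordinates of the
  ambient affine space.\<close>

definition degree_le :: "('k::field \<Rightarrow> 'b::idom \<Rightarrow> 'b) \<Rightarrow> ('n::finite \<Rightarrow> 'k) set \<Rightarrow>
    ('b \<Rightarrow> ('n \<Rightarrow> 'k) \<Rightarrow> 'k) \<Rightarrow> nat \<Rightarrow> 'b set" where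
  "degree_le scale X ev d =
     module.span scale {\<Prod>i\<in>UNIV. coord X ev i ^ e i | e. (\<Sum>i\<in>UNIV. e i) \<le> d}"

text \<open>
  An endomorphism of \<open>X\<close> is given by its coordinate functions, that is, by the images of the
  coordinates under the corresponding endomorphism \<open>\<phi>\<close> of the coordinate algebra. An automorphism
  is regarded as the pair of \<open>\<phi>\<close> and its inverse, so both have to be of bounded degree.
\<close>

definition Aut_filtration :: "('k::field \<Rightarrow> 'b::idom \<Rightarrow> 'b) \<Rightarrow> ('n::finite \<Rightarrow> 'k) set \<Rightarrow>
    ('b \<Rightarrow> ('n \<Rightarrow> 'k) \<Rightarrow> 'k) \<Rightarrow> nat \<Rightarrow> ('b \<Rightarrow> 'b) set" where
  "Aut_filtration scale X ev d = {\<phi> \<in> carrier (Aut scale).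
     \<forall>i. \<phi> (coord X ev i) \<in> degree_le scale X ev d \<and>
         inv_into UNIV \<phi> (coord X ev i) \<in> degree_le scale X ev d}"

text \<open>
  Each filtration piece lies in a finite-dimensional space: a sum of copies of
  \<open>degree_le scale X ev d\<close>, one for each coordinate of \<open>\<phi>\<close> and of its inverse. The polynomial
  functions on that space are generated by its linear functionals, and every such functional
  is induced by linear functionals on the whole coordinate algebra. Hence the functions
  below restrict on each filtration piece precisely to the polynomial functions.
\<close>

definition Aut_funs :: "('k::field \<Rightarrow> 'b::idom \<Rightarrow> 'b) \<Rightarrow> ('n::finite \<Rightarrow> 'k) set \<Rightarrow>
    ('b \<Rightarrow> ('n \<Rightarrow> 'k) \<Rightarrow> 'k) \<Rightarrow> (('b \<Rightarrow> 'b) \<Rightarrow> 'k) set" where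
  "Aut_funs scale X ev = fun_algebra
     ({\<lambda>\<phi>. l (\<phi> (coord X ev i)) | l i. Vector_Spaces.linear scale (*) l} \<union>
      {\<lambda>\<phi>. l (inv_into UNIV \<phi> (coord X ev i)) | l i. Vector_Spaces.linear scale (*) l})"

definition Aut_closed :: "('k::field \<Rightarrow> 'b::idom \<Rightarrow> 'b) \<Rightarrow> ('n::finite \<Rightarrow> 'k) set \<Rightarrow>
    ('b \<Rightarrow> ('n \<Rightarrow> 'k) \<Rightarrow> 'k) \<Rightarrow> ('b \<Rightarrow> 'b) set \<Rightarrow> bool" where
  "Aut_closed scale X ev Z \<longleftrightarrow> Z \<subseteq> carrier (Aut scale) \<and>
     (\<forall>d. \<exists>S \<subseteq> Aut_funs scale X ev.
        Z \<inter> Aut_filtration scale X ev d = {\<phi> \<in> Aut_filtration scale X ev d. \<forall>P\<in>S. P \<phi> = 0})"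

definition closed_algebraic_subgroup :: "('k::field \<Rightarrow> 'b::idom \<Rightarrow> 'b) \<Rightarrow>
    ('n::finite \<Rightarrow> 'k) set \<Rightarrow> ('b \<Rightarrow> ('n \<Rightarrow> 'k) \<Rightarrow> 'k) \<Rightarrow> ('b \<Rightarrow> 'b) set \<Rightarrow> bool" where
  "closed_algebraic_subgroup scale X ev H \<longleftrightarrow> subgroup H (Aut scale) \<and>
     Aut_closed scale X ev H \<and> (\<exists>d. H \<subseteq> Aut_filtration scale X ev d)"


section \<open>Tori\<close>

definition mult_group :: "'k::field monoid" where
  "mult_group = \<lparr>carrier = - {0}, monoid.mult = (*), one = 1\<rparr>"

definition std_torus :: "nat \<Rightarrow> (nat \<Rightarrow> 'k::field) monoid" where
  "std_torus r = product_group {..<r} (\<lambda>_. mult_group)"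

text \<open>Laurent polynomials.\<close>

definition std_torus_funs :: "nat \<Rightarrow> ((nat \<Rightarrow> 'k::field) \<Rightarrow> 'k) set" where
  "std_torus_funs r = fun_algebra ((\<lambda>i t. t i) ` {..<r} \<union> (\<lambda>i t. inverse (t i)) ` {..<r})"

text \<open>
  \<open>\<theta>\<close> is an isomorphism of algebraic groups from the standard torus onto \<open>H\<close>: it is an isomorphism
  of abstract groups, and regular functions correspond to regular functions in both directions
  (a regular function on \<open>H\<close> is the restriction of a polynomial function, \<open>H\<close> being closed in
  some filtration piece).
\<close>

definition torus_iso :: "('k::field \<Rightarrow> 'b::idom \<Rightarrow> 'b) \<Rightarrow> ('n::finite \<Rightarrow> 'k) set \<Rightarrow>
    ('b \<Rightarrow> ('n \<Rightarrow> 'k) \<Rightarrow> 'k) \<Rightarrow> ('b \<Rightarrow> 'b) set \<Rightarrow> nat \<Rightarrow> ((nat \<Rightarrow> 'k) \<Rightarrow> 'b \<Rightarrow> 'b) \<Rightarrow> bool" where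
  "torus_iso scale X ev H r \<theta> \<longleftrightarrow>
     \<theta> \<in> iso (std_torus r) (Aut scale\<lparr>carrier := H\<rparr>) \<and>
     (\<forall>P \<in> Aut_funs scale X ev. \<exists>f \<in> std_torus_funs r.
        \<forall>t \<in> carrier (std_torus r). P (\<theta> t) = f t) \<and>
     (\<forall>f \<in> std_torus_funs r. \<exists>P \<in> Aut_funs scale X ev.
        \<forall>t \<in> carrier (std_torus r). P (\<theta> t) = f t)"

definition torus_in :: "('k::field \<Rightarrow> 'b::idom \<Rightarrow> 'b) \<Rightarrow> ('n::finite \<Rightarrow> 'k) set \<Rightarrow>
    ('b \<Rightarrow> ('n \<Rightarrow> 'k) \<Rightarrow> 'k) \<Rightarrow> ('b \<Rightarrow> 'b) set \<Rightarrow> ('b \<Rightarrow> 'b) set \<Rightarrow> bool" where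
  "torus_in scale X ev G T \<longleftrightarrow> T \<subseteq> G \<and> closed_algebraic_subgroup scale X ev T \<and>
     (\<exists>r \<theta>. torus_iso scale X ev T r \<theta>)"

definition maximal_torus_in :: "('k::field \<Rightarrow> 'b::idom \<Rightarrow> 'b) \<Rightarrow> ('n::finite \<Rightarrow> 'k) set \<Rightarrow>
    ('b \<Rightarrow> ('n \<Rightarrow> 'k) \<Rightarrow> 'k) \<Rightarrow> ('b \<Rightarrow> 'b) set \<Rightarrow> ('b \<Rightarrow> 'b) set \<Rightarrow> bool" where
  "maximal_torus_in scale X ev G T \<longleftrightarrow> torus_in scale X ev G T \<and>
     \<not> (\<exists>T'. torus_in scale X ev G T' \<and> T \<subset> T')"

definition semi_invariants :: "('k::field \<Rightarrow> 'b::idom \<Rightarrow> 'b) \<Rightarrow> ('b \<Rightarrow> 'b) set \<Rightarrow> 'b set \<Rightarrow> 'b set"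
  where "semi_invariants scale T A = {f \<in> A. \<forall>t\<in>T. \<exists>c. t f = scale c f}"

end

theory Submission
  imports Defs "HOL-Library.Function_Algebras"
begin

text \<open>
  It suffices to show that \<open>\<phi>\<^sup>-\<^sup>1\<close> maps semi-invariants to semi-invariants, since \<open>\<phi>\<close> is arbitrary.
  The torus \<open>T\<close>, of rank \<open>r\<close>, amounts to a grading of the coordinate algebra \<open>B\<close> by \<open>\<int>\<^sup>r\<close> for which
  \<open>\<delta>\<close> has degree zero, and the semi-invariants in \<open>A = Ker \<delta>\<close> are the homogeneous elements of \<open>A\<close>.
  An infinitesimal generator of the conjugate torus \<open>\<phi> T \<phi>\<^sup>-\<^sup>1\<close> is a derivation \<open>D\<close> that is
  diagonalizable with integer eigenvalues and commutes with \<open>\<delta>\<close>. The point is that each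
  homogeneous element of \<open>A\<close> is an eigenvector of every such \<open>D\<close>
  (\<open>eigenvector_on_kernel\<close>); transported by \<open>\<phi>\<^sup>-\<^sup>1\<close> this says that its image has a single weight.

  First, \<open>D\<close> preserves the degree on \<open>A\<close>. Otherwise consider, for the grading by one of the
  coordinates of the weight, the component of \<open>D\<close> of extremal degree among those that do not vanish
  on \<open>A\<close>. Because \<open>D\<close> is locally finite, this component is locally nilpotent on \<open>A\<close>, and a
  derivation that commutes with \<open>\<delta>\<close> and is locally nilpotent on \<open>A\<close> is so on \<open>B\<close>. It is thus a
  locally nilpotent derivation whose kernel differs from \<open>A\<close>, against the maximality of \<open>\<delta>\<close>
  (\<open>homogeneous_on_kernel_of_maximal_LND\<close>).

  Secondly, the component \<open>D'\<close> of degree zero of \<open>D\<close> with respect to the whole \<open>\<int>\<^sup>r\<close>-grading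
  commutes with \<open>T\<close> and \<open>\<delta>\<close> and agrees with \<open>D\<close> on \<open>A\<close>. As \<open>\<delta>\<^sup>n f\<close> lies in \<open>A\<close> for suitable \<open>n\<close>,
  the algebra \<open>B\<close> is the sum of generalized eigenspaces of \<open>D'\<close> for integer eigenvalues, which refine
  the grading to one by \<open>\<int>\<^sup>r\<^sup>+\<^sup>1\<close> (\<open>grading_W2\<close>). If the eigenvalue were not a linear function of the
  torus weight, this grading would define, after a change of coordinates, a torus of rank \<open>r + 1\<close>
  in the isotropy group that contains \<open>T\<close>, against the maximality of \<open>T\<close>
  (\<open>eigenvalue_linear_in_weight\<close>). So \<open>D\<close> has a single eigenvalue on each homogeneous part of \<open>A\<close>.

  The dictionary between tori and gradings is provided by \<open>torus_grading\<close> and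
  \<open>torus_weight_lattice\<close> in one direction and by \<open>scalar_automorphisms_torus\<close> in the other.
\<close>

section \<open>Derivations and gradings of commutative algebras\<close>

locale comm_algebra = vector_space scale
  for scale :: "'k::field_char_0 \<Rightarrow> 'b::idom \<Rightarrow> 'b" +
  assumes scale_mult_left: "scale c f * g = scale c (f * g)"
begin

abbreviation lin :: "('b \<Rightarrow> 'b) \<Rightarrow> bool" where
  "lin \<equiv> Vector_Spaces.linear scale scale"

lemma scale_mult_right: "f * scale c g = scale c (f * g)"
  by (metis scale_mult_left mult.commute)

lemma linI:
  assumes "\<And>f g. D (f + g) = D f + D g" and "\<And>c f. D (scale c f) = scale c (D f)"
  shows "lin D"
  by (intro Vector_Spaces.linear.intro module_hom.intro module_hom_axioms.intro
      vector_space_axioms module_axioms assms)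

lemma
  assumes "lin D"
  shows lin_add: "D (f + g) = D f + D g"
    and lin_scale: "D (scale c f) = scale c (D f)"
    and lin_zero: "D 0 = 0"
    and lin_diff: "D (f - g) = D f - D g"
    and lin_sum: "D (sum x F) = (\<Sum>a\<in>F. D (x a))"
proof -
  interpret D: module_hom scale scale D
    using assms by (simp add: linear_iff_module_hom)
  show "D (f + g) = D f + D g" "D (scale c f) = scale c (D f)" "D 0 = 0"
    "D (f - g) = D f - D g" "D (sum x F) = (\<Sum>a\<in>F. D (x a))"
    by (simp_all add: D.add D.scale D.zero D.diff D.sum)
qed

lemma lin_funpow:
  assumes "lin D"
  shows "lin (D ^^ n)"
proof (induction n)
  case 0
  then show ?case by (auto intro: linI)
next
  case (Suc n)
  then show ?case by (auto intro!: linI simp: lin_add[OF assms] lin_scale[OF assms] lin_add[OF Suc] lin_scale[OF Suc])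
qed

lemma derivationI:
  assumes "lin D" and "\<And>f g. D (f * g) = D f * g + f * D g"
  shows "derivation scale D"
  using assms by (simp add: derivation_def)

lemma derivation_lin: "derivation scale D \<Longrightarrow> lin D"
  by (simp add: derivation_def)

lemma derivation_mult: "derivation scale D \<Longrightarrow> D (f * g) = D f * g + f * D g"
  by (simp add: derivation_def)

lemma derivation_one: 
  assumes "derivation scale D" shows "D 1 = 0"
  using derivation_mult[OF assms, of 1 1] by (metis add_cancel_right_right mult.right_neutral mult.left_neutral)

lemma funpow_zero_mono:
  assumes "lin D" and "(D ^^ n) f = 0" and "n \<le> m"
  shows "(D ^^ m) f = 0"
proof -
  have "(D ^^ m) f = (D ^^ (m - n)) ((D ^^ n) f)"
    using assms(3) by (metis comp_apply funpow_add le_add_diff_inverse2)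
  then show ?thesis using assms lin_zero[OF lin_funpow[OF assms(1)]] by simp
qed

lemma funpow_commute:
  assumes "\<And>f. D (\<delta> f) = \<delta> (D f)"
  shows "(D ^^ n) (\<delta> f) = \<delta> ((D ^^ n) f)"
  by (induction n) (simp_all add: assms)

text \<open>
  Induction on the order of nilpotency under \<open>\<delta>\<close>: if a power of \<open>D\<close> kills \<open>\<delta> f\<close>, it moves \<open>f\<close>
  into the kernel of \<open>\<delta>\<close>, where \<open>D\<close> is nilpotent. Local nilpotency thus needs to be
  established on \<open>Ker \<delta>\<close> only.
\<close>

lemma locally_nilpotent_if_on_kernel:
  assumes "lin D" and commute: "\<And>f. D (\<delta> f) = \<delta> (D f)"
    and \<delta>: "LND scale \<delta>"
    and ker: "\<And>f. \<delta> f = 0 \<Longrightarrow> \<exists>n. (D ^^ n) f = 0"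
  shows "\<exists>n. (D ^^ n) f = 0"
proof -
  have "\<exists>m. (D ^^ m) f = 0" if "(\<delta> ^^ n) f = 0" for n f
    using that
  proof (induction n arbitrary: f)
    case 0
    then show ?case by (auto intro: exI[of _ 0])
  next
    case (Suc n)
    then have "(\<delta> ^^ n) (\<delta> f) = 0" by (simp add: funpow_swap1)
    then obtain m where "(D ^^ m) (\<delta> f) = 0" using Suc.IH by blast
    then have "\<delta> ((D ^^ m) f) = 0" by (simp add: funpow_commute[of D \<delta>, OF commute])
    then obtain k where "(D ^^ k) ((D ^^ m) f) = 0" using ker by blast
    then have "(D ^^ (k + m)) f = 0" by (simp add: funpow_add)
    then show ?case by blast
  qed
  then show ?thesis using \<delta> unfolding LND_def by blast
qed

end

locale grading = comm_algebra scale
  for scale :: "'k::field_char_0 \<Rightarrow> 'b::idom \<Rightarrow> 'b" +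
  fixes W :: "'g::ab_group_add \<Rightarrow> 'b set"
  assumes subspace_W: "subspace (W a)"
    and span_W: "span (\<Union>a. W a) = UNIV"
    and independent_W: "finite F \<Longrightarrow> (\<And>a. a \<in> F \<Longrightarrow> x a \<in> W a) \<Longrightarrow> sum x F = 0 \<Longrightarrow> a \<in> F \<Longrightarrow> x a = 0"
    and one_W: "1 \<in> W 0"
    and mult_W: "f \<in> W a \<Longrightarrow> g \<in> W b \<Longrightarrow> f * g \<in> W (a + b)"
begin

lemma zero_W [simp]: "0 \<in> W a"
  by (rule subspace_0[OF subspace_W])

lemma add_W: "f \<in> W a \<Longrightarrow> g \<in> W a \<Longrightarrow> f + g \<in> W a"
  by (rule subspace_add[OF subspace_W])

lemma diff_W: "f \<in> W a \<Longrightarrow> g \<in> W a \<Longrightarrow> f - g \<in> W a"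
  by (rule subspace_diff[OF subspace_W])

lemma scale_W: "f \<in> W a \<Longrightarrow> scale c f \<in> W a"
  by (rule subspace_scale[OF subspace_W])

lemma sum_W: "(\<And>i. i \<in> I \<Longrightarrow> x i \<in> W a) \<Longrightarrow> sum x I \<in> W a"
  by (rule subspace_sum[OF subspace_W])

lemma homogeneous_induct [consumes 0, case_names homogeneous add]:
  assumes "\<And>a f. f \<in> W a \<Longrightarrow> P f" and "\<And>f g. P f \<Longrightarrow> P g \<Longrightarrow> P (f + g)"
  shows "P f"
proof -
  have "f \<in> span (\<Union>a. W a)" using span_W by simp
  then show ?thesis
  proof (induction rule: span_induct_alt)
    case base
    show ?case using assms(1)[OF zero_W] .
  next
    case (step c x y)
    then obtain a where "x \<in> W a" by blast
    then show ?case using assms(2)[OF assms(1)[OF scale_W] step(2)] by blast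
  qed
qed

definition decomposition :: "'b \<Rightarrow> 'g set \<Rightarrow> ('g \<Rightarrow> 'b) \<Rightarrow> bool" where
  "decomposition f F x \<longleftrightarrow> finite F \<and> (\<forall>a. x a \<in> W a) \<and> (\<forall>a. a \<notin> F \<longrightarrow> x a = 0) \<and> f = sum x F"

lemma decomposition_extend:
  assumes "decomposition f F x" and "finite G" and "F \<subseteq> G"
  shows "decomposition f G x"
proof -
  have "sum x G = sum x F"
    using assms by (intro sum.mono_neutral_right) (auto simp: decomposition_def)
  then show ?thesis using assms by (auto simp: decomposition_def)
qed

lemma decomposition_add:
  assumes "decomposition f F x" and "decomposition g G y"
  shows "decomposition (f + g) (F \<union> G) (\<lambda>a. x a + y a)"
proof -
  have "finite (F \<union> G)" using assms by (auto simp: decomposition_def)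
  then have "decomposition f (F \<union> G) x" "decomposition g (F \<union> G) y"
    by (auto intro: decomposition_extend[OF assms(1)] decomposition_extend[OF assms(2)])
  then show ?thesis by (auto simp: decomposition_def sum.distrib intro: add_W)
qed

lemma decomposition_homogeneous:
  assumes "f \<in> W a"
  shows "decomposition f {a} (\<lambda>b. if b = a then f else 0)"
  using assms by (auto simp: decomposition_def)

lemma decomposition_exists: "\<exists>F x. decomposition f F x"
proof (induction f rule: homogeneous_induct)
  case (homogeneous a f)
  then show ?case using decomposition_homogeneous by blast
next
  case (add f g)
  then show ?case using decomposition_add by blast
qed

lemma decomposition_unique:
  assumes "decomposition f F x" and "decomposition f G y"
  shows "x = y"
proof
  fix a
  let ?H = "insert a (F \<union> G)"
  have "finite ?H" using assms by (auto simp: decomposition_def)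
  then have 1: "decomposition f ?H x" "decomposition f ?H y"
    by (auto intro: decomposition_extend[OF assms(1)] decomposition_extend[OF assms(2)])
  then have "(\<Sum>b\<in>?H. x b - y b) = 0"
    unfolding sum_subtractf by (simp add: decomposition_def)
  then have "x a - y a = 0"
    using independent_W[of ?H "\<lambda>b. x b - y b" a] 1 diff_W \<open>finite ?H\<close>
    by (auto simp: decomposition_def)
  then show "x a = y a" by simp
qed

definition proj :: "'g \<Rightarrow> 'b \<Rightarrow> 'b" where
  "proj a f = (SOME x. \<exists>F. decomposition f F x) a"

definition supp :: "'b \<Rightarrow> 'g set" where
  "supp f = {a. proj a f \<noteq> 0}"

lemma proj_eq: "decomposition f F x \<Longrightarrow> proj a f = x a"
  unfolding proj_def by (rule fun_cong[of _ _ a], rule some_equality) (auto dest: decomposition_unique)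

lemma decomposition_proj: "decomposition f (supp f) (\<lambda>a. proj a f)"
proof -
  obtain F x where *: "decomposition f F x" using decomposition_exists by blast
  then have "x = (\<lambda>a. proj a f)" by (simp add: proj_eq fun_eq_iff)
  with * have F: "decomposition f F (\<lambda>a. proj a f)" by simp
  then have sub: "supp f \<subseteq> F" and fin: "finite F"
    unfolding decomposition_def supp_def by blast+
  have "(\<Sum>a\<in>supp f. proj a f) = (\<Sum>a\<in>F. proj a f)"
    using sub fin by (intro sum.mono_neutral_left) (auto simp: supp_def)
  moreover have "finite (supp f)" using sub fin by (rule finite_subset)
  moreover have "f = (\<Sum>a\<in>F. proj a f)" "\<forall>a. proj a f \<in> W a"
    using F unfolding decomposition_def by blast+
  ultimately show ?thesis by (simp add: decomposition_def supp_def)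
qed

lemma proj_in_W [simp]: "proj a f \<in> W a"
  using decomposition_proj[of f] unfolding decomposition_def by blast

lemma finite_supp [simp]: "finite (supp f)"
  using decomposition_proj[of f] unfolding decomposition_def by blast

lemma sum_proj: "(\<Sum>a\<in>supp f. proj a f) = f"
  using decomposition_proj[of f] unfolding decomposition_def by metis

lemma sum_proj_superset: "finite F \<Longrightarrow> supp f \<subseteq> F \<Longrightarrow> (\<Sum>a\<in>F. proj a f) = f"
  using decomposition_extend[OF decomposition_proj, of F f] unfolding decomposition_def by metis

lemma proj_notin_supp: "a \<notin> supp f \<Longrightarrow> proj a f = 0"
  by (simp add: supp_def)

lemma proj_homogeneous: "f \<in> W a \<Longrightarrow> proj b f = (if b = a then f else 0)"
  using proj_eq[OF decomposition_homogeneous] by simp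

lemma proj_lin: "lin (proj a)"
proof (rule linI)
  show "proj a (f + g) = proj a f + proj a g" for f g
    using proj_eq[OF decomposition_add[OF decomposition_proj decomposition_proj]] .
  have "decomposition (scale c f) (supp f) (\<lambda>a. scale c (proj a f))" for c f
    unfolding decomposition_def
    using scale_sum_right[of c "\<lambda>a. proj a f" "supp f"]
    by (simp add: sum_proj scale_W proj_notin_supp)
  then show "proj a (scale c f) = scale c (proj a f)" for c f
    using proj_eq by blast
qed

lemmas proj_add = lin_add[OF proj_lin]
  and proj_scale = lin_scale[OF proj_lin]
  and proj_zero [simp] = lin_zero[OF proj_lin]
  and proj_sum = lin_sum[OF proj_lin]

lemma proj_commute:
  assumes "lin D" and "\<And>a f. f \<in> W a \<Longrightarrow> D f \<in> W a"
  shows "proj a (D f) = D (proj a f)"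
proof (induction f rule: homogeneous_induct)
  case (homogeneous b f)
  then show ?case using lin_zero[OF assms(1)]
    by (simp add: proj_homogeneous[OF homogeneous] proj_homogeneous[OF assms(2)[OF homogeneous]])
next
  case (add f g)
  then show ?case by (simp add: proj_add lin_add[OF assms(1)])
qed

lemma proj_mult_left:
  assumes "f \<in> W b"
  shows "proj a (f * g) = f * proj (a - b) g"
proof (induction g rule: homogeneous_induct)
  case (homogeneous c g)
  have "a - b = c \<longleftrightarrow> a = b + c" by (simp add: diff_eq_eq add.commute)
  then show ?case
    by (simp only: proj_homogeneous[OF mult_W[OF assms homogeneous]] proj_homogeneous[OF homogeneous])
      simp
next
  case (add f g)
  then show ?case by (simp add: proj_add algebra_simps)
qed

lemma proj_mult_nonzero:
  assumes "proj a (f * g) \<noteq> 0"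
  shows "\<exists>b. proj b f \<noteq> 0 \<and> proj (a - b) g \<noteq> 0"
proof (rule ccontr)
  assume *: "\<not> ?thesis"
  have "f * g = (\<Sum>b\<in>supp f. proj b f * g)"
    by (simp add: sum_proj flip: sum_distrib_right)
  then have "proj a (f * g) = (\<Sum>b\<in>supp f. proj a (proj b f * g))"
    by (simp add: proj_sum)
  also have "\<dots> = (\<Sum>b\<in>supp f. proj b f * proj (a - b) g)"
    by (simp add: proj_mult_left[OF proj_in_W])
  also have "\<dots> = 0" using * by (intro sum.neutral) auto
  finally show False using assms by simp
qed

lemma homogeneous_iff: "f \<in> W a \<longleftrightarrow> (\<forall>b. b \<noteq> a \<longrightarrow> proj b f = 0)"
proof
  assume *: "\<forall>b. b \<noteq> a \<longrightarrow> proj b f = 0"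
  then have "(\<Sum>b\<in>{a}. proj b f) = f"
    by (intro sum_proj_superset) (auto simp: supp_def)
  then have "proj a f = f" by simp
  then show "f \<in> W a" by (metis proj_in_W)
next
  assume "f \<in> W a"
  then show "\<forall>b. b \<noteq> a \<longrightarrow> proj b f = 0" using proj_homogeneous by metis
qed

definition weights :: "'g set" where
  "weights = {a. \<exists>f\<in>W a. f \<noteq> 0}"

lemma supp_subset_weights: "supp f \<subseteq> weights"
  unfolding supp_def weights_def using proj_in_W by blast

lemma weights_zero: "0 \<in> weights"
  using one_W zero_neq_one[symmetric] unfolding weights_def by blast

lemma weights_add: "a \<in> weights \<Longrightarrow> b \<in> weights \<Longrightarrow> a + b \<in> weights"
  unfolding weights_def mem_Collect_eq using mult_W no_zero_divisors by blast

text \<open>The differences of weights form a group since the weights form a monoid, which is where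
  the absence of zero divisors enters.\<close>

definition weight_lattice :: "'g set" where
  "weight_lattice = {a - b | a b. a \<in> weights \<and> b \<in> weights}"

lemma weight_lattice_weights: "a \<in> weights \<Longrightarrow> a \<in> weight_lattice"
  unfolding weight_lattice_def using weights_zero by (metis (mono_tags, lifting) diff_zero mem_Collect_eq)

lemma weight_lattice_zero: "0 \<in> weight_lattice"
  using weight_lattice_weights weights_zero by blast

lemma weight_lattice_minus: "a \<in> weight_lattice \<Longrightarrow> - a \<in> weight_lattice"
  unfolding weight_lattice_def mem_Collect_eq by (metis minus_diff_eq)

lemma weight_lattice_add:
  assumes "a \<in> weight_lattice" and "b \<in> weight_lattice"
  shows "a + b \<in> weight_lattice"
proof -
  obtain a1 a2 b1 b2 where *: "a = a1 - a2" "b = b1 - b2"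
    "a1 \<in> weights" "a2 \<in> weights" "b1 \<in> weights" "b2 \<in> weights"
    using assms by (auto simp: weight_lattice_def)
  then have "a + b = (a1 + b1) - (a2 + b2)" by simp
  then show ?thesis using * weights_add unfolding weight_lattice_def by blast
qed

subsection \<open>Homogeneous components of a derivation\<close>

definition hcomp :: "('b \<Rightarrow> 'b) \<Rightarrow> 'g \<Rightarrow> 'b \<Rightarrow> 'b" where
  "hcomp D l f = (\<Sum>a\<in>supp f. proj (a + l) (D (proj a f)))"

context
  fixes D :: "'b \<Rightarrow> 'b"
  assumes D: "lin D"
begin

lemma hcomp_superset:
  assumes "finite F" and "supp f \<subseteq> F"
  shows "hcomp D l f = (\<Sum>a\<in>F. proj (a + l) (D (proj a f)))"
  unfolding hcomp_def using assms
  by (intro sum.mono_neutral_left) (auto simp: proj_notin_supp lin_zero[OF D])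

lemma hcomp_homogeneous:
  assumes "f \<in> W a"
  shows "hcomp D l f = proj (a + l) (D f)"
proof -
  have "supp f \<subseteq> {a}" using assms by (auto simp: supp_def proj_homogeneous[OF assms])
  then show ?thesis using hcomp_superset[of "{a}" f l] assms by (simp add: proj_homogeneous[OF assms])
qed

lemma hcomp_in_W: "f \<in> W a \<Longrightarrow> hcomp D l f \<in> W (a + l)"
  by (simp add: hcomp_homogeneous)

lemma hcomp_lin: "lin (hcomp D l)"
proof (rule linI)
  fix f g
  let ?F = "supp f \<union> supp g"
  have "supp (f + g) \<subseteq> ?F" by (auto simp: supp_def proj_add)
  then show "hcomp D l (f + g) = hcomp D l f + hcomp D l g"
    by (simp add: hcomp_superset[of ?F] proj_add lin_add[OF D] sum.distrib)
next
  fix c f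
  have "supp (scale c f) \<subseteq> supp f" by (auto simp: supp_def proj_scale)
  then show "hcomp D l (scale c f) = scale c (hcomp D l f)"
    by (simp add: hcomp_superset[of "supp f"] proj_scale lin_scale[OF D] scale_sum_right)
qed

lemma hcomp_commute:
  assumes "lin \<delta>" and "\<And>a f. f \<in> W a \<Longrightarrow> \<delta> f \<in> W a" and "\<And>f. D (\<delta> f) = \<delta> (D f)"
  shows "hcomp D l (\<delta> f) = \<delta> (hcomp D l f)"
proof (induction f rule: homogeneous_induct)
  case (homogeneous a f)
  have "hcomp D l (\<delta> f) = proj (a + l) (D (\<delta> f))"
    by (rule hcomp_homogeneous[OF assms(2)[OF homogeneous]])
  also have "\<dots> = \<delta> (proj (a + l) (D f))"
    unfolding assms(3) by (rule proj_commute[OF assms(1,2)])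
  finally show ?case by (simp only: hcomp_homogeneous[OF homogeneous])
next
  case (add f g)
  then show ?case by (simp add: lin_add[OF hcomp_lin] lin_add[OF D] lin_add[OF assms(1)])
qed

lemma finite_hcomp: "finite {l. hcomp D l f \<noteq> 0}"
proof -
  have "{l. hcomp D l f \<noteq> 0} \<subseteq> (\<Union>a\<in>supp f. (\<lambda>b. b - a) ` supp (D (proj a f)))"
  proof
    fix l assume "l \<in> {l. hcomp D l f \<noteq> 0}"
    then obtain a where a: "a \<in> supp f" "proj (a + l) (D (proj a f)) \<noteq> 0"
      unfolding hcomp_def by (metis (mono_tags, lifting) mem_Collect_eq sum.neutral)
    have "l = (a + l) - a" by simp
    then show "l \<in> (\<Union>a\<in>supp f. (\<lambda>b. b - a) ` supp (D (proj a f)))"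
      using a unfolding supp_def by blast
  qed
  then show ?thesis by (rule finite_subset) auto
qed

end

lemma hcomp_derivation:
  assumes "derivation scale D"
  shows "derivation scale (hcomp D l)"
proof (rule derivationI)
  have D: "lin D" by (rule derivation_lin[OF assms])
  show "lin (hcomp D l)" by (rule hcomp_lin[OF D])
  have 1: "hcomp D l (f * g) = hcomp D l f * g + f * hcomp D l g"
    if f: "f \<in> W a" for f g a
  proof (induction g rule: homogeneous_induct)
    case (homogeneous b g)
    have "proj (a + b + l) (D f * g) = proj (a + l) (D f) * g"
      using proj_mult_left[OF homogeneous, of "a + b + l" "D f"]
      by (simp add: mult.commute algebra_simps)
    moreover have "proj (a + b + l) (f * D g) = f * proj (b + l) (D g)"
      using proj_mult_left[OF f, of "a + b + l" "D g"] by (simp add: algebra_simps)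
    ultimately show ?case
      using hcomp_homogeneous[OF D mult_W[OF f homogeneous]]
        hcomp_homogeneous[OF D f] hcomp_homogeneous[OF D homogeneous]
      by (simp add: derivation_mult[OF assms] proj_add)
  next
    case (add g g')
    then show ?case by (simp add: distrib_left lin_add[OF hcomp_lin[OF D]] algebra_simps)
  qed
  show "hcomp D l (f * g) = hcomp D l f * g + f * hcomp D l g" for f g
  proof (induction f rule: homogeneous_induct)
    case (homogeneous a f)
    then show ?case by (rule 1)
  next
    case (add f f')
    then show ?case by (simp add: distrib_right lin_add[OF hcomp_lin[OF D]] algebra_simps)
  qed
qed

subsection \<open>Changing the grading group\<close>

definition coarsen :: "('g \<Rightarrow> 'h) \<Rightarrow> 'h \<Rightarrow> 'b set" where
  "coarsen h k = {f. \<forall>a. proj a f \<noteq> 0 \<longrightarrow> h a = k}"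

lemma W_subset_coarsen: "W a \<subseteq> coarsen h (h a)"
  using proj_homogeneous by (force simp: coarsen_def)

text \<open>Additivity is required on the weights only: the division with remainder by which weights
  are rescaled below is not additive elsewhere.\<close>

lemma grading_coarsen:
  fixes h :: "'g \<Rightarrow> 'h::ab_group_add"
  assumes "\<And>a b. a \<in> weights \<Longrightarrow> b \<in> weights \<Longrightarrow> h (a + b) = h a + h b"
  shows "grading scale (coarsen h)"
proof
  show "subspace (coarsen h k)" for k
  proof (rule subspaceI)
    show "f + g \<in> coarsen h k" if "f \<in> coarsen h k" "g \<in> coarsen h k" for f g
      unfolding coarsen_def mem_Collect_eq
    proof (intro allI impI)
      fix a assume "proj a (f + g) \<noteq> 0"
      then have "proj a f \<noteq> 0 \<or> proj a g \<noteq> 0" by (auto simp: proj_add)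
      then show "h a = k" using that by (auto simp: coarsen_def)
    qed
  qed (auto simp: coarsen_def proj_scale)
  show "span (\<Union>k. coarsen h k) = UNIV"
    using span_mono[of "\<Union>a. W a" "\<Union>k. coarsen h k"] W_subset_coarsen span_W by blast
  show "x k = 0" if F: "finite F" "\<And>k. k \<in> F \<Longrightarrow> x k \<in> coarsen h k" "sum x F = 0" "k \<in> F" for F x k
  proof -
    have "proj a (x k) = 0" for a
    proof (rule ccontr)
      assume a: "proj a (x k) \<noteq> 0"
      have "proj a (x l) = 0" if "l \<in> F - {k}" for l
        using that a F(2)[OF F(4)] F(2)[of l] by (auto simp: coarsen_def)
      then have "(\<Sum>l\<in>F. proj a (x l)) = proj a (x k)"
        using F by (simp add: sum.remove)
      then show False using F(3) a by (metis proj_sum proj_zero)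
    qed
    then show ?thesis by (metis sum_proj sum.neutral)
  qed
  have h0: "h 0 = 0" using assms[OF weights_zero weights_zero] by simp
  then show "1 \<in> coarsen h 0" using W_subset_coarsen[of 0 h] one_W by auto
  show "f * g \<in> coarsen h (k + l)" if fg: "f \<in> coarsen h k" "g \<in> coarsen h l" for f g k l
    unfolding coarsen_def
  proof (intro CollectI allI impI)
    fix a assume "proj a (f * g) \<noteq> 0"
    then obtain b where b: "proj b f \<noteq> 0" "proj (a - b) g \<noteq> 0"
      using proj_mult_nonzero by blast
    then have "b \<in> weights" "a - b \<in> weights"
      using supp_subset_weights by (auto simp: supp_def)
    then have "h a = h b + h (a - b)" using assms[of b "a - b"] by simp
    then show "h a = k + l" using b fg by (auto simp: coarsen_def)
  qed
qed

subsection \<open>The derivation given by an additive function of the degree\<close>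

text \<open>For the weight grading of a torus and a coordinate of the degree, this is the infinitesimal
  generator of a one-parameter subgroup.\<close>

definition degree_derivation :: "('g \<Rightarrow> int) \<Rightarrow> 'b \<Rightarrow> 'b" where
  "degree_derivation h f = (\<Sum>a\<in>supp f. scale (of_int (h a)) (proj a f))"

lemma degree_derivation_superset:
  assumes "finite F" and "supp f \<subseteq> F"
  shows "degree_derivation h f = (\<Sum>a\<in>F. scale (of_int (h a)) (proj a f))"
  unfolding degree_derivation_def using assms
  by (intro sum.mono_neutral_left) (auto simp: proj_notin_supp)

lemma degree_derivation_homogeneous:
  assumes "f \<in> W a"
  shows "degree_derivation h f = scale (of_int (h a)) f"
proof -
  have "supp f \<subseteq> {a}" using assms by (auto simp: supp_def proj_homogeneous[OF assms])
  then show ?thesis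
    using degree_derivation_superset[of "{a}" f h] assms by (simp add: proj_homogeneous[OF assms])
qed

lemma degree_derivation_lin: "lin (degree_derivation h)"
proof (rule linI)
  fix f g
  let ?F = "supp f \<union> supp g"
  have "supp (f + g) \<subseteq> ?F" by (auto simp: supp_def proj_add)
  then show "degree_derivation h (f + g) = degree_derivation h f + degree_derivation h g"
    by (simp add: degree_derivation_superset[of ?F] proj_add scale_right_distrib sum.distrib)
next
  fix c f
  have "supp (scale c f) \<subseteq> supp f" by (auto simp: supp_def proj_scale)
  then show "degree_derivation h (scale c f) = scale c (degree_derivation h f)"
    by (simp add: degree_derivation_superset[of "supp f"] proj_scale scale_sum_right mult.commute)
qed

lemma degree_derivation:
  assumes "\<And>a b. h (a + b) = h a + h b"
  shows "derivation scale (degree_derivation h)"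
proof (rule derivationI[OF degree_derivation_lin])
  note add = lin_add[OF degree_derivation_lin]
  have 1: "degree_derivation h (f * g) = degree_derivation h f * g + f * degree_derivation h g"
    if f: "f \<in> W a" for f g a
  proof (induction g rule: homogeneous_induct)
    case (homogeneous b g)
    then show ?case
      using degree_derivation_homogeneous[OF f] degree_derivation_homogeneous[OF homogeneous]
        degree_derivation_homogeneous[OF mult_W[OF f homogeneous]]
      by (simp add: assms scale_mult_left scale_mult_right scale_left_distrib)
  next
    case (add g g')
    then show ?case by (simp add: distrib_left lin_add[OF degree_derivation_lin] algebra_simps)
  qed
  show "degree_derivation h (f * g) = degree_derivation h f * g + f * degree_derivation h g" for f g
  proof (induction f rule: homogeneous_induct)
    case (homogeneous a f)
    then show ?case by (rule 1)
  next
    case (add f f')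
    then show ?case by (simp add: distrib_right lin_add[OF degree_derivation_lin] algebra_simps)
  qed
qed

lemma degree_derivation_commute:
  assumes "lin \<delta>" and "\<And>a f. f \<in> W a \<Longrightarrow> \<delta> f \<in> W a"
  shows "degree_derivation h (\<delta> f) = \<delta> (degree_derivation h f)"
proof (induction f rule: homogeneous_induct)
  case (homogeneous a f)
  then show ?case using assms by (simp add: degree_derivation_homogeneous lin_scale[OF assms(1)])
next
  case (add f g)
  then show ?case by (simp add: lin_add[OF degree_derivation_lin] lin_add[OF assms(1)])
qed

end

context comm_algebra
begin

section \<open>Diagonalizable derivations and generalized eigenspaces\<close>

definition diagonalizable :: "('b \<Rightarrow> 'b) \<Rightarrow> bool" where
  "diagonalizable D \<longleftrightarrow> (\<forall>f. \<exists>F x. finite F \<and> f = sum x F \<and>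
     (\<forall>m\<in>F. D (x m) = scale (of_int m) (x m)))"

definition shift :: "('b \<Rightarrow> 'b) \<Rightarrow> int \<Rightarrow> 'b \<Rightarrow> 'b" where
  "shift D c f = D f - scale (of_int c) f"

definition gen_eigenspace :: "('b \<Rightarrow> 'b) \<Rightarrow> int \<Rightarrow> 'b set" where
  "gen_eigenspace D c = {f. \<exists>n. (shift D c ^^ n) f = 0}"

text \<open>The vectors killed by a product of factors \<open>D - c\<close> with integers \<open>c\<close>.\<close>

inductive split_vector :: "('b \<Rightarrow> 'b) \<Rightarrow> 'b \<Rightarrow> bool" for D where
  zero: "split_vector D 0"
| shift: "split_vector D (shift D c f) \<Longrightarrow> split_vector D f"

context
  fixes D :: "'b \<Rightarrow> 'b"
  assumes D: "lin D"
begin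

lemma shift_lin: "lin (shift D c)"
  by (rule linI) (simp_all add: shift_def lin_add[OF D] lin_scale[OF D] algebra_simps
      scale_right_distrib scale_right_diff_distrib)

lemma gen_eigenspace_funpow:
  assumes "f \<in> gen_eigenspace D c"
  shows "\<exists>n. \<forall>m\<ge>n. (shift D c ^^ m) f = 0"
proof -
  obtain n where "(shift D c ^^ n) f = 0" using assms by (auto simp: gen_eigenspace_def)
  then show ?thesis using funpow_zero_mono[OF shift_lin] by blast
qed

lemma subspace_gen_eigenspace: "subspace (gen_eigenspace D c)"
proof (rule subspaceI)
  show "0 \<in> gen_eigenspace D c"
    by (auto simp: gen_eigenspace_def intro: exI[of _ 0])
next
  fix f g assume f: "f \<in> gen_eigenspace D c" and g: "g \<in> gen_eigenspace D c"
  from gen_eigenspace_funpow[OF f] obtain n where n: "\<And>k. n \<le> k \<Longrightarrow> (shift D c ^^ k) f = 0"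
    by blast
  from gen_eigenspace_funpow[OF g] obtain m where m: "\<And>k. m \<le> k \<Longrightarrow> (shift D c ^^ k) g = 0"
    by blast
  have "(shift D c ^^ (n + m)) (f + g) = 0"
    by (simp only: lin_add[OF lin_funpow[OF shift_lin]] n m le_add1 le_add2 add_0)
  then show "f + g \<in> gen_eigenspace D c" unfolding gen_eigenspace_def by blast
next
  fix a f assume "f \<in> gen_eigenspace D c"
  then show "scale a f \<in> gen_eigenspace D c"
    by (auto simp: gen_eigenspace_def lin_scale[OF lin_funpow[OF shift_lin]])
qed

lemma gen_eigenspace_of_shift: "shift D c f \<in> gen_eigenspace D c \<Longrightarrow> f \<in> gen_eigenspace D c"
  unfolding gen_eigenspace_def mem_Collect_eq by (metis funpow_Suc_right o_apply)

lemma gen_eigenspace_commute: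
  assumes "lin p" and "\<And>f. D (p f) = p (D f)" and "f \<in> gen_eigenspace D c"
  shows "p f \<in> gen_eigenspace D c"
proof -
  have "shift D c (p f) = p (shift D c f)" for f
    by (simp add: shift_def assms(2) lin_diff[OF assms(1)] lin_scale[OF assms(1)])
  then have "(shift D c ^^ n) (p f) = p ((shift D c ^^ n) f)" for n f
    by (rule funpow_commute[of "shift D c" p])
  moreover obtain n where "(shift D c ^^ n) f = 0" using assms(3) by (auto simp: gen_eigenspace_def)
  ultimately have "(shift D c ^^ n) (p f) = 0" using lin_zero[OF assms(1)] by simp
  then show ?thesis unfolding gen_eigenspace_def by blast
qed

lemma shift_shift: "shift D b f = shift D c f + scale (of_int (c - b)) f"
  by (simp add: shift_def scale_left_diff_distrib)

text \<open>On a generalized eigenspace for \<open>c \<noteq> b\<close>, the operator \<open>D - b\<close> is a nonzero scalar plus a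
  nilpotent operator, hence bijective.\<close>

lemma shift_inj:
  assumes "b \<noteq> c" and "f \<in> gen_eigenspace D c" and "shift D b f = 0"
  shows "f = 0"
proof -
  have 1: "shift D c f = scale (of_int (b - c)) f" using shift_shift[of c f b] assms(3) by simp
  have "(shift D c ^^ n) f = scale (of_int (b - c) ^ n) f" for n
    by (induction n) (simp_all add: lin_scale[OF shift_lin] 1 mult.commute)
  then show ?thesis using assms by (auto simp: gen_eigenspace_def)
qed

lemma shift_surj:
  assumes V: "subspace V" "\<And>f. f \<in> V \<Longrightarrow> D f \<in> V"
    and "b \<noteq> c" and "f \<in> gen_eigenspace D c" and "f \<in> V"
  shows "\<exists>g \<in> gen_eigenspace D c \<inter> V. shift D b g = f"
proof -
  have "\<exists>g \<in> gen_eigenspace D c \<inter> V. shift D b g = f" if "(shift D c ^^ n) f = 0" "f \<in> V" for n f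
    using that
  proof (induction n arbitrary: f)
    case 0
    then show ?case
      using subspace_0[OF subspace_gen_eigenspace] subspace_0[OF V(1)] lin_zero[OF shift_lin]
      by (intro bexI[of _ 0]) auto
  next
    case (Suc n)
    let ?e = "of_int (c - b) :: 'k"
    have e: "?e \<noteq> 0" using assms(3) by simp
    have f: "f \<in> gen_eigenspace D c" using Suc.prems unfolding gen_eigenspace_def by blast
    let ?f1 = "scale (inverse ?e) f"
    have "(shift D c ^^ n) (shift D c ?f1) = scale (inverse ?e) ((shift D c ^^ Suc n) f)"
      by (simp only: funpow_Suc_right o_apply lin_scale[OF shift_lin] lin_scale[OF lin_funpow[OF shift_lin]])
    then have "(shift D c ^^ n) (shift D c ?f1) = 0" using Suc.prems by simp
    moreover have "shift D c ?f1 \<in> V"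
      unfolding shift_def using Suc.prems
      by (intro subspace_diff[OF V(1)] subspace_scale[OF V(1)] V(2))
    ultimately obtain g where g: "g \<in> gen_eigenspace D c \<inter> V" "shift D b g = shift D c ?f1"
      using Suc.IH by blast
    have "shift D b (?f1 - g) = scale ?e ?f1"
      by (simp only: lin_diff[OF shift_lin] g(2) shift_shift[of b ?f1 c]) simp
    also have "\<dots> = f" using e by simp
    finally have "shift D b (?f1 - g) = f" .
    moreover have "?f1 - g \<in> gen_eigenspace D c \<inter> V"
      using f g Suc.prems
      by (intro IntI subspace_diff[OF V(1)] subspace_scale[OF V(1)]
          subspace_diff[OF subspace_gen_eigenspace] subspace_scale[OF subspace_gen_eigenspace]) auto
    ultimately show ?case by blast
  qed
  then show ?thesis using assms(4,5) unfolding gen_eigenspace_def by blast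
qed

text \<open>A power of \<open>D - b\<close> removes the summand for \<open>b\<close> and is injective on the other generalized
  eigenspaces.\<close>

lemma gen_eigenspace_independent:
  assumes "finite F" and "\<And>c. c \<in> F \<Longrightarrow> x c \<in> gen_eigenspace D c" and "sum x F = 0" and "c \<in> F"
  shows "x c = 0"
  using assms
proof (induction F arbitrary: x c rule: finite_induct)
  case (insert b F)
  from insert.prems(1) have "x b \<in> gen_eigenspace D b" by blast
  then obtain n where n: "(shift D b ^^ n) (x b) = 0" unfolding gen_eigenspace_def by blast
  let ?P = "shift D b ^^ n"
  have P: "lin ?P" by (rule lin_funpow[OF shift_lin])
  have "?P (x b) + (\<Sum>c\<in>F. ?P (x c)) = ?P (sum x (insert b F))"
    using insert.hyps by (simp add: lin_add[OF P] lin_sum[OF P])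
  then have 0: "(\<Sum>c\<in>F. ?P (x c)) = 0" using insert.prems(2) n lin_zero[OF P] by simp
  have Dshift: "D (shift D b f) = shift D b (D f)" for f
    by (simp add: shift_def lin_diff[OF D] lin_scale[OF D])
  have DP: "D (?P f) = ?P (D f)" for f
    using funpow_commute[of "shift D b" D n f] Dshift by simp
  have "?P (x c) = 0" if "c \<in> F" for c
  proof (rule insert.IH[OF _ 0 that])
    fix c assume "c \<in> F"
    then show "?P (x c) \<in> gen_eigenspace D c"
      using gen_eigenspace_commute[OF P DP] insert.prems(1) by blast
  qed
  then have F: "x c = 0" if c: "c \<in> F" for c
  proof -
    have "(shift D b ^^ k) (x c) = 0 \<Longrightarrow> x c = 0" for k
    proof (induction k)
      case (Suc k)
      have "(shift D b ^^ k) (x c) \<in> gen_eigenspace D c"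
      proof (rule gen_eigenspace_commute[OF lin_funpow[OF shift_lin]])
        show "D ((shift D b ^^ k) f) = (shift D b ^^ k) (D f)" for f
          using funpow_commute[of "shift D b" D k f] Dshift by simp
        show "x c \<in> gen_eigenspace D c" using insert.prems(1) c by blast
      qed
      then have "(shift D b ^^ k) (x c) = 0"
        using shift_inj[of b c] Suc.prems insert.hyps c by auto
      then show ?case by (rule Suc.IH)
    qed simp
    then show ?thesis using \<open>\<And>c. c \<in> F \<Longrightarrow> ?P (x c) = 0\<close> c by blast
  qed
  have "sum x F = 0" using F by simp
  then have "x b = 0" using insert.prems(2) insert.hyps by simp
  then show ?case using F insert.prems(3) by blast
qed simp

text \<open>If \<open>(D - b) f\<close> is a sum of generalized eigenvectors, the equation \<open>(D - b) h = (D - b) f\<close> can be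
  solved by such a sum \<open>h\<close> up to an error in the generalized eigenspace for \<open>b\<close>, which then
  contains \<open>f - h\<close>. The invariant subspace \<open>V\<close> will be a weight space of a torus.\<close>

lemma split_vector_span:
  assumes "split_vector D f" and V: "subspace V" "\<And>f. f \<in> V \<Longrightarrow> D f \<in> V" and "f \<in> V"
  shows "f \<in> span (\<Union>c. gen_eigenspace D c \<inter> V)"
  using assms(1,4)
proof induction
  case zero
  show ?case by (rule span_zero)
next
  case (shift b f)
  let ?G = "\<lambda>c. gen_eigenspace D c \<inter> V"
  have "shift D b f \<in> V"
    unfolding shift_def using shift.prems
    by (intro subspace_diff[OF V(1)] subspace_scale[OF V(1)] V(2))
  then have "shift D b f \<in> span (\<Union>c. ?G c)" by (rule shift.IH)
  moreover have "\<exists>h \<in> span (\<Union>c. ?G c) \<inter> V. shift D b h - g \<in> ?G b" if "g \<in> span (\<Union>c. ?G c)" for g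
    using that
  proof (induction rule: span_induct_alt)
    case base
    show ?case using span_zero V(1) subspace_0 subspace_gen_eigenspace lin_zero[OF shift_lin]
      by (intro bexI[of _ 0]) auto
  next
    case (step a g g')
    then obtain c where c: "g \<in> ?G c" by blast
    have "\<exists>h \<in> ?G c. shift D b h - g \<in> ?G b"
    proof (cases "c = b")
      case True
      have "- g \<in> ?G b"
        using c True subspace_neg[OF V(1)] subspace_neg[OF subspace_gen_eigenspace] by blast
      moreover have "0 \<in> ?G c"
        using subspace_0 subspace_gen_eigenspace V(1) by blast
      ultimately show ?thesis using lin_zero[OF shift_lin] by (intro bexI[of _ 0]) auto
    next
      case False
      then obtain h where "h \<in> ?G c" "shift D b h = g" using shift_surj[OF V, of b c g] c by auto
      then show ?thesis
        using subspace_0 subspace_gen_eigenspace V(1) by (intro bexI[of _ h]) auto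
    qed
    then obtain h where h: "h \<in> ?G c" "shift D b h - g \<in> ?G b" by blast
    obtain h' where h': "h' \<in> span (\<Union>c. ?G c) \<inter> V" "shift D b h' - g' \<in> ?G b"
      using step.IH by blast
    have "shift D b (scale a h + h') - (scale a g + g')
        = scale a (shift D b h - g) + (shift D b h' - g')"
      by (simp add: lin_add[OF shift_lin] lin_scale[OF shift_lin] scale_right_diff_distrib)
    moreover have "\<dots> \<in> ?G b"
      using h(2) h'(2) subspace_add[OF subspace_inter] subspace_scale[OF subspace_inter]
      using subspace_gen_eigenspace V(1) by blast
    moreover have "h \<in> span (\<Union>c. ?G c) \<inter> V" using h(1) by (blast intro: span_base)
    then have "scale a h + h' \<in> span (\<Union>c. ?G c) \<inter> V"
      using h' subspace_add[OF V(1)] subspace_scale[OF V(1)] span_add span_scale by blast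
    ultimately show ?case by metis
  qed
  ultimately obtain h where h: "h \<in> span (\<Union>c. ?G c) \<inter> V" "shift D b h - shift D b f \<in> ?G b"
    by blast
  then have "shift D b (h - f) \<in> gen_eigenspace D b" by (simp add: lin_diff[OF shift_lin])
  then have "h - f \<in> gen_eigenspace D b" by (rule gen_eigenspace_of_shift)
  moreover have "h - f \<in> V" using h shift.prems V(1) subspace_diff by blast
  ultimately have "h - f \<in> span (\<Union>c. ?G c)" by (intro span_base) blast
  then have "h - (h - f) \<in> span (\<Union>c. ?G c)" using h span_diff by blast
  then show ?case by simp
qed

lemma diagonalizable_gen_eigenvector:
  assumes "diagonalizable D" and "f \<in> gen_eigenspace D c"
  shows "D f = scale (of_int c) f"
proof -
  obtain F x where x: "finite F" "f = sum x F" "\<And>m. m \<in> F \<Longrightarrow> D (x m) = scale (of_int m) (x m)"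
    using assms(1) unfolding diagonalizable_def by metis
  have eig: "x m \<in> gen_eigenspace D m" if "m \<in> F" for m
    unfolding gen_eigenspace_def using x(3)[OF that] by (auto simp: shift_def intro: exI[of _ 1])
  let ?F = "insert c F"
  define y where "y m = (if m \<in> F then x m else 0) - (if m = c then f else 0)" for m
  have "y m \<in> gen_eigenspace D m" if "m \<in> ?F" for m
    unfolding y_def using eig that assms(2) subspace_0[OF subspace_gen_eigenspace]
    by (intro subspace_diff[OF subspace_gen_eigenspace]) auto
  moreover have "sum y ?F = 0"
  proof -
    have "(\<Sum>m\<in>?F. if m \<in> F then x m else 0) = sum x F"
      using x(1) by (intro sum.mono_neutral_cong_right) auto
    then show ?thesis using x(1) x(2)[symmetric] by (simp add: y_def sum_subtractf)
  qed
  ultimately have "y c = 0" using gen_eigenspace_independent[of ?F y c] x(1) by blast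
  then show ?thesis using x(3)[of c] lin_zero[OF D] by (auto simp: y_def split: if_splits)
qed

end

lemma gen_eigenspace_one:
  assumes "derivation scale D"
  shows "1 \<in> gen_eigenspace D 0"
  using derivation_one[OF assms] by (auto simp: gen_eigenspace_def shift_def intro: exI[of _ 1])

lemma gen_eigenspace_mult:
  assumes D: "derivation scale D"
    and "f \<in> gen_eigenspace D c" and "g \<in> gen_eigenspace D d"
  shows "f * g \<in> gen_eigenspace D (c + d)"
proof -
  note lin = derivation_lin[OF D]
  have leibniz: "shift D (c + d) (f * g) = shift D c f * g + f * shift D d g" for f g
    by (simp add: shift_def derivation_mult[OF D] scale_left_distrib scale_mult_left
        scale_mult_right algebra_simps)
  have "f * g \<in> gen_eigenspace D (c + d)"
    if "(shift D c ^^ n) f = 0" "(shift D d ^^ m) g = 0" for n m f g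
    using that
  proof (induction "n + m" arbitrary: n m f g rule: less_induct)
    case less
    show ?case
    proof (cases "n = 0 \<or> m = 0")
      case True
      then show ?thesis using less.prems subspace_0[OF subspace_gen_eigenspace[OF lin]] by auto
    next
      case False
      then obtain n' m' where nm: "n = Suc n'" "m = Suc m'" using not0_implies_Suc by blast
      have "shift D c f * g \<in> gen_eigenspace D (c + d)"
        using less.prems nm by (intro less.hyps[of n' m]) (auto simp: funpow_swap1)
      moreover have "f * shift D d g \<in> gen_eigenspace D (c + d)"
        using less.prems nm by (intro less.hyps[of n m']) (auto simp: funpow_swap1)
      ultimately have "shift D (c + d) (f * g) \<in> gen_eigenspace D (c + d)"
        unfolding leibniz by (intro subspace_add[OF subspace_gen_eigenspace[OF lin]])
      then show ?thesis by (rule gen_eigenspace_of_shift[OF lin])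
    qed
  qed
  then show ?thesis using assms(2,3) unfolding gen_eigenspace_def by blast
qed

end

context comm_algebra
begin

section \<open>Homogeneity on the kernel of a maximal locally nilpotent derivation\<close>

text \<open>
  Suppose that some component of nonzero degree of \<open>D\<close> does not vanish on \<open>Ker \<delta>\<close>, and take the
  one, \<open>P\<close>, of the largest degree \<open>\<mu>\<close>, in the case where \<open>\<mu>\<close> is positive. On a homogeneous
  element of degree \<open>k\<close> of \<open>Ker \<delta>\<close> the top component of \<open>D\<^sup>n\<close> is \<open>P\<^sup>n\<close>, in degree \<open>k + n \<mu>\<close>. As
  \<open>D\<close> is diagonalizable, the degrees that occur are bounded, so that \<open>P\<close> is locally nilpotent on
  \<open>Ker \<delta>\<close>, hence everywhere. Now \<open>P\<close> contradicts the maximality of \<open>\<delta>\<close>. The parameter \<open>s\<close> of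
  the claim \<open>up\<close> covers the positive and the negative degrees at once.
\<close>

lemma homogeneous_on_kernel_of_maximal_LND:
  fixes W :: "int \<Rightarrow> 'b set"
  assumes W: "grading scale W"
    and max: "maximal_LND scale \<delta>" and \<delta>W: "\<And>a f. f \<in> W a \<Longrightarrow> \<delta> f \<in> W a"
    and D: "derivation scale D" and diag: "diagonalizable D"
    and comm: "\<And>f. D (\<delta> f) = \<delta> (D f)"
    and fin: "finite {l. \<exists>f. grading.hcomp W D l f \<noteq> 0}"
    and "\<delta> f = 0" and "f \<in> W k"
  shows "D f \<in> W k"
proof -
  interpret W: grading scale W by fact
  have LND: "LND scale \<delta>" using max by (simp add: maximal_LND_def)
  then have lin\<delta>: "lin \<delta>" by (simp add: LND_def derivation_lin)
  have linD: "lin D" by (rule derivation_lin[OF D])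
  have proj_ker: "\<delta> (W.proj a f) = 0" if "\<delta> f = 0" for a f
    using W.proj_commute[OF lin\<delta> \<delta>W, of a f] that by simp
  have up: "W.hcomp D l f = 0" if s: "s * l > 0" and f: "\<delta> f = 0" for s l f
  proof (rule ccontr)
    assume nz: "W.hcomp D l f \<noteq> 0"
    define M where "M = {l. s * l > 0 \<and> (\<exists>f. \<delta> f = 0 \<and> W.hcomp D l f \<noteq> 0)}"
    have "finite M" by (rule finite_subset[OF _ fin]) (auto simp: M_def)
    moreover have "l \<in> M" using s f nz by (auto simp: M_def)
    ultimately have "Max ((*) s ` M) \<in> (*) s ` M" by (intro Max_in) auto
    then obtain \<mu> where \<mu>: "\<mu> \<in> M" "Max ((*) s ` M) = s * \<mu>" by auto
    have \<mu>_max: "s * l \<le> s * \<mu>" if "l \<in> M" for l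
      unfolding \<mu>(2)[symmetric] using \<open>finite M\<close> that by (intro Max_ge) auto
    have s\<mu>: "s * \<mu> > 0" using \<mu>(1) by (simp add: M_def)
    then have s0: "s \<noteq> 0" and \<mu>0: "\<mu> \<noteq> 0" by auto
    define P where "P = W.hcomp D \<mu>"
    have P: "derivation scale P" unfolding P_def by (rule W.hcomp_derivation[OF D])
    then have linP: "lin P" by (rule derivation_lin)
    have commP: "P (\<delta> f) = \<delta> (P f)" for f
      unfolding P_def by (rule W.hcomp_commute[OF linD lin\<delta> \<delta>W comm])
    have vanish: "W.proj j (D g) = 0" if "g \<in> W a" "\<delta> g = 0" "s * (j - a) > s * \<mu>" for g a j
    proof -
      have "W.proj j (D g) = W.hcomp D (j - a) g"
        using W.hcomp_homogeneous[OF linD that(1), of "j - a"] by simp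
      moreover have "j - a \<notin> M" using \<mu>_max[of "j - a"] that(3) by linarith
      ultimately show ?thesis using that s\<mu> by (auto simp: M_def)
    qed
    have step: "(\<forall>j. s * j > s * (K + \<mu>) \<longrightarrow> W.proj j (D g) = 0) \<and>
        W.proj (K + \<mu>) (D g) = P (W.proj K g)"
      if g: "\<delta> g = 0" and K: "\<forall>j. s * j > s * K \<longrightarrow> W.proj j g = 0" for g K
    proof -
      have expand: "W.proj j (D g) = (\<Sum>a\<in>W.supp g. W.proj j (D (W.proj a g)))" for j
        using W.sum_proj[of g] lin_sum[OF linD] W.proj_sum by metis
      have small: "s * a \<le> s * K" if "a \<in> W.supp g" for a
        using K that unfolding W.supp_def by force
      have "W.proj j (D g) = 0" if j: "s * j > s * (K + \<mu>)" for j
        unfolding expand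
      proof (intro sum.neutral ballI)
        fix a assume "a \<in> W.supp g"
        then have "s * (j - a) > s * \<mu>"
          using small[of a] j unfolding right_diff_distrib distrib_left by linarith
        then show "W.proj j (D (W.proj a g)) = 0"
          using vanish[OF W.proj_in_W proj_ker[OF g]] by blast
      qed
      moreover have "W.proj (K + \<mu>) (D g) = P (W.proj K g)"
      proof -
        have "W.proj (K + \<mu>) (D (W.proj a g)) = 0" if a: "a \<in> W.supp g - {K}" for a
        proof -
          have "s * a \<noteq> s * K" using a s0 by auto
          moreover have "s * a \<le> s * K" using a by (intro small) simp
          ultimately have "s * a < s * K" by (rule le_neq_trans[rotated])
          then have "s * (K + \<mu> - a) > s * \<mu>"
            unfolding right_diff_distrib distrib_left by linarith
          then show ?thesis using vanish[OF W.proj_in_W proj_ker[OF g]] by blast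
        qed
        then have "(\<Sum>a\<in>W.supp g. W.proj (K + \<mu>) (D (W.proj a g)))
            = (\<Sum>a\<in>W.supp g \<inter> {K}. W.proj (K + \<mu>) (D (W.proj a g)))"
          by (intro sum.mono_neutral_right) auto
        also have "\<dots> = W.proj (K + \<mu>) (D (W.proj K g))"
          using W.proj_notin_supp[of K g] lin_zero[OF linD] by (cases "K \<in> W.supp g") simp_all
        also have "\<dots> = P (W.proj K g)"
          unfolding P_def by (rule W.hcomp_homogeneous[OF linD W.proj_in_W, symmetric])
        finally show ?thesis by (simp add: expand)
      qed
      ultimately show ?thesis by blast
    qed
    have nilp_hom: "\<exists>n. (P ^^ n) g = 0" if g: "\<delta> g = 0" "g \<in> W k" for g k
    proof -
      have top: "\<delta> ((D ^^ n) g) = 0 \<and>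
          (\<forall>j. s * j > s * (k + int n * \<mu>) \<longrightarrow> W.proj j ((D ^^ n) g) = 0) \<and>
          W.proj (k + int n * \<mu>) ((D ^^ n) g) = (P ^^ n) g" for n
      proof (induction n)
        case 0
        then show ?case using g by (auto simp: W.proj_homogeneous[OF g(2)])
      next
        case (Suc n)
        have degree: "k + int (Suc n) * \<mu> = (k + int n * \<mu>) + \<mu>" by (simp add: algebra_simps)
        have iterate: "(Q ^^ Suc n) g = Q ((Q ^^ n) g)" for Q :: "'b \<Rightarrow> 'b" by simp
        let ?h = "(D ^^ n) g" and ?K = "k + int n * \<mu>"
        have IH: "\<delta> ?h = 0" "\<forall>j. s * j > s * ?K \<longrightarrow> W.proj j ?h = 0"
          "W.proj ?K ?h = (P ^^ n) g"
          using Suc.IH by blast+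
        have "\<delta> (D ?h) = 0"
          unfolding comm[symmetric] IH(1) by (rule lin_zero[OF linD])
        moreover note step[OF IH(1,2)]
        ultimately show ?case
          unfolding degree iterate IH(3) by (intro conjI) (erule conjunct1 conjunct2 | assumption)+
      qed
      obtain F x where x: "finite F" "g = sum x F" "\<And>m. m \<in> F \<Longrightarrow> D (x m) = scale (of_int m) (x m)"
        using diag unfolding diagonalizable_def by metis
      have "(D ^^ n) (x m) = scale (of_int m ^ n) (x m)" if "m \<in> F" for n m
        by (induction n) (simp_all add: x(3)[OF that] lin_scale[OF linD] mult.commute)
      then have Dn: "(D ^^ n) g = (\<Sum>m\<in>F. scale (of_int m ^ n) (x m))" for n
        unfolding x(2) by (simp add: lin_sum[OF lin_funpow[OF linD]])
      define S where "S = (\<Union>m\<in>F. W.supp (x m))"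
      have S: "W.proj j ((D ^^ n) g) = 0" if "j \<notin> S" for j n
        using that unfolding Dn W.proj_sum
        by (intro sum.neutral) (auto simp: S_def W.supp_def W.proj_scale)
      have "finite S" using x(1) by (simp add: S_def)
      moreover have "inj (\<lambda>n. k + int n * \<mu>)" using \<mu>0 by (auto intro: injI)
      ultimately have "\<not> range (\<lambda>n. k + int n * \<mu>) \<subseteq> S"
        using range_inj_infinite finite_subset by blast
      then obtain n where "k + int n * \<mu> \<notin> S" by blast
      then show ?thesis using S top by metis
    qed
    have ker: "\<exists>n. (P ^^ n) g = 0" if g: "\<delta> g = 0" for g
    proof -
      have "shift P 0 = P" by (simp add: shift_def fun_eq_iff)
      then have gen: "f \<in> gen_eigenspace P 0 \<longleftrightarrow> (\<exists>n. (P ^^ n) f = 0)" for f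
        by (simp add: gen_eigenspace_def)
      have "(\<Sum>a\<in>W.supp g. W.proj a g) \<in> gen_eigenspace P 0"
        using nilp_hom[OF proj_ker[OF g] W.proj_in_W] gen
        by (intro subspace_sum[OF subspace_gen_eigenspace[OF linP]]) blast
      then show ?thesis using gen W.sum_proj by simp
    qed
    have "\<exists>n. (P ^^ n) g = 0" for g
      by (rule locally_nilpotent_if_on_kernel[OF linP commP LND ker])
    then have "LND scale P" using P by (simp add: LND_def)
    moreover obtain g where g: "\<delta> g = 0" "P g \<noteq> 0" using \<mu>(1) by (auto simp: M_def P_def)
    moreover have "P \<circ> \<delta> = \<delta> \<circ> P" using commP by (simp add: fun_eq_iff)
    moreover have "P \<noteq> (\<lambda>_. 0)" using g(2) by auto
    ultimately have "Ker P = Ker \<delta>" using max unfolding maximal_LND_def by blast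
    then show False using g by (auto simp: Ker_def)
  qed
  show ?thesis unfolding W.homogeneous_iff
  proof (intro allI impI)
    fix j assume "j \<noteq> k"
    then have "sgn (j - k) * (j - k) > 0" by (simp add: sgn_if)
    moreover have "W.proj j (D f) = W.hcomp D (j - k) f"
      using W.hcomp_homogeneous[OF linD assms(9), of "j - k"] by simp
    ultimately show "W.proj j (D f) = 0" using up assms(8) by simp
  qed
qed

section \<open>Vector valued maps with coefficients in an algebra of functions\<close>

abbreviation functional :: "('b \<Rightarrow> 'k) \<Rightarrow> bool" where
  "functional \<equiv> Vector_Spaces.linear scale (*)"

lemma vector_space_pair_field: "vector_space_pair scale ((*) :: 'k \<Rightarrow> 'k \<Rightarrow> 'k)"
  by (intro vector_space_pair.intro vector_space_axioms) (unfold_locales; simp add: algebra_simps)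

lemma
  assumes "functional l"
  shows functional_add: "l (f + g) = l f + l g"
    and functional_scale: "l (scale c f) = c * l f"
    and functional_zero: "l 0 = 0"
    and functional_sum: "l (sum x F) = (\<Sum>a\<in>F. l (x a))"
proof -
  interpret l: module_hom scale "(*)" l
    using assms by (simp add: linear_iff_module_hom)
  show "l (f + g) = l f + l g" "l (scale c f) = c * l f" "l 0 = 0"
    "l (sum x F) = (\<Sum>a\<in>F. l (x a))"
    by (simp_all add: l.add l.scale l.zero l.sum)
qed

lemma functional_exists:
  assumes "independent B"
  shows "\<exists>l. functional l \<and> (\<forall>b\<in>B. l b = c b)"
  by (rule vector_space_pair.linear_independent_extend[OF vector_space_pair_field assms])

lemma functional_separating:
  assumes "f \<notin> span S"
  shows "\<exists>l. functional l \<and> l f = 1 \<and> (\<forall>g\<in>S. l g = 0)"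
proof -
  obtain B where B: "B \<subseteq> S" "independent B" "S \<subseteq> span B"
    by (rule maximal_independent_subset)
  then have "span B = span S" by (metis span_eq span_superset subset_trans)
  then have "independent (insert f B)" using assms B(2) independent_insertI by metis
  then obtain l where l: "functional l" "\<forall>b\<in>insert f B. l b = (if b = f then 1 else 0)"
    using functional_exists[of "insert f B" "\<lambda>b. if b = f then 1 else 0"] by blast
  have "f \<notin> B" using assms \<open>span B = span S\<close> span_base by blast
  have "l g = 0" if "g \<in> span B" for g
    using that
  proof (induction rule: span_induct_alt)
    case base
    show ?case by (rule functional_zero[OF l(1)])
  next
    case (step c b g)
    then have "l b = 0" using l(2) \<open>f \<notin> B\<close> by auto
    then show ?case using step by (simp add: functional_add[OF l(1)] functional_scale[OF l(1)])
  qed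
  then show ?thesis using l B(3) by (intro exI[of _ l]) auto
qed

text \<open>Coordinates with respect to a basis of the span of \<open>S\<close>, extended to the whole space because
  the regular functions on the automorphism group are made from functionals on the whole
  algebra.\<close>

lemma span_coordinates:
  assumes "finite S"
  shows "\<exists>B l. finite B \<and> (\<forall>b. functional (l b)) \<and> (\<forall>f\<in>span S. f = (\<Sum>b\<in>B. scale (l b f) b))"
proof -
  obtain B where B: "B \<subseteq> S" "independent B" "S \<subseteq> span B"
    by (rule maximal_independent_subset)
  have fin: "finite B" using B(1) assms finite_subset by blast
  have "\<exists>l. functional l \<and> (\<forall>b\<in>B. l b = (if b = b' then 1 else 0))" for b'
    using functional_exists[OF B(2)] .
  then obtain l where l: "\<And>b'. functional (l b')" "\<And>b b'. b \<in> B \<Longrightarrow> l b' b = (if b = b' then 1 else 0)"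
    by metis
  have "f = (\<Sum>b\<in>B. scale (l b f) b)" if "f \<in> span S" for f
  proof -
    have "f \<in> span B" using that B(3) by (metis span_minimal subspace_span subsetD)
    then show ?thesis
    proof (induction rule: span_induct_alt)
      case base
      then show ?case by (simp add: functional_zero[OF l(1)])
    next
      case (step c b g)
      have "(\<Sum>b'\<in>B. scale (l b' b) b') = (\<Sum>b'\<in>B. if b' = b then b else 0)"
        using l(2)[OF step(1)] by (intro sum.cong) auto
      also have "\<dots> = b" using fin step(1) by simp
      finally have "scale c (\<Sum>b'\<in>B. scale (l b' b) b') = scale c b" by simp
      then show ?case using step(2)
        by (simp add: functional_add[OF l(1)] functional_scale[OF l(1)] scale_left_distrib
            sum.distrib scale_sum_right)
    qed
  qed
  then show ?thesis using fin l(1) by blast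
qed

inductive_set vector_maps :: "('a \<Rightarrow> 'k) set \<Rightarrow> ('a \<Rightarrow> 'b) set" for R where
  scale: "P \<in> R \<Longrightarrow> (\<lambda>t. scale (P t) v) \<in> vector_maps R"
| add: "F \<in> vector_maps R \<Longrightarrow> G \<in> vector_maps R \<Longrightarrow> (\<lambda>t. F t + G t) \<in> vector_maps R"

lemma vector_maps_const: "(\<lambda>_. v) \<in> vector_maps (fun_algebra R)"
  using vector_maps.scale[OF fun_algebra.const[of 1 R], of v] by simp

lemma vector_maps_sum:
  assumes "\<And>i. i \<in> I \<Longrightarrow> F i \<in> vector_maps (fun_algebra R)"
  shows "(\<lambda>t. \<Sum>i\<in>I. F i t) \<in> vector_maps (fun_algebra R)"
  using assms
proof (induction I rule: infinite_finite_induct)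
  case (insert i I)
  then show ?case using vector_maps.add[of "F i"] by simp
qed (simp_all add: vector_maps_const)

lemma vector_maps_mult:
  assumes "F \<in> vector_maps (fun_algebra R)" and "G \<in> vector_maps (fun_algebra R)"
  shows "(\<lambda>t. F t * G t) \<in> vector_maps (fun_algebra R)"
  using assms(1)
proof induction
  case (scale P v)
  show ?case using assms(2)
  proof induction
    case (scale Q w)
    have "(\<lambda>t. scale (P t * Q t) (v * w)) \<in> vector_maps (fun_algebra R)"
      by (rule vector_maps.scale[OF fun_algebra.mult[OF \<open>P \<in> _\<close> scale]])
    then show ?case by (simp add: scale_mult_left scale_mult_right mult.commute)
  next
    case (add G G')
    then show ?case using vector_maps.add[OF add(3,4)] by (simp add: distrib_left)
  qed
next
  case (add F F')
  then show ?case using vector_maps.add[OF add(3,4)] by (simp add: distrib_right)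
qed

lemma functional_vector_maps:
  assumes "functional l" and "F \<in> vector_maps (fun_algebra R)"
  shows "(\<lambda>t. l (F t)) \<in> fun_algebra R"
  using assms(2)
proof induction
  case (scale P v)
  show ?case using fun_algebra.mult[OF scale fun_algebra.const[of "l v"]]
    by (simp add: functional_scale[OF assms(1)])
next
  case (add F G)
  then show ?case using fun_algebra.add[OF add(3,4)] by (simp add: functional_add[OF assms(1)])
qed

end

section \<open>Coordinate algebras and their automorphisms\<close>

lemma fun_algebra_prod:
  assumes "\<And>i. i \<in> I \<Longrightarrow> f i \<in> fun_algebra R"
  shows "(\<lambda>t. \<Prod>i\<in>I. f i t) \<in> fun_algebra R"
  using assms
proof (induction I rule: infinite_finite_induct)
  case (insert i I)
  then show ?case using fun_algebra.mult[of "f i"] by simp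
qed (simp_all add: fun_algebra.const)

lemma fun_algebra_sum:
  assumes "\<And>i. i \<in> I \<Longrightarrow> f i \<in> fun_algebra R"
  shows "(\<lambda>t. \<Sum>i\<in>I. f i t) \<in> fun_algebra R"
  using assms
proof (induction I rule: infinite_finite_induct)
  case (insert i I)
  then show ?case using fun_algebra.add[of "f i"] by simp
qed (simp_all add: fun_algebra.const)

lemma fun_algebra_power:
  assumes "f \<in> fun_algebra R"
  shows "(\<lambda>t. f t ^ n) \<in> fun_algebra R"
  using fun_algebra_prod[of "{..<n}" "\<lambda>_. f"] assms by simp

context coordinate_algebra
begin

lemma ev_in: "ev f \<in> regular_functions X"
  using ev_bij by (auto simp: bij_betw_def)

lemma ev_eqI:
  assumes "\<And>p. p \<in> X \<Longrightarrow> ev f p = ev g p"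
  shows "f = g"
proof -
  obtain u v where u: "ev f = restrict u X" and v: "ev g = restrict v X"
    using ev_in unfolding regular_functions_def by blast
  then have "ev f = ev g" using assms by (auto simp: fun_eq_iff restrict_def)
  then show ?thesis using ev_bij by (metis bij_betw_imp_inj_on inj_eq)
qed

lemma ev_coord:
  assumes "p \<in> X"
  shows "ev (coord X ev i) p = p i"
proof -
  have "(\<lambda>p. p i) \<in> affine_space_funs"
    unfolding affine_space_funs_def by (rule fun_algebra.generator) blast
  then have "(\<lambda>p\<in>X. p i) \<in> ev ` UNIV"
    using ev_bij unfolding regular_functions_def bij_betw_def by blast
  then have "ev (coord X ev i) = (\<lambda>p\<in>X. p i)"
    unfolding coord_def by (rule f_inv_into_f)
  then show ?thesis using assms by simp
qed

sublocale comm_algebra scale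
  by unfold_locales (rule ev_eqI, simp add: ev_mult ev_scale)

abbreviation x :: "'n \<Rightarrow> 'b" where
  "x \<equiv> coord X ev"

lemma coordinate_induct [consumes 0, case_names const coord add mult]:
  assumes "\<And>c. P (scale c 1)" and "\<And>i. P (x i)"
    and "\<And>f g. P f \<Longrightarrow> P g \<Longrightarrow> P (f + g)" and "\<And>f g. P f \<Longrightarrow> P g \<Longrightarrow> P (f * g)"
  shows "P f"
proof -
  obtain u where u: "u \<in> affine_space_funs" "ev f = restrict u X"
    using ev_in unfolding regular_functions_def by blast
  have "\<exists>g. P g \<and> (\<forall>p\<in>X. ev g p = u p)"
    using u(1) unfolding affine_space_funs_def
  proof induction
    case (const c)
    then show ?case using assms(1)[of c] by (auto simp: ev_scale ev_one intro!: exI[of _ "scale c 1"])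
  next
    case (generator g)
    then obtain i where "g = (\<lambda>p. p i)" by blast
    then show ?case using assms(2)[of i] by (auto simp: ev_coord)
  next
    case (add u v)
    then obtain f g where "P f" "\<forall>p\<in>X. ev f p = u p" "P g" "\<forall>p\<in>X. ev g p = v p" by blast
    then show ?case using assms(3)[of f g] by (auto simp: ev_add intro!: exI[of _ "f + g"])
  next
    case (mult u v)
    then obtain f g where "P f" "\<forall>p\<in>X. ev f p = u p" "P g" "\<forall>p\<in>X. ev g p = v p" by blast
    then show ?case using assms(4)[of f g] by (auto simp: ev_mult intro!: exI[of _ "f * g"])
  qed
  then obtain g where g: "P g" "\<forall>p\<in>X. ev g p = u p" by blast
  then have "f = g" using u(2) by (intro ev_eqI) simp
  then show ?thesis using g(1) by simp
qed

subsection \<open>Degree\<close>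

definition monomials :: "nat \<Rightarrow> 'b set" where
  "monomials d = {\<Prod>i\<in>UNIV. x i ^ e i | e. (\<Sum>i\<in>UNIV. e i) \<le> d}"

lemma degree_le_monomials: "degree_le scale X ev d = span (monomials d)"
  by (simp add: degree_le_def monomials_def)

lemma finite_monomials: "finite (monomials d)"
proof -
  have "{e :: 'n \<Rightarrow> nat. (\<Sum>i\<in>UNIV. e i) \<le> d} \<subseteq> (UNIV :: 'n set) \<rightarrow>\<^sub>E {..d}"
  proof
    fix e :: "'n \<Rightarrow> nat" assume e: "e \<in> {e. (\<Sum>i\<in>UNIV. e i) \<le> d}"
    have "e i \<le> d" for i
      using e member_le_sum[of i UNIV e] by auto
    then show "e \<in> UNIV \<rightarrow>\<^sub>E {..d}" by auto
  qed
  then have "finite {e :: 'n \<Rightarrow> nat. (\<Sum>i\<in>UNIV. e i) \<le> d}"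
    by (rule finite_subset) (simp add: finite_PiE)
  then have "finite ((\<lambda>e. \<Prod>i\<in>UNIV. x i ^ e i) ` {e. (\<Sum>i\<in>UNIV. e i) \<le> d})" by simp
  moreover have "(\<lambda>e. \<Prod>i\<in>UNIV. x i ^ e i) ` {e. (\<Sum>i\<in>UNIV. e i) \<le> d} = monomials d"
    by (auto simp: monomials_def)
  ultimately show ?thesis by simp
qed

lemma degree_le_mono: "d \<le> e \<Longrightarrow> degree_le scale X ev d \<subseteq> degree_le scale X ev e"
  unfolding degree_le_monomials monomials_def by (rule span_mono) force

lemma monomials_mult:
  assumes "f \<in> monomials d" and "g \<in> monomials e"
  shows "f * g \<in> monomials (d + e)"
proof -
  obtain a b where a: "f = (\<Prod>i\<in>UNIV. x i ^ a i)" "(\<Sum>i\<in>UNIV. a i) \<le> d"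
    and b: "g = (\<Prod>i\<in>UNIV. x i ^ b i)" "(\<Sum>i\<in>UNIV. b i) \<le> e"
    using assms unfolding monomials_def by blast
  then have "f * g = (\<Prod>i\<in>UNIV. x i ^ (a i + b i))" "(\<Sum>i\<in>UNIV. a i + b i) \<le> d + e"
    by (simp_all add: power_add prod.distrib sum.distrib)
  then show ?thesis
    unfolding monomials_def by (intro CollectI exI[of _ "\<lambda>i. a i + b i"] conjI)
qed

lemma degree_le_mult:
  assumes "f \<in> degree_le scale X ev d" and "g \<in> degree_le scale X ev e"
  shows "f * g \<in> degree_le scale X ev (d + e)"
  using assms(1) unfolding degree_le_monomials
proof (induction rule: span_induct_alt)
  case base
  show ?case by (simp add: span_zero)
next
  case (step c m f)
  have "m * g \<in> span (monomials (d + e))"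
    using assms(2) unfolding degree_le_monomials
  proof (induction rule: span_induct_alt)
    case (step c' m' g)
    then have "m * m' \<in> monomials (d + e)" using monomials_mult \<open>m \<in> _\<close> by blast
    then show ?case using step
      by (simp add: distrib_left scale_mult_right span_add span_scale span_base)
  qed (simp add: span_zero)
  then show ?case using step by (simp add: distrib_right scale_mult_left span_add span_scale)
qed

lemma degree_le_exists: "\<exists>d. f \<in> degree_le scale X ev d"
proof (induction f rule: coordinate_induct)
  case (const c)
  have "1 \<in> monomials 0" unfolding monomials_def by (auto intro!: exI[of _ "\<lambda>_. 0"])
  then show ?case unfolding degree_le_monomials by (blast intro: span_base span_scale)
next
  case (coord i)
  have "x i \<in> monomials 1"
    unfolding monomials_def
    by (auto intro!: exI[of _ "\<lambda>j. if j = i then 1 else 0"] simp: if_distrib[of "power _"] cong: if_cong)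
  then show ?case unfolding degree_le_monomials by (blast intro: span_base)
next
  case (add f g)
  then obtain d e where "f \<in> degree_le scale X ev d" "g \<in> degree_le scale X ev e" by blast
  then have "f \<in> degree_le scale X ev (d + e)" "g \<in> degree_le scale X ev (d + e)"
    using degree_le_mono[of d "d + e"] degree_le_mono[of e "d + e"] by auto
  then show ?case unfolding degree_le_monomials by (blast intro: span_add)
next
  case (mult f g)
  then show ?case using degree_le_mult by blast
qed

lemma degree_le_finite:
  assumes "finite S"
  shows "\<exists>d. S \<subseteq> degree_le scale X ev d"
  using assms
proof induction
  case (insert f S)
  then obtain d e where "f \<in> degree_le scale X ev d" "S \<subseteq> degree_le scale X ev e"
    using degree_le_exists by blast
  then have "insert f S \<subseteq> degree_le scale X ev (d + e)"
    using degree_le_mono[of d "d + e"] degree_le_mono[of e "d + e"] by auto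
  then show ?case by blast
qed simp

lemma subspace_degree_le: "subspace (degree_le scale X ev d)"
  unfolding degree_le_monomials by (rule subspace_span)

subsection \<open>Families of endomorphisms\<close>

text \<open>Boundedness of the degree lets the images of the coordinates be expanded in finitely many
  vectors; the coefficients are then regular functions, and the products that express the image
  of a general element remain of this form.\<close>

lemma bounded_family_vector_map:
  assumes hom: "\<And>t. t \<in> Z \<Longrightarrow> lin (\<sigma> t) \<and> (\<forall>f g. \<sigma> t (f * g) = \<sigma> t f * \<sigma> t g) \<and> \<sigma> t 1 = 1"
    and deg: "\<And>t i. t \<in> Z \<Longrightarrow> \<sigma> t (x i) \<in> degree_le scale X ev d"
    and reg: "\<And>l i. functional l \<Longrightarrow> \<exists>P \<in> fun_algebra R. \<forall>t\<in>Z. P t = l (\<sigma> t (x i))"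
  shows "\<exists>F \<in> vector_maps (fun_algebra R). \<forall>t\<in>Z. F t = \<sigma> t f"
proof (induction f rule: coordinate_induct)
  case (const c)
  show ?case using hom vector_maps_const[of "scale c 1"]
    by (intro bexI[of _ "\<lambda>_. scale c 1"]) (auto simp: lin_scale)
next
  case (coord i)
  obtain B l where B: "finite B" "\<And>b. functional (l b)"
    "\<And>f. f \<in> degree_le scale X ev d \<Longrightarrow> f = (\<Sum>b\<in>B. scale (l b f) b)"
    using span_coordinates[OF finite_monomials] unfolding degree_le_monomials by metis
  have "\<forall>b. \<exists>P. P \<in> fun_algebra R \<and> (\<forall>t\<in>Z. P t = l b (\<sigma> t (x i)))"
    using reg[OF B(2)] by blast
  from choice[OF this] obtain P
    where "\<forall>b. P b \<in> fun_algebra R \<and> (\<forall>t\<in>Z. P b t = l b (\<sigma> t (x i)))" ..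
  then have P: "\<And>b. P b \<in> fun_algebra R" "\<And>b t. t \<in> Z \<Longrightarrow> P b t = l b (\<sigma> t (x i))"
    by blast+
  have "(\<lambda>t. \<Sum>b\<in>B. scale (P b t) b) \<in> vector_maps (fun_algebra R)"
    by (intro vector_maps_sum vector_maps.scale P(1))
  moreover have "(\<Sum>b\<in>B. scale (P b t) b) = \<sigma> t (x i)" if "t \<in> Z" for t
    using B(3)[OF deg[OF that]] P(2)[OF that] by simp
  ultimately show ?case
    by (intro bexI[of _ "\<lambda>t. \<Sum>b\<in>B. scale (P b t) b"] ballI) simp_all
next
  case (add f g)
  then obtain F G where "F \<in> vector_maps (fun_algebra R)" "\<forall>t\<in>Z. F t = \<sigma> t f"
    "G \<in> vector_maps (fun_algebra R)" "\<forall>t\<in>Z. G t = \<sigma> t g" by blast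
  moreover have "\<sigma> t (f + g) = \<sigma> t f + \<sigma> t g" if "t \<in> Z" for t
    using hom[OF that] lin_add by blast
  ultimately show ?case by (intro bexI[of _ "\<lambda>t. F t + G t"]) (auto intro: vector_maps.add)
next
  case (mult f g)
  then obtain F G where "F \<in> vector_maps (fun_algebra R)" "\<forall>t\<in>Z. F t = \<sigma> t f"
    "G \<in> vector_maps (fun_algebra R)" "\<forall>t\<in>Z. G t = \<sigma> t g" by blast
  then show ?case using hom by (intro bexI[of _ "\<lambda>t. F t * G t"]) (auto intro: vector_maps_mult)
qed

lemma Aut_iff: "\<phi> \<in> carrier (Aut scale) \<longleftrightarrow>
    bij \<phi> \<and> lin \<phi> \<and> (\<forall>f g. \<phi> (f * g) = \<phi> f * \<phi> g) \<and> \<phi> 1 = 1"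
  by (simp add: Aut_def)

lemma Aut_inv:
  assumes "\<phi> \<in> carrier (Aut scale)"
  shows "inv_into UNIV \<phi> \<in> carrier (Aut scale)"
proof -
  have \<phi>: "bij \<phi>" "lin \<phi>" "\<And>f g. \<phi> (f * g) = \<phi> f * \<phi> g" "\<phi> 1 = 1" using assms by (auto simp: Aut_iff)
  let ?\<psi> = "inv_into UNIV \<phi>"
  have inv: "\<phi> (?\<psi> f) = f" "?\<psi> (\<phi> f) = f" for f
    using \<phi>(1) by (auto simp: bij_is_surj surj_f_inv_f bij_is_inj)
  have "lin ?\<psi>"
  proof (rule linI)
    show "?\<psi> (f + g) = ?\<psi> f + ?\<psi> g" for f g
      using inv(2)[of "?\<psi> f + ?\<psi> g"] by (simp add: lin_add[OF \<phi>(2)] inv)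
    show "?\<psi> (scale c f) = scale c (?\<psi> f)" for c f
      using inv(2)[of "scale c (?\<psi> f)"] by (simp add: lin_scale[OF \<phi>(2)] inv)
  qed
  moreover have "?\<psi> (f * g) = ?\<psi> f * ?\<psi> g" for f g
    using inv(2)[of "?\<psi> f * ?\<psi> g"] by (simp add: \<phi>(3) inv)
  moreover have "?\<psi> 1 = 1" using inv(2)[of 1] \<phi>(4) by simp
  ultimately show ?thesis using bij_imp_bij_inv[OF \<phi>(1)] by (simp add: Aut_iff)
qed

text \<open>Regular functions on the automorphism group are defined through the images of the coordinates
  only. On each piece of the filtration they also see the image of any other element \<open>f\<close>.\<close>

lemma functional_orbit_regular:
  assumes "functional l"
  shows "\<exists>P \<in> Aut_funs scale X ev. \<forall>\<phi> \<in> Aut_filtration scale X ev d. P \<phi> = l (\<phi> f)"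
    and "\<exists>P \<in> Aut_funs scale X ev. \<forall>\<phi> \<in> Aut_filtration scale X ev d. P \<phi> = l (inv_into UNIV \<phi> f)"
proof -
  let ?Z = "Aut_filtration scale X ev d"
  have "\<exists>F \<in> vector_maps (Aut_funs scale X ev). \<forall>\<phi>\<in>?Z. F \<phi> = \<phi> f"
    unfolding Aut_funs_def
  proof (rule bounded_family_vector_map)
    show "\<exists>P\<in>fun_algebra ({\<lambda>\<phi>. l (\<phi> (x i)) | l i. functional l} \<union>
        {\<lambda>\<phi>. l (inv_into UNIV \<phi> (x i)) | l i. functional l}). \<forall>\<phi>\<in>?Z. P \<phi> = l (\<phi> (x i))"
      if "functional l" for l i
      using that by (intro bexI[of _ "\<lambda>\<phi>. l (\<phi> (x i))"] ballI refl fun_algebra.generator) blast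
  qed (auto simp: Aut_filtration_def Aut_iff)
  then obtain F where F: "F \<in> vector_maps (Aut_funs scale X ev)" "\<forall>\<phi>\<in>?Z. F \<phi> = \<phi> f" by blast
  have "(\<lambda>\<phi>. l (F \<phi>)) \<in> Aut_funs scale X ev"
    using functional_vector_maps[OF assms] F(1) unfolding Aut_funs_def by blast
  then show "\<exists>P \<in> Aut_funs scale X ev. \<forall>\<phi>\<in>?Z. P \<phi> = l (\<phi> f)"
    using F(2) by (intro bexI[of _ "\<lambda>\<phi>. l (F \<phi>)"]) auto
  have "\<exists>F \<in> vector_maps (Aut_funs scale X ev). \<forall>\<phi>\<in>?Z. F \<phi> = inv_into UNIV \<phi> f"
    unfolding Aut_funs_def
  proof (rule bounded_family_vector_map)
    show "\<exists>P\<in>fun_algebra ({\<lambda>\<phi>. l (\<phi> (x i)) | l i. functional l} \<union>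
        {\<lambda>\<phi>. l (inv_into UNIV \<phi> (x i)) | l i. functional l}). \<forall>\<phi>\<in>?Z. P \<phi> = l (inv_into UNIV \<phi> (x i))"
      if "functional l" for l i
      using that by (intro bexI[of _ "\<lambda>\<phi>. l (inv_into UNIV \<phi> (x i))"] ballI refl fun_algebra.generator) blast
  next
    show "lin (inv_into UNIV \<phi>) \<and> (\<forall>f g. inv_into UNIV \<phi> (f * g) = inv_into UNIV \<phi> f * inv_into UNIV \<phi> g)
        \<and> inv_into UNIV \<phi> 1 = 1" if "\<phi> \<in> ?Z" for \<phi>
      using Aut_inv[of \<phi>] that by (auto simp: Aut_filtration_def Aut_iff)
  qed (auto simp: Aut_filtration_def)
  then obtain F where F: "F \<in> vector_maps (Aut_funs scale X ev)" "\<forall>\<phi>\<in>?Z. F \<phi> = inv_into UNIV \<phi> f" by blast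
  have "(\<lambda>\<phi>. l (F \<phi>)) \<in> Aut_funs scale X ev"
    using functional_vector_maps[OF assms] F(1) unfolding Aut_funs_def by blast
  then show "\<exists>P \<in> Aut_funs scale X ev. \<forall>\<phi>\<in>?Z. P \<phi> = l (inv_into UNIV \<phi> f)"
    using F(2) by (intro bexI[of _ "\<lambda>\<phi>. l (F \<phi>)"]) auto
qed

lemma derivation_eq_zero:
  assumes D: "derivation scale D" and "\<And>i. D (x i) = 0"
  shows "D f = 0"
proof (induction f rule: coordinate_induct)
  case (const c)
  then show ?case using lin_scale[OF derivation_lin[OF D]] derivation_one[OF D] by simp
next
  case (add f g)
  then show ?case using lin_add[OF derivation_lin[OF D]] by simp
qed (simp_all add: assms derivation_mult[OF D])

text \<open>A derivation is determined by its values on the coordinates, of which there are finitely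
  many.\<close>

lemma finite_hcomp_degrees:
  fixes W :: "'g::ab_group_add \<Rightarrow> 'b set"
  assumes "grading scale W" and D: "derivation scale D"
  shows "finite {l. \<exists>f. grading.hcomp W D l f \<noteq> 0}"
proof -
  interpret W: grading scale W by fact
  have "{l. \<exists>f. W.hcomp D l f \<noteq> 0} \<subseteq> (\<Union>i. {l. W.hcomp D l (x i) \<noteq> 0})"
    using derivation_eq_zero[OF W.hcomp_derivation[OF D]] by blast
  moreover have "finite \<dots>"
    by (rule finite_UN_I[OF finite W.finite_hcomp[OF derivation_lin[OF D]]])
  ultimately show ?thesis by (rule finite_subset)
qed

end

section \<open>Characters of the standard torus\<close>

definition exponents :: "nat \<Rightarrow> (nat \<Rightarrow> int) set" where
  "exponents r = {a. \<forall>i\<ge>r. a i = 0}"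

definition single :: "nat \<Rightarrow> int \<Rightarrow> nat \<Rightarrow> int" where
  "single j k = (\<lambda>i. if i = j then k else 0)"

definition chr :: "nat \<Rightarrow> (nat \<Rightarrow> int) \<Rightarrow> (nat \<Rightarrow> 'k::field) \<Rightarrow> 'k" where
  "chr r a t = (\<Prod>i<r. t i powi a i)"

lemma single_add: "single j (k + l) = single j k + single j l"
  by (auto simp: single_def fun_eq_iff)

lemma exponents_add: "a \<in> exponents r \<Longrightarrow> b \<in> exponents r \<Longrightarrow> a + b \<in> exponents r"
  by (auto simp: exponents_def)

lemma torus_carrier: "t \<in> carrier (std_torus r) \<longleftrightarrow> (\<forall>i<r. t i \<noteq> 0) \<and> t \<in> extensional {..<r}"
  by (auto simp: std_torus_def mult_group_def PiE_iff)

lemma torus_mult: "s \<otimes>\<^bsub>std_torus r\<^esub> t = (\<lambda>i\<in>{..<r}. s i * t i)"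
  by (simp add: std_torus_def mult_group_def)

lemma torus_one: "\<one>\<^bsub>std_torus r\<^esub> = (\<lambda>i\<in>{..<r}. 1)"
  by (simp add: std_torus_def mult_group_def)

lemma group_mult_group: "group (mult_group :: 'k::field monoid)"
proof (rule groupI)
  show "\<exists>y\<in>carrier mult_group. y \<otimes>\<^bsub>mult_group\<^esub> x = \<one>\<^bsub>mult_group\<^esub>"
    if "x \<in> carrier mult_group" for x :: 'k
    using that by (intro bexI[of _ "inverse x"]) (auto simp: mult_group_def)
qed (auto simp: mult_group_def)

lemma group_std_torus: "group (std_torus r :: (nat \<Rightarrow> 'k::field) monoid)"
  unfolding std_torus_def by (rule product_group) (rule group_mult_group)

lemma chr_add:
  assumes "t \<in> carrier (std_torus r)"
  shows "chr r (a + b) t = chr r a t * chr r b t"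
  using assms by (simp add: chr_def torus_carrier power_int_add prod.distrib)

lemma chr_zero: "chr r 0 t = 1"
  by (simp add: chr_def)

lemma chr_mult: "chr r a (s \<otimes>\<^bsub>std_torus r\<^esub> t) = chr r a s * chr r a t"
  by (simp add: chr_def torus_mult power_int_mult_distrib prod.distrib)

lemma chr_one: "chr r a \<one>\<^bsub>std_torus r\<^esub> = 1"
  by (simp add: chr_def torus_one)

lemma chr_nonzero: "t \<in> carrier (std_torus r) \<Longrightarrow> chr r a t \<noteq> 0"
  by (auto simp: chr_def torus_carrier)

lemma chr_uminus:
  assumes "t \<in> carrier (std_torus r)"
  shows "chr r (- a) t = inverse (chr r a t)"
  using chr_add[OF assms, of a "- a"] chr_nonzero[OF assms, of a]
  by (simp add: chr_zero field_simps)

lemma chr_inv: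
  fixes t :: "nat \<Rightarrow> 'k::field"
  assumes "t \<in> carrier (std_torus r)"
  shows "chr r a (inv\<^bsub>std_torus r\<^esub> t) = chr r (- a) t"
proof -
  interpret group "std_torus r :: (nat \<Rightarrow> 'k) monoid" by (rule group_std_torus)
  have "chr r a (inv\<^bsub>std_torus r\<^esub> t) * chr r a t = 1"
    using assms by (simp add: chr_one flip: chr_mult)
  then show ?thesis
    using chr_nonzero[OF assms, of a] by (simp add: chr_uminus[OF assms] field_simps)
qed

lemma chr_single:
  assumes "j < r"
  shows "chr r (single j k) t = t j powi k"
proof -
  have "chr r (single j k) t = (\<Prod>i<r. if i = j then t j powi k else 1)"
    unfolding chr_def by (intro prod.cong) (auto simp: single_def)
  then show ?thesis using assms by simp
qed

lemma chr_regular: "chr r a \<in> std_torus_funs r"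
proof -
  have "(\<lambda>t. t i powi a i) \<in> std_torus_funs r" if "i < r" for i
  proof (cases "a i \<ge> 0")
    case True
    have "(\<lambda>t. t i ^ nat (a i)) \<in> std_torus_funs r"
      unfolding std_torus_funs_def using that
      by (intro fun_algebra_power fun_algebra.generator) blast
    then show ?thesis using True by (simp add: power_int_def)
  next
    case False
    have "(\<lambda>t. inverse (t i) ^ nat (- a i)) \<in> std_torus_funs r"
      unfolding std_torus_funs_def using that
      by (intro fun_algebra_power fun_algebra.generator) blast
    then show ?thesis using False by (simp add: power_int_def)
  qed
  then have "(\<lambda>t. \<Prod>i<r. t i powi a i) \<in> std_torus_funs r"
    unfolding std_torus_funs_def by (intro fun_algebra_prod) auto
  then show ?thesis by (simp add: chr_def[abs_def])
qed

lemma two_powi_inject: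
  assumes "(2 :: 'k::field_char_0) powi m = 2 powi n"
  shows "m = n"
proof -
  have *: "False" if "m < n" "(2 :: 'k) powi m = 2 powi n" for m n
  proof -
    have "(2 :: 'k) powi n = 2 powi m * 2 powi (n - m)"
      by (simp flip: power_int_add)
    then have "(2 :: 'k) powi (n - m) = 1" using that(2) by simp
    then have "(2 :: 'k) ^ nat (n - m) = 1" using that(1) by (simp add: power_int_def)
    then have "of_nat (2 ^ nat (n - m)) = (of_nat 1 :: 'k)" by simp
    then have "(2 :: nat) ^ nat (n - m) = 1" by (simp only: of_nat_eq_iff)
    then show False using that(1) by simp
  qed
  show ?thesis using *[of m n] *[of n m] assms by (metis linorder_neqE)
qed

text \<open>In characteristic zero the powers of \<open>2\<close> are distinct, so that it is enough to put \<open>2\<close> in a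
  coordinate where the exponents differ.\<close>

lemma chr_separate:
  assumes "a \<in> exponents r" and "b \<in> exponents r" and "a \<noteq> b"
  shows "\<exists>t \<in> carrier (std_torus r). chr r a t \<noteq> (chr r b t :: 'k::field_char_0)"
proof -
  obtain j where j: "a j \<noteq> b j" using assms(3) by blast
  then have "j < r" using assms(1,2) by (force simp: exponents_def not_less[symmetric])
  define t :: "nat \<Rightarrow> 'k" where "t = (\<lambda>i\<in>{..<r}. if i = j then 2 else 1)"
  have "chr r c t = 2 powi c j" for c
  proof -
    have "chr r c t = (\<Prod>i<r. if i = j then 2 powi c j else 1)"
      unfolding chr_def by (intro prod.cong) (auto simp: t_def)
    then show ?thesis using \<open>j < r\<close> by simp
  qed
  then have "chr r a t \<noteq> chr r b t" using two_powi_inject j by metis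
  moreover have "t \<in> carrier (std_torus r)" by (auto simp: t_def torus_carrier)
  ultimately show ?thesis by blast
qed

text \<open>A lattice that contains the unit vectors is everything, and each of its homomorphisms to the
  multiplicative group is evaluation of characters at a point of the torus.\<close>

lemma lattice_character:
  fixes \<Lambda> :: "(nat \<Rightarrow> int) \<Rightarrow> 'k::field"
  assumes zero: "0 \<in> L" and add: "\<And>a b. a \<in> L \<Longrightarrow> b \<in> L \<Longrightarrow> a + b \<in> L"
    and minus: "\<And>a. a \<in> L \<Longrightarrow> - a \<in> L"
    and unit: "\<And>j. j < m \<Longrightarrow> single j 1 \<in> L"
    and hom: "\<And>a b. a \<in> L \<Longrightarrow> b \<in> L \<Longrightarrow> \<Lambda> (a + b) = \<Lambda> a * \<Lambda> b"
    and nonzero: "\<And>a. a \<in> L \<Longrightarrow> \<Lambda> a \<noteq> 0"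
    and c: "c \<in> exponents m"
  shows "\<Lambda> c = chr m c (\<lambda>j\<in>{..<m}. \<Lambda> (single j 1))"
proof -
  have hom0: "\<Lambda> 0 = 1" using hom[OF zero zero] nonzero[OF zero] by simp
  have single: "single j k \<in> L \<and> \<Lambda> (single j k) = \<Lambda> (single j 1) powi k" if j: "j < m" for j k
  proof (induction k rule: int_induct[where k = 0])
    case base
    have s0: "single j 0 = 0" by (auto simp: single_def fun_eq_iff)
    show ?case using zero hom0 by (simp add: s0 flip: zero_fun_def)
  next
    case (step1 k)
    moreover have "\<Lambda> (single j 1) powi (k + 1) = \<Lambda> (single j 1) powi k * \<Lambda> (single j 1)"
      using nonzero[OF unit[OF j]] by (simp add: power_int_add)
    ultimately show ?case
      unfolding single_add using add hom unit[OF j] by metis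
  next
    case (step2 k)
    have eq: "single j (k - 1) + single j 1 = single j k" by (simp flip: single_add)
    have "single j (k - 1) = single j k + - single j 1" by (auto simp: single_def fun_eq_iff)
    then have L: "single j (k - 1) \<in> L" using step2 minus[OF unit[OF j]] add by metis
    have "\<Lambda> (single j k) = \<Lambda> (single j (k - 1)) * \<Lambda> (single j 1)"
      using hom[OF L unit[OF j]] unfolding eq .
    then have "\<Lambda> (single j (k - 1)) = \<Lambda> (single j 1) powi (k - 1)"
      using step2 nonzero[OF unit[OF j]] by (simp add: power_int_diff field_simps)
    with L show ?case by blast
  qed
  let ?c = "\<lambda>n i. if i < n then c i else 0"
  have "?c n \<in> L \<and> \<Lambda> (?c n) = (\<Prod>j<n. \<Lambda> (single j 1) powi c j)" if "n \<le> m" for n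
    using that
  proof (induction n)
    case 0
    show ?case using zero hom0 by (simp flip: zero_fun_def)
  next
    case (Suc n)
    have eq: "?c (Suc n) = ?c n + single n (c n)" by (auto simp: single_def fun_eq_iff)
    have n: "n < m" using Suc.prems by simp
    have IH: "?c n \<in> L" "\<Lambda> (?c n) = (\<Prod>j<n. \<Lambda> (single j 1) powi c j)"
      using Suc.IH Suc.prems by simp_all
    note last = single[OF n, of "c n"]
    have "?c n + single n (c n) \<in> L" by (rule add[OF IH(1) conjunct1[OF last]])
    moreover have "\<Lambda> (?c n + single n (c n)) = (\<Prod>j<Suc n. \<Lambda> (single j 1) powi c j)"
      unfolding hom[OF IH(1) conjunct1[OF last]] IH(2) conjunct2[OF last] by simp
    ultimately show ?case unfolding eq by (rule conjI)
  qed
  moreover have "?c m = c" using c by (auto simp: exponents_def fun_eq_iff)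
  ultimately have "\<Lambda> c = (\<Prod>j<m. \<Lambda> (single j 1) powi c j)" by (metis order_refl)
  then show ?thesis by (simp add: chr_def)
qed

context comm_algebra
begin

text \<open>Laurent polynomials with vector coefficients and exponents in \<open>L\<close>. Only the values on the
  torus matter, as characters are multiplicative in the exponent only there.\<close>

definition laurent :: "nat \<Rightarrow> (nat \<Rightarrow> int) set \<Rightarrow> ((nat \<Rightarrow> 'k) \<Rightarrow> 'b) \<Rightarrow> bool" where
  "laurent r L F \<longleftrightarrow> (\<exists>S v. finite S \<and> S \<subseteq> L \<and>
     (\<forall>t \<in> carrier (std_torus r). F t = (\<Sum>a\<in>S. scale (chr r a t) (v a))))"

lemma laurent_cong:
  "(\<And>t. t \<in> carrier (std_torus r) \<Longrightarrow> F t = G t) \<Longrightarrow> laurent r L F \<longleftrightarrow> laurent r L G"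
  by (simp add: laurent_def)

lemma laurent_single: "a \<in> L \<Longrightarrow> laurent r L (\<lambda>t. scale (chr r a t) v)"
  unfolding laurent_def by (intro exI[of _ "{a}"] exI[of _ "\<lambda>_. v"]) auto

lemma laurent_zero: "laurent r L (\<lambda>_. 0)"
  unfolding laurent_def by (intro exI[of _ "{}"]) auto

lemma laurent_add:
  assumes "laurent r L F" and "laurent r L G"
  shows "laurent r L (\<lambda>t. F t + G t)"
proof -
  obtain S v where S: "finite S" "S \<subseteq> L"
    "\<And>t. t \<in> carrier (std_torus r) \<Longrightarrow> F t = (\<Sum>a\<in>S. scale (chr r a t) (v a))"
    using assms(1) by (auto simp: laurent_def)
  obtain S' w where S': "finite S'" "S' \<subseteq> L"
    "\<And>t. t \<in> carrier (std_torus r) \<Longrightarrow> G t = (\<Sum>a\<in>S'. scale (chr r a t) (w a))"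
    using assms(2) by (auto simp: laurent_def)
  let ?u = "\<lambda>a. (if a \<in> S then v a else 0) + (if a \<in> S' then w a else 0)"
  have "F t + G t = (\<Sum>a\<in>S \<union> S'. scale (chr r a t) (?u a))" if "t \<in> carrier (std_torus r)" for t
  proof -
    have "(\<Sum>a\<in>S. scale (chr r a t) (v a)) = (\<Sum>a\<in>S \<union> S'. scale (chr r a t) (if a \<in> S then v a else 0))"
      using S(1) S'(1) by (intro sum.mono_neutral_cong_left) auto
    moreover have "(\<Sum>a\<in>S'. scale (chr r a t) (w a)) = (\<Sum>a\<in>S \<union> S'. scale (chr r a t) (if a \<in> S' then w a else 0))"
      using S(1) S'(1) by (intro sum.mono_neutral_cong_left) auto
    ultimately show ?thesis
      by (simp only: S(3)[OF that] S'(3)[OF that] scale_right_distrib sum.distrib)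
  qed
  then show ?thesis unfolding laurent_def
    using S(1,2) S'(1,2) by (intro exI[of _ "S \<union> S'"] exI[of _ ?u]) auto
qed

lemma laurent_sum:
  assumes "\<And>i. i \<in> I \<Longrightarrow> laurent r L (F i)"
  shows "laurent r L (\<lambda>t. \<Sum>i\<in>I. F i t)"
  using assms
proof (induction I rule: infinite_finite_induct)
  case (insert i I)
  then show ?case using laurent_add[of r L "F i"] by simp
qed (simp_all add: laurent_zero)

lemma laurent_mult:
  assumes "laurent r L F" and "laurent r L G" and add: "\<And>a b. a \<in> L \<Longrightarrow> b \<in> L \<Longrightarrow> a + b \<in> L"
  shows "laurent r L (\<lambda>t. F t * G t)"
proof -
  obtain S v where S: "finite S" "S \<subseteq> L"
    "\<And>t. t \<in> carrier (std_torus r) \<Longrightarrow> F t = (\<Sum>a\<in>S. scale (chr r a t) (v a))"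
    using assms(1) by (auto simp: laurent_def)
  obtain S' w where S': "finite S'" "S' \<subseteq> L"
    "\<And>t. t \<in> carrier (std_torus r) \<Longrightarrow> G t = (\<Sum>a\<in>S'. scale (chr r a t) (w a))"
    using assms(2) by (auto simp: laurent_def)
  have "F t * G t = (\<Sum>a\<in>S. \<Sum>b\<in>S'. scale (chr r (a + b) t) (v a * w b))"
    if "t \<in> carrier (std_torus r)" for t
    unfolding S(3)[OF that] S'(3)[OF that] sum_product
    by (simp add: chr_add[OF that] scale_mult_left scale_mult_right mult.commute)
  moreover have "laurent r L (\<lambda>t. \<Sum>a\<in>S. \<Sum>b\<in>S'. scale (chr r (a + b) t) (v a * w b))"
    using S(2) S'(2) by (intro laurent_sum laurent_single add) auto
  ultimately show ?thesis using laurent_cong[of r "\<lambda>t. F t * G t"] by simp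
qed

lemma laurent_torus_fun:
  assumes "p \<in> std_torus_funs r"
  shows "laurent r (exponents r) (\<lambda>t. scale (p t) 1)"
  using assms unfolding std_torus_funs_def
proof induction
  case (const c)
  have "laurent r (exponents r) (\<lambda>t. scale (chr r 0 t) (scale c 1))"
    by (rule laurent_single) (simp add: exponents_def)
  then show ?case by (simp add: chr_zero)
next
  case (generator f)
  then obtain j where j: "j < r" "f = (\<lambda>t. t j) \<or> f = (\<lambda>t. inverse (t j))" by auto
  have "laurent r (exponents r) (\<lambda>t. scale (chr r (single j k) t) 1)" for k
    using j(1) by (intro laurent_single) (auto simp: exponents_def single_def)
  then have "laurent r (exponents r) (\<lambda>t. scale (t j powi k) 1)" for k
    by (simp add: chr_single[OF j(1)])
  from this[of 1] this[of "-1"] show ?case using j(2) by (auto simp: power_int_minus)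
next
  case (add p q)
  then show ?case using laurent_add by (simp add: scale_left_distrib)
next
  case (mult p q)
  have "laurent r (exponents r) (\<lambda>t. scale (p t) 1 * scale (q t) 1)"
    by (rule laurent_mult[OF mult(3,4) exponents_add])
  then show ?case by (simp add: scale_mult_left)
qed

lemma laurent_vector_map:
  assumes "F \<in> vector_maps (std_torus_funs r)"
  shows "laurent r (exponents r) F"
  using assms
proof induction
  case (scale P v)
  have "laurent r (exponents r) (\<lambda>t. scale (chr r 0 t) v)"
    by (rule laurent_single) (simp add: exponents_def)
  then have "laurent r (exponents r) (\<lambda>t. v)" by (simp add: chr_zero)
  from laurent_mult[OF laurent_torus_fun[OF scale] this exponents_add] show ?case
    by (simp add: scale_mult_left)
next
  case (add F G)
  then show ?case by (intro laurent_add)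
qed

text \<open>Dedekind's argument: subtracting \<open>chr r b s\<close> times the relation from its translate by \<open>s\<close>
  eliminates the character \<open>b\<close>.\<close>

lemma characters_independent:
  assumes "finite S" and "S \<subseteq> exponents r"
    and "\<And>t. t \<in> carrier (std_torus r) \<Longrightarrow> (\<Sum>a\<in>S. scale (chr r a t) (v a)) = 0"
    and "a \<in> S"
  shows "v a = 0"
  using assms
proof (induction S arbitrary: v a rule: finite_induct)
  case (insert b S)
  interpret T: group "std_torus r :: (nat \<Rightarrow> 'k) monoid" by (rule group_std_torus)
  have S: "v a = 0" if a: "a \<in> S" for a
  proof -
    have "a \<in> exponents r" "b \<in> exponents r" "a \<noteq> b" using insert a by auto
    then obtain s where s: "s \<in> carrier (std_torus r)" "chr r a s \<noteq> (chr r b s :: 'k)"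
      using chr_separate by blast
    let ?w = "\<lambda>a. scale (chr r a s - chr r b s) (v a)"
    have "(\<Sum>a\<in>S. scale (chr r a t) (?w a)) = 0" if t: "t \<in> carrier (std_torus r)" for t
    proof -
      have "0 = (\<Sum>a\<in>insert b S. scale (chr r a (t \<otimes>\<^bsub>std_torus r\<^esub> s)) (v a))
          - scale (chr r b s) (\<Sum>a\<in>insert b S. scale (chr r a t) (v a))"
        using insert.prems(2)[OF t] insert.prems(2)[OF T.m_closed[OF t s(1)]] by simp
      also have "\<dots> = (\<Sum>a\<in>insert b S. scale (chr r a t) (?w a))"
        unfolding chr_mult scale_sum_right sum_subtractf[symmetric]
        by (intro sum.cong refl) (simp add: scale_right_diff_distrib scale_left_diff_distrib
            right_diff_distrib mult.commute)
      also have "\<dots> = (\<Sum>a\<in>S. scale (chr r a t) (?w a))"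
        using insert.hyps by simp
      finally show ?thesis by simp
    qed
    then have "?w a = 0" using insert.prems(1) a by (intro insert.IH[of ?w a]) blast+
    then show ?thesis using s(2) by simp
  qed
  have "scale (chr r b \<one>\<^bsub>std_torus r\<^esub>) (v b) = 0"
    using insert.prems(2)[OF T.one_closed] insert.hyps S by simp
  then have "v b = 0" by (simp add: chr_one)
  then show ?case using S insert.prems(3) by blast
qed simp

end

section \<open>Tori and gradings\<close>

context coordinate_algebra
begin

subsection \<open>The weight spaces of a torus\<close>

text \<open>The type of the exponents also contains those with nonzero entries from \<open>r\<close> on. Their
  characters coincide with characters of proper exponents, so the weight spaces have to be
  declared to be zero.\<close>

definition weight_space :: "nat \<Rightarrow> ((nat \<Rightarrow> 'k) \<Rightarrow> 'b \<Rightarrow> 'b) \<Rightarrow> (nat \<Rightarrow> int) \<Rightarrow> 'b set" where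
  "weight_space r \<theta> a = {f. (f \<noteq> 0 \<longrightarrow> a \<in> exponents r) \<and>
     (\<forall>t \<in> carrier (std_torus r). \<theta> t f = scale (chr r a t) f)}"

context
  fixes T r \<theta> d
  assumes iso: "torus_iso scale X ev T r \<theta>"
    and bounded: "T \<subseteq> Aut_filtration scale X ev d"
begin

lemma \<theta>_in: "t \<in> carrier (std_torus r) \<Longrightarrow> \<theta> t \<in> T"
  using iso by (auto simp: torus_iso_def iso_def hom_def)

lemma \<theta>_Aut: 
  assumes "t \<in> carrier (std_torus r)"
  shows "bij (\<theta> t)" "lin (\<theta> t)" "\<theta> t (f * g) = \<theta> t f * \<theta> t g" "\<theta> t 1 = 1"
  using \<theta>_in[OF assms] bounded by (auto simp: Aut_filtration_def Aut_iff)

lemma \<theta>_mult: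
  assumes "s \<in> carrier (std_torus r)" and "t \<in> carrier (std_torus r)"
  shows "\<theta> (s \<otimes>\<^bsub>std_torus r\<^esub> t) f = \<theta> s (\<theta> t f)"
  using iso assms by (auto simp: torus_iso_def iso_def hom_def Aut_def)

lemma \<theta>_one: "\<theta> \<one>\<^bsub>std_torus r\<^esub> f = f"
proof -
  interpret G: group "std_torus r :: (nat \<Rightarrow> 'k) monoid" by (rule group_std_torus)
  have "\<theta> \<one>\<^bsub>std_torus r\<^esub> (\<theta> \<one>\<^bsub>std_torus r\<^esub> f) = \<theta> \<one>\<^bsub>std_torus r\<^esub> f"
    using \<theta>_mult[OF G.one_closed G.one_closed, of f] by simp
  then show ?thesis using \<theta>_Aut(1)[OF G.one_closed] by (metis bij_is_inj inj_eq)
qed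

text \<open>Comparing the coefficients of the characters of \<open>s\<close> in \<open>\<theta> (s t) f = \<theta> t (\<theta> s f)\<close> shows
  that the coefficients of the Laurent expansion of \<open>\<theta> s f\<close> are weight vectors; their sum is
  \<open>\<theta> 1 f = f\<close>.\<close>

lemma torus_span: "f \<in> span (\<Union>a. weight_space r \<theta> a)"
proof -
  interpret G: group "std_torus r :: (nat \<Rightarrow> 'k) monoid" by (rule group_std_torus)
  have "\<exists>F \<in> vector_maps (std_torus_funs r). \<forall>t \<in> carrier (std_torus r). F t = \<theta> t f"
    unfolding std_torus_funs_def
  proof (rule bounded_family_vector_map)
    fix t :: "nat \<Rightarrow> 'k" assume t: "t \<in> carrier (std_torus r)"
    show "lin (\<theta> t) \<and> (\<forall>f g. \<theta> t (f * g) = \<theta> t f * \<theta> t g) \<and> \<theta> t 1 = 1"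
      using \<theta>_Aut[OF t] by blast
    show "\<theta> t (x i) \<in> degree_le scale X ev d" for i
      using \<theta>_in[OF t] bounded by (auto simp: Aut_filtration_def)
  next
    fix l i assume "functional l"
    then have "(\<lambda>\<phi>. l (\<phi> (x i))) \<in> Aut_funs scale X ev"
      unfolding Aut_funs_def by (intro fun_algebra.generator) blast
    then have "\<exists>p \<in> std_torus_funs r. \<forall>t \<in> carrier (std_torus r). l (\<theta> t (x i)) = p t"
      using iso unfolding torus_iso_def by fast
    then show "\<exists>P\<in>fun_algebra ((\<lambda>i t. t i) ` {..<r} \<union> (\<lambda>i t. inverse (t i)) ` {..<r}).
        \<forall>t\<in>carrier (std_torus r). P t = l (\<theta> t (x i))"
      unfolding std_torus_funs_def by metis
  qed
  then obtain F where F: "F \<in> vector_maps (std_torus_funs r)"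
    "\<And>t. t \<in> carrier (std_torus r) \<Longrightarrow> F t = \<theta> t f" by blast
  obtain S v where S: "finite S" "S \<subseteq> exponents r"
    "\<And>t. t \<in> carrier (std_torus r) \<Longrightarrow> F t = (\<Sum>a\<in>S. scale (chr r a t) (v a))"
    using laurent_vector_map[OF F(1)] unfolding laurent_def by blast
  have expand: "\<theta> t f = (\<Sum>a\<in>S. scale (chr r a t) (v a))" if "t \<in> carrier (std_torus r)" for t
    using F(2)[OF that] S(3)[OF that] by simp
  have "v a \<in> weight_space r \<theta> a" if a: "a \<in> S" for a
  proof -
    have "\<theta> t (v a) = scale (chr r a t) (v a)" if t: "t \<in> carrier (std_torus r)" for t
    proof -
      have "(\<Sum>a\<in>S. scale (chr r a s) (\<theta> t (v a) - scale (chr r a t) (v a))) = 0"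
        if s: "s \<in> carrier (std_torus r)" for s
      proof -
        have "(\<Sum>a\<in>S. scale (chr r a s) (\<theta> t (v a))) = \<theta> t (\<theta> s f)"
          by (simp add: expand[OF s] lin_sum[OF \<theta>_Aut(2)[OF t]] lin_scale[OF \<theta>_Aut(2)[OF t]])
        also have "\<dots> = \<theta> (t \<otimes>\<^bsub>std_torus r\<^esub> s) f" using \<theta>_mult[OF t s] by simp
        also have "\<dots> = (\<Sum>a\<in>S. scale (chr r a s) (scale (chr r a t) (v a)))"
          by (simp add: expand[OF G.m_closed[OF t s]] chr_mult mult.commute)
        finally show ?thesis by (simp add: scale_right_diff_distrib sum_subtractf)
      qed
      then have "\<theta> t (v a) - scale (chr r a t) (v a) = 0"
        using characters_independent[OF S(1,2), of "\<lambda>a. \<theta> t (v a) - scale (chr r a t) (v a)" a] a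
        by blast
      then show ?thesis by simp
    qed
    then show ?thesis using S(2) a by (auto simp: weight_space_def)
  qed
  then have "(\<Sum>a\<in>S. v a) \<in> span (\<Union>a. weight_space r \<theta> a)"
    by (intro span_sum span_base) blast
  moreover have "(\<Sum>a\<in>S. v a) = f"
    using expand[OF G.one_closed] by (simp add: chr_one \<theta>_one)
  ultimately show ?thesis by simp
qed

lemma torus_grading: "grading scale (weight_space r \<theta>)"
proof
  show "subspace (weight_space r \<theta> a)" for a
  proof (rule subspaceI)
    show "0 \<in> weight_space r \<theta> a"
      using lin_zero[OF \<theta>_Aut(2)] by (auto simp: weight_space_def)
    show "f + g \<in> weight_space r \<theta> a" if "f \<in> weight_space r \<theta> a" "g \<in> weight_space r \<theta> a" for f g
      using that lin_add[OF \<theta>_Aut(2)] by (auto simp: weight_space_def scale_right_distrib)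
    show "scale c f \<in> weight_space r \<theta> a" if "f \<in> weight_space r \<theta> a" for c f
      using that lin_scale[OF \<theta>_Aut(2)] by (auto simp: weight_space_def mult.commute)
  qed
  show "span (\<Union>a. weight_space r \<theta> a) = UNIV" using torus_span by blast
  show "v a = 0" if F: "finite F" "\<And>a. a \<in> F \<Longrightarrow> v a \<in> weight_space r \<theta> a" "sum v F = 0" "a \<in> F"
    for F v a
  proof -
    let ?F = "F \<inter> exponents r"
    have out: "v a = 0" if "a \<in> F - ?F" for a using F(2)[of a] that by (auto simp: weight_space_def)
    have "(\<Sum>a\<in>?F. scale (chr r a t) (v a)) = 0" if t: "t \<in> carrier (std_torus r)" for t
    proof -
      have "(\<Sum>a\<in>?F. scale (chr r a t) (v a)) = (\<Sum>a\<in>F. scale (chr r a t) (v a))"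
        using F(1) out by (intro sum.mono_neutral_left) auto
      also have "\<dots> = (\<Sum>a\<in>F. \<theta> t (v a))"
        using F(2) t by (intro sum.cong) (auto simp: weight_space_def)
      also have "\<dots> = \<theta> t (sum v F)" by (simp add: lin_sum[OF \<theta>_Aut(2)[OF t]])
      finally show ?thesis using F(3) lin_zero[OF \<theta>_Aut(2)[OF t]] by simp
    qed
    then have "v a = 0" if "a \<in> ?F" for a
      using characters_independent[of ?F r v a] F(1) that by blast
    then show ?thesis using out F(4) by blast
  qed
  show "1 \<in> weight_space r \<theta> 0"
    using \<theta>_Aut(4) by (auto simp: weight_space_def chr_zero exponents_def)
  show "f * g \<in> weight_space r \<theta> (a + b)"
    if "f \<in> weight_space r \<theta> a" "g \<in> weight_space r \<theta> b" for f g a b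
    using that \<theta>_Aut(3)
    by (auto simp: weight_space_def chr_add scale_mult_left scale_mult_right exponents_add)
qed

interpretation W: grading scale "weight_space r \<theta>" by (rule torus_grading)

lemma torus_expand:
  assumes "t \<in> carrier (std_torus r)"
  shows "\<theta> t f = (\<Sum>a\<in>W.supp f. scale (chr r a t) (W.proj a f))"
proof -
  have "\<theta> t f = (\<Sum>a\<in>W.supp f. \<theta> t (W.proj a f))"
    using lin_sum[OF \<theta>_Aut(2)[OF assms], of "\<lambda>a. W.proj a f" "W.supp f"] by (simp add: W.sum_proj)
  also have "\<dots> = (\<Sum>a\<in>W.supp f. scale (chr r a t) (W.proj a f))"
    using W.proj_in_W assms by (intro sum.cong) (auto simp: weight_space_def)
  finally show ?thesis .
qed

lemma torus_weights: "W.weights \<subseteq> exponents r"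
  by (auto simp: W.weights_def weight_space_def)

text \<open>The regular functions of \<open>T\<close> are combinations of characters in the weight lattice. The
  coordinates of the torus are among these functions, and characters are independent.\<close>

lemma torus_weight_lattice:
  assumes "j < r"
  shows "single j 1 \<in> W.weight_lattice"
proof (rule ccontr)
  interpret G: group "std_torus r :: (nat \<Rightarrow> 'k) monoid" by (rule group_std_torus)
  let ?L = W.weight_lattice
  assume no: "single j 1 \<notin> ?L"
  have orbit: "laurent r ?L (\<lambda>t. scale (l (\<theta> t f)) 1)"
    "laurent r ?L (\<lambda>t. scale (l (inv_into UNIV (\<theta> t) f)) 1)" if l: "functional l" for l f
  proof -
    have "laurent r ?L (\<lambda>t. \<Sum>a\<in>W.supp f. scale (chr r a t) (scale (l (W.proj a f)) 1))"
      using W.supp_subset_weights W.weight_lattice_weights by (intro laurent_sum laurent_single) blast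
    moreover have "scale (l (\<theta> t f)) 1 = (\<Sum>a\<in>W.supp f. scale (chr r a t) (scale (l (W.proj a f)) 1))"
      if "t \<in> carrier (std_torus r)" for t
      by (simp add: torus_expand[OF that] functional_sum[OF l] functional_scale[OF l] scale_sum_left)
    ultimately show "laurent r ?L (\<lambda>t. scale (l (\<theta> t f)) 1)"
      using laurent_cong[of r "\<lambda>t. scale (l (\<theta> t f)) 1"] by simp
    have "laurent r ?L (\<lambda>t. \<Sum>a\<in>W.supp f. scale (chr r (- a) t) (scale (l (W.proj a f)) 1))"
      using W.supp_subset_weights W.weight_lattice_weights W.weight_lattice_minus
      by (intro laurent_sum laurent_single) blast
    moreover have "scale (l (inv_into UNIV (\<theta> t) f)) 1
        = (\<Sum>a\<in>W.supp f. scale (chr r (- a) t) (scale (l (W.proj a f)) 1))"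
      if t: "t \<in> carrier (std_torus r)" for t
    proof -
      let ?i = "inv\<^bsub>std_torus r\<^esub> t"
      have "\<theta> t (\<theta> ?i f) = f"
        using \<theta>_mult[OF t G.inv_closed[OF t], of f] t by (simp add: \<theta>_one)
      then have "inv_into UNIV (\<theta> t) f = \<theta> ?i f"
        using \<theta>_Aut(1)[OF t] by (metis bij_is_inj inv_f_f)
      then show ?thesis
        by (simp add: torus_expand[OF G.inv_closed[OF t]] chr_inv[OF t] functional_sum[OF l]
            functional_scale[OF l] scale_sum_left)
    qed
    ultimately show "laurent r ?L (\<lambda>t. scale (l (inv_into UNIV (\<theta> t) f)) 1)"
      using laurent_cong[of r "\<lambda>t. scale (l (inv_into UNIV (\<theta> t) f)) 1"] by simp
  qed
  have all: "laurent r ?L (\<lambda>t. scale (P (\<theta> t)) 1)" if "P \<in> Aut_funs scale X ev" for P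
    using that unfolding Aut_funs_def
  proof induction
    case (const c)
    have "laurent r ?L (\<lambda>t. scale (chr r 0 t) (scale c 1))"
      by (rule laurent_single) (rule W.weight_lattice_zero)
    then show ?case by (simp add: chr_zero)
  next
    case (generator P)
    then show ?case using orbit by blast
  next
    case (add P Q)
    then show ?case using laurent_add by (simp add: scale_left_distrib)
  next
    case (mult P Q)
    have "laurent r ?L (\<lambda>t. scale (P (\<theta> t)) 1 * scale (Q (\<theta> t)) 1)"
      by (rule laurent_mult[OF mult(3,4) W.weight_lattice_add])
    then show ?case by (simp add: scale_mult_left)
  qed
  have "(\<lambda>t. t j) \<in> std_torus_funs r"
    unfolding std_torus_funs_def using assms by (intro fun_algebra.generator) blast
  then obtain P where P: "P \<in> Aut_funs scale X ev" "\<And>t. t \<in> carrier (std_torus r) \<Longrightarrow> P (\<theta> t) = t j"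
  proof -
    assume *: "\<And>P. P \<in> Aut_funs scale X ev \<Longrightarrow>
      (\<And>t. t \<in> carrier (std_torus r) \<Longrightarrow> P (\<theta> t) = t j) \<Longrightarrow> thesis"
    have "\<forall>f\<in>std_torus_funs r. \<exists>P\<in>Aut_funs scale X ev. \<forall>t\<in>carrier (std_torus r). P (\<theta> t) = f t"
      by (rule iso[unfolded torus_iso_def, THEN conjunct2, THEN conjunct2])
    from bspec[OF this \<open>(\<lambda>t. t j) \<in> std_torus_funs r\<close>] show thesis using * by metis
  qed
  obtain S v where S: "finite S" "S \<subseteq> ?L"
    "\<And>t. t \<in> carrier (std_torus r) \<Longrightarrow> scale (P (\<theta> t)) 1 = (\<Sum>a\<in>S. scale (chr r a t) (v a))"
    using all[OF P(1)] unfolding laurent_def by blast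
  let ?e = "single j 1"
  let ?w = "\<lambda>a. if a = ?e then -1 else v a"
  have e: "?e \<notin> S" using no S(2) by blast
  have "(\<Sum>a\<in>insert ?e S. scale (chr r a t) (?w a)) = 0" if t: "t \<in> carrier (std_torus r)" for t
  proof -
    have "(\<Sum>a\<in>S. scale (chr r a t) (?w a)) = (\<Sum>a\<in>S. scale (chr r a t) (v a))"
      using e by (intro sum.cong) auto
    also have "\<dots> = scale (t j) 1" using S(3)[OF t] P(2)[OF t] by simp
    finally show ?thesis using S(1) e chr_single[OF assms, of 1 t] by simp
  qed
  moreover have "?L \<subseteq> exponents r"
  proof
    fix c assume "c \<in> ?L"
    then obtain a b where "c = a - b" "a \<in> W.weights" "b \<in> W.weights"
      by (auto simp: W.weight_lattice_def)
    moreover from this have "a \<in> exponents r" "b \<in> exponents r" using torus_weights by blast+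
    ultimately show "c \<in> exponents r" by (simp add: exponents_def)
  qed
  moreover have "?e \<in> exponents r" using assms by (auto simp: exponents_def single_def)
  ultimately have "?w ?e = 0"
    using characters_independent[of "insert ?e S" r ?w ?e] S(1,2) by blast
  then show False by simp
qed

end

end

subsection \<open>The torus of a grading\<close>

locale full_grading = coordinate_algebra scale X ev + grading scale W
  for scale :: "'k::{alg_closed_field, field_char_0} \<Rightarrow> 'b::idom \<Rightarrow> 'b"
    and X :: "('n::finite \<Rightarrow> 'k) set" and ev
    and W :: "(nat \<Rightarrow> int) \<Rightarrow> 'b set" +
  fixes m :: nat
  assumes weights_exponents: "weights \<subseteq> exponents m"
    and full: "j < m \<Longrightarrow> single j 1 \<in> weight_lattice"
begin

definition act :: "(nat \<Rightarrow> 'k) \<Rightarrow> 'b \<Rightarrow> 'b" where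
  "act t f = (\<Sum>a\<in>supp f. scale (chr m a t) (proj a f))"

definition scalar_automorphisms :: "('b \<Rightarrow> 'b) set" where
  "scalar_automorphisms = {\<phi> \<in> carrier (Aut scale). \<forall>a. \<forall>f \<in> W a. \<exists>c. \<phi> f = scale c f}"

lemma act_superset:
  assumes "finite F" and "supp f \<subseteq> F"
  shows "act t f = (\<Sum>a\<in>F. scale (chr m a t) (proj a f))"
  unfolding act_def using assms
  by (intro sum.mono_neutral_left) (auto simp: proj_notin_supp)

lemma act_homogeneous:
  assumes "f \<in> W a"
  shows "act t f = scale (chr m a t) f"
proof -
  have "supp f \<subseteq> {a}" by (auto simp: supp_def proj_homogeneous[OF assms])
  then show ?thesis using act_superset[of "{a}" f t] by (simp add: proj_homogeneous[OF assms])
qed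

lemma act_lin: "lin (act t)"
proof (rule linI)
  fix f g
  let ?F = "supp f \<union> supp g"
  have "supp (f + g) \<subseteq> ?F" by (auto simp: supp_def proj_add)
  then show "act t (f + g) = act t f + act t g"
    by (simp add: act_superset[of ?F] proj_add scale_right_distrib sum.distrib)
next
  fix c f
  have "supp (scale c f) \<subseteq> supp f" by (auto simp: supp_def proj_scale)
  then show "act t (scale c f) = scale c (act t f)"
    by (simp add: act_superset[of "supp f"] proj_scale scale_sum_right mult.commute)
qed

lemma act_one: "act t 1 = 1"
  using act_homogeneous[OF one_W] by (simp add: chr_zero)

lemma act_mult:
  assumes "t \<in> carrier (std_torus m)"
  shows "act t (f * g) = act t f * act t g"
proof -
  have 1: "act t (f * g) = act t f * act t g" if f: "f \<in> W a" for f g a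
  proof (induction g rule: homogeneous_induct)
    case (homogeneous b g)
    show ?case
      by (simp add: act_homogeneous[OF f] act_homogeneous[OF homogeneous]
          act_homogeneous[OF mult_W[OF f homogeneous]] chr_add[OF assms] scale_mult_left scale_mult_right)
  next
    case (add g g')
    then show ?case by (simp add: distrib_left lin_add[OF act_lin])
  qed
  show ?thesis
  proof (induction f rule: homogeneous_induct)
    case (homogeneous a f)
    then show ?case by (rule 1)
  next
    case (add f f')
    then show ?case by (simp add: distrib_right lin_add[OF act_lin])
  qed
qed

lemma act_act: "act (s \<otimes>\<^bsub>std_torus m\<^esub> t) f = act s (act t f)"
proof (induction f rule: homogeneous_induct)
  case (homogeneous a f)
  then show ?case
    by (simp add: act_homogeneous[OF homogeneous] lin_scale[OF act_lin] chr_mult mult.commute)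
next
  case (add f g)
  then show ?case by (simp add: lin_add[OF act_lin])
qed

lemma act_id: "act \<one>\<^bsub>std_torus m\<^esub> f = f"
  by (simp add: act_def chr_one sum_proj)

lemma
  assumes "t \<in> carrier (std_torus m)"
  shows act_inv_right: "act t (act (inv\<^bsub>std_torus m\<^esub> t) f) = f"
    and act_inv_left: "act (inv\<^bsub>std_torus m\<^esub> t) (act t f) = f"
proof -
  interpret G: group "std_torus m :: (nat \<Rightarrow> 'k) monoid" by (rule group_std_torus)
  show "act t (act (inv\<^bsub>std_torus m\<^esub> t) f) = f" "act (inv\<^bsub>std_torus m\<^esub> t) (act t f) = f"
    using assms by (simp_all add: act_id flip: act_act)
qed

lemma act_bij: "t \<in> carrier (std_torus m) \<Longrightarrow> bij (act t)"
  by (rule o_bij[of "act (inv\<^bsub>std_torus m\<^esub> t)"]) (simp_all add: fun_eq_iff act_inv_left act_inv_right)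

lemma act_inverse:
  assumes "t \<in> carrier (std_torus m)"
  shows "inv_into UNIV (act t) = act (inv\<^bsub>std_torus m\<^esub> t)"
  by (rule inv_equality) (simp_all add: act_inv_left[OF assms] act_inv_right[OF assms])

lemma act_Aut: "t \<in> carrier (std_torus m) \<Longrightarrow> act t \<in> carrier (Aut scale)"
  by (simp add: Aut_iff act_bij act_lin act_mult act_one)

lemma weight_vector: "a \<in> weights \<Longrightarrow> \<exists>f \<in> W a. f \<noteq> 0"
  by (simp add: weights_def)

lemma scalar_character:
  assumes "\<phi> \<in> scalar_automorphisms"
  shows "\<exists>\<mu>. \<forall>a. \<forall>f \<in> W a. \<phi> f = scale (\<mu> a) f"
proof -
  have lin: "lin \<phi>" and inj: "inj \<phi>"
    using assms by (auto simp: scalar_automorphisms_def Aut_iff bij_is_inj)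
  have scal: "\<exists>c. \<phi> f = scale c f" if "f \<in> W a" for f a
    using assms that by (auto simp: scalar_automorphisms_def)
  \<comment> \<open>Two eigenvectors with different eigenvalues have a sum that is not an eigenvector.\<close>
  have unique: "c = c'"
    if f: "f \<in> W a" "f \<noteq> 0" "\<phi> f = scale c f" and g: "g \<in> W a" "g \<noteq> 0" "\<phi> g = scale c' g"
    for f g a c c'
  proof (rule ccontr)
    assume "c \<noteq> c'"
    obtain e where "\<phi> (f + g) = scale e (f + g)" using scal[OF add_W[OF f(1) g(1)]] by blast
    then have eq: "scale (c - e) f = scale (e - c') g"
      by (simp add: lin_add[OF lin] f(3) g(3) scale_left_diff_distrib scale_right_distrib algebra_simps)
    then have "\<phi> (scale (c - e) f) = \<phi> (scale (e - c') g)" by simp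
    then have "scale ((c - e) * c) f = scale c' (scale (e - c') g)"
      by (simp add: lin_scale[OF lin] f(3) g(3) mult.commute)
    also have "\<dots> = scale ((c - e) * c') f" by (simp add: mult.commute flip: eq)
    finally have "scale ((c - e) * c - (c - e) * c') f = 0" by (simp add: scale_left_diff_distrib)
    then have "c = e" using f(2) \<open>c \<noteq> c'\<close> by (simp flip: right_diff_distrib)
    then have "e = c'" using eq g(2) by simp
    then show False using \<open>c = e\<close> \<open>c \<noteq> c'\<close> by simp
  qed
  have "\<exists>c. \<forall>f \<in> W a. \<phi> f = scale c f" for a
  proof (cases "a \<in> weights")
    case True
    then obtain f where f: "f \<in> W a" "f \<noteq> 0" by (auto simp: weights_def)
    then obtain c where c: "\<phi> f = scale c f" using scal by blast
    have "\<phi> g = scale c g" if "g \<in> W a" for g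
    proof (cases "g = 0")
      case False
      then show ?thesis using scal[OF that] unique[OF f c that] by metis
    qed (simp add: lin_zero[OF lin])
    then show ?thesis by blast
  next
    case False
    then have "f = 0" if "f \<in> W a" for f using that unfolding weights_def by blast
    then have "\<phi> f = scale 0 f" if "f \<in> W a" for f
      using lin_zero[OF lin] that by (metis scale_zero_left)
    then show ?thesis by blast
  qed
  then show ?thesis by (intro choice allI)
qed

text \<open>The scalars by which an automorphism acts form a homomorphism on the monoid of weights, which
  extends to the weight lattice. As the lattice contains the unit vectors, it is given by a point
  of the torus.\<close>

lemma scalar_automorphisms_eq: "scalar_automorphisms = act ` carrier (std_torus m)"
proof (intro equalityI subsetI)
  fix \<phi> assume "\<phi> \<in> act ` carrier (std_torus m)"
  then show "\<phi> \<in> scalar_automorphisms"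
    using act_Aut act_homogeneous unfolding scalar_automorphisms_def by blast
next
  fix \<phi> assume \<phi>: "\<phi> \<in> scalar_automorphisms"
  then have Aut: "bij \<phi>" "lin \<phi>" "\<And>f g. \<phi> (f * g) = \<phi> f * \<phi> g" "\<phi> 1 = 1"
    by (auto simp: scalar_automorphisms_def Aut_iff)
  obtain \<mu> where \<mu>: "\<And>a f. f \<in> W a \<Longrightarrow> \<phi> f = scale (\<mu> a) f"
    using scalar_character[OF \<phi>] by blast
  have nz: "\<mu> a \<noteq> 0" if a: "a \<in> weights" for a
  proof
    assume "\<mu> a = 0"
    moreover obtain f where f: "f \<in> W a" "f \<noteq> 0" using weight_vector[OF a] by blast
    ultimately have "\<phi> f = \<phi> 0" using \<mu>[OF f(1)] lin_zero[OF Aut(2)] by simp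
    then show False using Aut(1) f(2) by (metis bij_is_inj inj_eq)
  qed
  have mult: "\<mu> (a + b) = \<mu> a * \<mu> b" if a: "a \<in> weights" and b: "b \<in> weights" for a b
  proof -
    obtain f where f: "f \<in> W a" "f \<noteq> 0" using weight_vector[OF a] by blast
    obtain g where g: "g \<in> W b" "g \<noteq> 0" using weight_vector[OF b] by blast
    have "scale (\<mu> (a + b)) (f * g) = scale (\<mu> a * \<mu> b) (f * g)"
      using Aut(3)[of f g] \<mu>[OF mult_W[OF f(1) g(1)]] \<mu>[OF f(1)] \<mu>[OF g(1)]
      by (simp add: scale_mult_left scale_mult_right mult.commute)
    moreover have "f * g \<noteq> 0" using f(2) g(2) by simp
    ultimately show ?thesis by (simp only: scale_cancel_right) blast
  qed
  have "\<exists>c. \<exists>a\<in>weights. \<exists>b\<in>weights. l = a - b \<and> c = \<mu> a / \<mu> b" if "l \<in> weight_lattice" for l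
    using that by (auto simp: weight_lattice_def)
  then obtain \<Lambda> where \<Lambda>: "\<And>l. l \<in> weight_lattice \<Longrightarrow>
      \<exists>a\<in>weights. \<exists>b\<in>weights. l = a - b \<and> \<Lambda> l = \<mu> a / \<mu> b"
    by metis
  have \<Lambda>_eq: "\<Lambda> l = \<mu> a / \<mu> b" if "a \<in> weights" "b \<in> weights" "l = a - b" for l a b
  proof -
    have "l \<in> weight_lattice" using that by (auto simp: weight_lattice_def)
    then obtain a' b' where *: "a' \<in> weights" "b' \<in> weights" "l = a' - b'" "\<Lambda> l = \<mu> a' / \<mu> b'"
      using \<Lambda> by blast
    then have "a + b' = a' + b" using that(3) by (simp add: algebra_simps)
    then have "\<mu> a * \<mu> b' = \<mu> a' * \<mu> b" using mult that *(1,2) by metis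
    then show ?thesis using *(4) nz that(2) *(2) by (simp add: frac_eq_eq)
  qed
  define t where "t = (\<lambda>j\<in>{..<m}. \<Lambda> (single j 1))"
  have \<Lambda>_nz: "\<Lambda> l \<noteq> 0" if "l \<in> weight_lattice" for l
    using \<Lambda>[OF that] nz by force
  have \<Lambda>_hom: "\<Lambda> (k + l) = \<Lambda> k * \<Lambda> l" if k: "k \<in> weight_lattice" and l: "l \<in> weight_lattice" for k l
  proof -
    obtain a b where a: "a \<in> weights" "b \<in> weights" "k = a - b" "\<Lambda> k = \<mu> a / \<mu> b" using \<Lambda>[OF k] by blast
    obtain c d where c: "c \<in> weights" "d \<in> weights" "l = c - d" "\<Lambda> l = \<mu> c / \<mu> d" using \<Lambda>[OF l] by blast
    have "k + l = (a + c) - (b + d)" using a(3) c(3) by simp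
    then have "\<Lambda> (k + l) = \<mu> (a + c) / \<mu> (b + d)"
      using \<Lambda>_eq[OF weights_add weights_add] a c by blast
    then show ?thesis using a c by (simp add: mult)
  qed
  have t: "t \<in> carrier (std_torus m)"
    unfolding t_def torus_carrier using \<Lambda>_nz[OF full] by auto
  have chr: "chr m a t = \<mu> a" if "a \<in> weights" for a
  proof -
    have "\<Lambda> a = chr m a t"
      unfolding t_def using weights_exponents that
      by (intro lattice_character[of weight_lattice] weight_lattice_zero weight_lattice_add
          weight_lattice_minus full \<Lambda>_hom \<Lambda>_nz) auto
    moreover have "\<mu> 0 = 1"
      using \<mu>[OF one_W] Aut(4) scale_cancel_right[of "\<mu> 0" 1 1] by simp
    ultimately show ?thesis using \<Lambda>_eq[OF that weights_zero, of a] by simp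
  qed
  have "\<phi> f = act t f" for f
  proof (induction f rule: homogeneous_induct)
    case (homogeneous a f)
    show ?case
    proof (cases "f = 0")
      case False
      then have "a \<in> weights" using homogeneous by (auto simp: weights_def)
      then show ?thesis using \<mu>[OF homogeneous] chr act_homogeneous[OF homogeneous] by simp
    qed (simp add: lin_zero[OF Aut(2)] lin_zero[OF act_lin])
  next
    case (add f g)
    then show ?case by (simp add: lin_add[OF Aut(2)] lin_add[OF act_lin])
  qed
  then show "\<phi> \<in> act ` carrier (std_torus m)" using t by blast
qed

lemma group_Aut: "group (Aut scale)"
proof (rule groupI)
  show "\<psi> \<otimes>\<^bsub>Aut scale\<^esub> \<phi> \<in> carrier (Aut scale)"
    if "\<psi> \<in> carrier (Aut scale)" "\<phi> \<in> carrier (Aut scale)" for \<psi> \<phi>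
  proof -
    have "lin (\<lambda>f. \<psi> (\<phi> f))"
      using that lin_add lin_scale by (intro linI) (auto simp: Aut_iff)
    then show ?thesis using that by (auto simp: Aut_def comp_def intro: bij_comp[unfolded comp_def])
  qed
  show "\<one>\<^bsub>Aut scale\<^esub> \<in> carrier (Aut scale)"
    by (auto simp: Aut_def intro: linI)
  show "\<exists>\<psi> \<in> carrier (Aut scale). \<psi> \<otimes>\<^bsub>Aut scale\<^esub> \<phi> = \<one>\<^bsub>Aut scale\<^esub>"
    if "\<phi> \<in> carrier (Aut scale)" for \<phi>
    using Aut_inv[OF that] that
    by (intro bexI[of _ "inv_into UNIV \<phi>"]) (auto simp: Aut_def fun_eq_iff bij_is_inj)
qed (auto simp: Aut_def comp_assoc)

lemma act_hom: "act \<in> hom (std_torus m) (Aut scale)"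
proof (rule homI)
  show "act (s \<otimes>\<^bsub>std_torus m\<^esub> t) = act s \<otimes>\<^bsub>Aut scale\<^esub> act t" for s t
    by (simp add: Aut_def fun_eq_iff act_act)
qed (rule act_Aut)

lemma act_inj: "inj_on act (carrier (std_torus m))"
proof (rule inj_onI)
  fix s t assume st: "s \<in> carrier (std_torus m)" "t \<in> carrier (std_torus m)" "act s = act t"
  have eq: "chr m a s = chr m a t" if a: "a \<in> weights" for a
  proof -
    obtain f where f: "f \<in> W a" "f \<noteq> 0" using weight_vector[OF a] by blast
    have "scale (chr m a s) f = scale (chr m a t) f"
      using st(3) act_homogeneous[OF f(1)] by metis
    then show ?thesis using f(2) by simp
  qed
  have "s j = t j" if j: "j < m" for j
  proof -
    obtain a b where ab: "single j 1 = a - b" "a \<in> weights" "b \<in> weights"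
      using full[OF j] by (auto simp: weight_lattice_def)
    then have "single j 1 + b = a" by simp
    then have "chr m (single j 1) s * chr m b s = chr m (single j 1) t * chr m b t"
      using eq[OF ab(2)] by (simp flip: chr_add[OF st(1)] chr_add[OF st(2)])
    then show ?thesis
      using eq[OF ab(3)] chr_nonzero[OF st(2)] by (simp add: chr_single[OF j])
  qed
  then show "s = t" using st(1,2) unfolding torus_carrier by (auto intro!: extensionalityI[of s "{..<m}" t])
qed

lemma act_bounded: "\<exists>d. scalar_automorphisms \<subseteq> Aut_filtration scale X ev d"
proof -
  interpret G: group "std_torus m :: (nat \<Rightarrow> 'k) monoid" by (rule group_std_torus)
  have "finite (\<Union>i. (\<lambda>a. proj a (x i)) ` supp (x i))" by (intro finite_UN_I) auto
  then obtain d where "(\<Union>i. (\<lambda>a. proj a (x i)) ` supp (x i)) \<subseteq> degree_le scale X ev d"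
    using degree_le_finite by blast
  then have d: "proj a (x i) \<in> degree_le scale X ev d" if "a \<in> supp (x i)" for a i
    using that by blast
  have "act t (x i) \<in> degree_le scale X ev d" for t i
    unfolding act_def using d
    by (intro subspace_sum[OF subspace_degree_le] subspace_scale[OF subspace_degree_le])
  then have "act t \<in> Aut_filtration scale X ev d" if "t \<in> carrier (std_torus m)" for t
    using act_Aut[OF that] by (simp add: Aut_filtration_def act_inverse[OF that])
  then show ?thesis unfolding scalar_automorphisms_eq by blast
qed

text \<open>An automorphism acts by scalars on a weight space if and only if it maps each weight vector
  \<open>f\<close> into the common kernel of the functionals that vanish at \<open>f\<close>.\<close>

lemma scalar_automorphisms_closed: "Aut_closed scale X ev scalar_automorphisms"
  unfolding Aut_closed_def
proof (intro conjI allI)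
  show "scalar_automorphisms \<subseteq> carrier (Aut scale)" by (auto simp: scalar_automorphisms_def)
  fix d
  let ?Z = "Aut_filtration scale X ev d"
  define S where "S = {P \<in> Aut_funs scale X ev. \<exists>a f l. f \<in> W a \<and> functional l \<and> l f = 0 \<and>
    (\<forall>\<phi>\<in>?Z. P \<phi> = l (\<phi> f))}"
  have "\<phi> \<in> scalar_automorphisms" if \<phi>: "\<phi> \<in> ?Z" "\<forall>P\<in>S. P \<phi> = 0" for \<phi>
  proof -
    have "\<exists>c. \<phi> f = scale c f" if f: "f \<in> W a" for a f
    proof (rule ccontr)
      assume no: "\<nexists>c. \<phi> f = scale c f"
      then have "\<phi> f \<notin> span {f}" by (auto simp: span_singleton)
      then obtain l where l: "functional l" "l (\<phi> f) = 1" "l f = 0"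
        using functional_separating[of "\<phi> f" "{f}"] by blast
      obtain P where P: "P \<in> Aut_funs scale X ev" "\<forall>\<phi>\<in>?Z. P \<phi> = l (\<phi> f)"
        using functional_orbit_regular(1)[OF l(1), of d f] by blast
      then have "P \<in> S" unfolding S_def using f l by blast
      then have "P \<phi> = 0" using \<phi>(2) by blast
      moreover have "P \<phi> = l (\<phi> f)" using P(2) \<phi>(1) by blast
      ultimately show False using l(2) by simp
    qed
    then show ?thesis using \<phi>(1) by (auto simp: scalar_automorphisms_def Aut_filtration_def)
  qed
  moreover have "P \<phi> = 0" if \<phi>: "\<phi> \<in> ?Z" "\<phi> \<in> scalar_automorphisms" and P: "P \<in> S" for \<phi> P
  proof -
    obtain a f l where f: "f \<in> W a" "functional l" "l f = 0" "\<forall>\<phi>\<in>?Z. P \<phi> = l (\<phi> f)"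
      using P unfolding S_def by blast
    then obtain c where "\<phi> f = scale c f" using \<phi>(2) unfolding scalar_automorphisms_def by blast
    then show ?thesis using f \<phi>(1) by (simp add: functional_scale[OF f(2)])
  qed
  ultimately have "scalar_automorphisms \<inter> ?Z = {\<phi> \<in> ?Z. \<forall>P\<in>S. P \<phi> = 0}" by blast
  moreover have "S \<subseteq> Aut_funs scale X ev" unfolding S_def by blast
  ultimately show "\<exists>S\<subseteq>Aut_funs scale X ev. scalar_automorphisms \<inter> ?Z = {\<phi> \<in> ?Z. \<forall>P\<in>S. P \<phi> = 0}"
    by blast
qed

text \<open>A functional with value \<open>1\<close> at a weight vector \<open>f\<close> maps the image of \<open>f\<close> under \<open>act t\<close> to
  \<open>chr m a t\<close>.\<close>

lemma weight_regular:
  assumes a: "a \<in> weights"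
  shows "\<exists>P \<in> Aut_funs scale X ev. \<forall>t \<in> carrier (std_torus m). P (act t) = chr m a t"
    and "\<exists>P \<in> Aut_funs scale X ev. \<forall>t \<in> carrier (std_torus m). P (act t) = inverse (chr m a t)"
proof -
  interpret G: group "std_torus m :: (nat \<Rightarrow> 'k) monoid" by (rule group_std_torus)
  obtain f where f: "f \<in> W a" "f \<noteq> 0" using weight_vector[OF a] by blast
  then obtain l where l: "functional l" "l f = 1"
    using functional_separating[of f "{}"] by auto
  obtain d where d: "\<And>t. t \<in> carrier (std_torus m) \<Longrightarrow> act t \<in> Aut_filtration scale X ev d"
    using act_bounded unfolding scalar_automorphisms_eq by blast
  obtain P where "P \<in> Aut_funs scale X ev" "\<forall>\<phi>\<in>Aut_filtration scale X ev d. P \<phi> = l (\<phi> f)"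
    using functional_orbit_regular(1)[OF l(1), of d f] by blast
  then show "\<exists>P \<in> Aut_funs scale X ev. \<forall>t \<in> carrier (std_torus m). P (act t) = chr m a t"
    using d by (intro bexI[of _ P]) (auto simp: act_homogeneous[OF f(1)] functional_scale[OF l(1)] l(2))
  obtain Q where Q: "Q \<in> Aut_funs scale X ev"
    "\<forall>\<phi>\<in>Aut_filtration scale X ev d. Q \<phi> = l (inv_into UNIV \<phi> f)"
    using functional_orbit_regular(2)[OF l(1), of d f] by blast
  have "Q (act t) = inverse (chr m a t)" if t: "t \<in> carrier (std_torus m)" for t
    using Q(2) d[OF t]
    by (simp add: act_inverse[OF t] act_homogeneous[OF f(1)] functional_scale[OF l(1)] l(2)
        chr_inv[OF t] chr_uminus[OF t])
  then show "\<exists>P \<in> Aut_funs scale X ev. \<forall>t \<in> carrier (std_torus m). P (act t) = inverse (chr m a t)"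
    using Q(1) by blast
qed

text \<open>The coordinates of the torus are quotients of the characters of two weights.\<close>

lemma torus_fun_regular:
  assumes "p \<in> std_torus_funs m"
  shows "\<exists>P \<in> Aut_funs scale X ev. \<forall>t \<in> carrier (std_torus m). P (act t) = p t"
  using assms unfolding std_torus_funs_def
proof induction
  case (const c)
  show ?case by (intro bexI[of _ "\<lambda>_. c"]) (auto simp: Aut_funs_def intro: fun_algebra.const)
next
  case (generator p)
  then obtain j where j: "j < m" "p = (\<lambda>t. t j) \<or> p = (\<lambda>t. inverse (t j))" by auto
  obtain a b where ab: "single j 1 = a - b" "a \<in> weights" "b \<in> weights"
    using full[OF j(1)] by (auto simp: weight_lattice_def)
  have quot: "t j = chr m a t * inverse (chr m b t)" if t: "t \<in> carrier (std_torus m)" for t :: "nat \<Rightarrow> 'k"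
  proof -
    have "chr m a t = chr m (single j 1) t * chr m b t"
      using ab(1) by (simp flip: chr_add[OF t])
    then show ?thesis using chr_nonzero[OF t] by (simp add: chr_single[OF j(1)])
  qed
  have prod: "\<exists>R \<in> Aut_funs scale X ev. \<forall>t \<in> carrier (std_torus m). R (act t) = p t * q t"
    if "\<exists>P \<in> Aut_funs scale X ev. \<forall>t \<in> carrier (std_torus m). P (act t) = p t"
      "\<exists>Q \<in> Aut_funs scale X ev. \<forall>t \<in> carrier (std_torus m). Q (act t) = q t" for p q
  proof -
    from that obtain P Q where "P \<in> Aut_funs scale X ev" "Q \<in> Aut_funs scale X ev"
      "\<forall>t \<in> carrier (std_torus m). P (act t) = p t" "\<forall>t \<in> carrier (std_torus m). Q (act t) = q t" by blast
    then show ?thesis unfolding Aut_funs_def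
      by (intro bexI[of _ "\<lambda>\<phi>. P \<phi> * Q \<phi>"]) (auto intro: fun_algebra.mult)
  qed
  from j(2) show ?case
  proof
    assume p: "p = (\<lambda>t. t j)"
    show ?thesis
      using prod[OF weight_regular(1)[OF ab(2)] weight_regular(2)[OF ab(3)]] by (simp add: p quot)
  next
    assume p: "p = (\<lambda>t. inverse (t j))"
    show ?thesis
      using prod[OF weight_regular(1)[OF ab(3)] weight_regular(2)[OF ab(2)]]
      by (simp add: p quot mult.commute)
  qed
next
  case (add p q)
  then obtain P Q where "P \<in> Aut_funs scale X ev" "Q \<in> Aut_funs scale X ev"
    "\<forall>t \<in> carrier (std_torus m). P (act t) = p t" "\<forall>t \<in> carrier (std_torus m). Q (act t) = q t" by blast
  then show ?case unfolding Aut_funs_def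
    by (intro bexI[of _ "\<lambda>\<phi>. P \<phi> + Q \<phi>"]) (auto intro: fun_algebra.add)
next
  case (mult p q)
  then obtain P Q where "P \<in> Aut_funs scale X ev" "Q \<in> Aut_funs scale X ev"
    "\<forall>t \<in> carrier (std_torus m). P (act t) = p t" "\<forall>t \<in> carrier (std_torus m). Q (act t) = q t" by blast
  then show ?case unfolding Aut_funs_def
    by (intro bexI[of _ "\<lambda>\<phi>. P \<phi> * Q \<phi>"]) (auto intro: fun_algebra.mult)
qed

lemma Aut_fun_torus_fun:
  assumes "P \<in> Aut_funs scale X ev"
  shows "\<exists>p \<in> std_torus_funs m. \<forall>t \<in> carrier (std_torus m). P (act t) = p t"
  using assms unfolding Aut_funs_def
proof induction
  case (const c)
  show ?case by (intro bexI[of _ "\<lambda>_. c"]) (auto simp: std_torus_funs_def intro: fun_algebra.const)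
next
  case (generator P)
  then consider (direct) l i where "functional l" "P = (\<lambda>\<phi>. l (\<phi> (x i)))"
    | (inverse) l i where "functional l" "P = (\<lambda>\<phi>. l (inv_into UNIV \<phi> (x i)))" by blast
  then show ?case
  proof cases
    case direct
    have "(\<lambda>t. \<Sum>a\<in>supp (x i). chr m a t * l (proj a (x i))) \<in> std_torus_funs m"
      unfolding std_torus_funs_def
      by (intro fun_algebra_sum fun_algebra.mult fun_algebra.const chr_regular[unfolded std_torus_funs_def])
    then show ?thesis
      by (rule bexI[rotated])
        (simp add: direct(2) act_def functional_sum[OF direct(1)] functional_scale[OF direct(1)])
  next
    case inverse
    have "(\<lambda>t. \<Sum>a\<in>supp (x i). chr m (- a) t * l (proj a (x i))) \<in> std_torus_funs m"
      unfolding std_torus_funs_def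
      by (intro fun_algebra_sum fun_algebra.mult fun_algebra.const chr_regular[unfolded std_torus_funs_def])
    moreover have "P (act t) = (\<Sum>a\<in>supp (x i). chr m (- a) t * l (proj a (x i)))"
      if t: "t \<in> carrier (std_torus m)" for t
      unfolding inverse(2) act_inverse[OF t] act_def
      by (simp add: chr_inv[OF t] functional_sum[OF inverse(1)] functional_scale[OF inverse(1)])
    ultimately show ?thesis by (intro bexI ballI)
  qed
next
  case (add P Q)
  then obtain p q where "p \<in> std_torus_funs m" "q \<in> std_torus_funs m"
    "\<forall>t \<in> carrier (std_torus m). P (act t) = p t" "\<forall>t \<in> carrier (std_torus m). Q (act t) = q t" by blast
  then show ?case unfolding std_torus_funs_def
    by (intro bexI[of _ "\<lambda>t. p t + q t"]) (auto intro: fun_algebra.add)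
next
  case (mult P Q)
  then obtain p q where "p \<in> std_torus_funs m" "q \<in> std_torus_funs m"
    "\<forall>t \<in> carrier (std_torus m). P (act t) = p t" "\<forall>t \<in> carrier (std_torus m). Q (act t) = q t" by blast
  then show ?case unfolding std_torus_funs_def
    by (intro bexI[of _ "\<lambda>t. p t * q t"]) (auto intro: fun_algebra.mult)
qed

theorem scalar_automorphisms_torus:
  assumes "scalar_automorphisms \<subseteq> G"
  shows "torus_in scale X ev G scalar_automorphisms"
proof -
  interpret H: group_hom "std_torus m" "Aut scale" act
    by (intro group_hom.intro group_hom_axioms.intro group_std_torus group_Aut act_hom)
  have "subgroup scalar_automorphisms (Aut scale)"
    unfolding scalar_automorphisms_eq by (rule H.img_is_subgroup)
  then have "closed_algebraic_subgroup scale X ev scalar_automorphisms"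
    using scalar_automorphisms_closed act_bounded by (simp add: closed_algebraic_subgroup_def)
  moreover have "act \<in> iso (std_torus m) (Aut scale\<lparr>carrier := scalar_automorphisms\<rparr>)"
    using act_hom act_inj unfolding iso_def bij_betw_def hom_def scalar_automorphisms_eq by auto
  then have "torus_iso scale X ev scalar_automorphisms m act"
    using torus_fun_regular Aut_fun_torus_fun unfolding torus_iso_def by blast
  ultimately show ?thesis using assms unfolding torus_in_def by blast
qed

end

section \<open>Lattices projecting onto a coordinate sublattice\<close>

lemma exponents_upd:
  assumes "c(r := 0) \<in> exponents r"
  shows "c \<in> exponents (Suc r)"
  unfolding exponents_def
proof (intro CollectI allI impI)
  fix i assume i: "Suc r \<le> i"
  have "(c(r := 0)) i = 0" using assms Suc_leD[OF i] unfolding exponents_def by blast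
  then show "c i = 0" using i by simp
qed

lemma int_multiple_closed:
  fixes L :: "(nat \<Rightarrow> int) set"
  assumes "0 \<in> L" and add: "\<And>a b. a \<in> L \<Longrightarrow> b \<in> L \<Longrightarrow> a + b \<in> L"
    and minus: "\<And>a. a \<in> L \<Longrightarrow> - a \<in> L" and a: "a \<in> L"
  shows "(\<lambda>i. k * a i) \<in> L"
proof (induction k rule: int_induct[where k = 0])
  case base
  have "(\<lambda>i. 0 * a i) = 0" by (simp add: fun_eq_iff)
  then show ?case using assms(1) by metis
next
  case (step1 k)
  have "(\<lambda>i. (k + 1) * a i) = (\<lambda>i. k * a i) + a" by (simp add: fun_eq_iff algebra_simps)
  then show ?case using add[OF step1(2) a] by metis
next
  case (step2 k)
  have "(\<lambda>i. (k - 1) * a i) = (\<lambda>i. k * a i) + - a" by (simp add: fun_eq_iff algebra_simps)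
  then show ?case using add[OF step2(2) minus[OF a]] by metis
qed

lemma int_subgroup_generator:
  fixes S :: "int set"
  assumes zero: "0 \<in> S" and add: "\<And>a b. a \<in> S \<Longrightarrow> b \<in> S \<Longrightarrow> a + b \<in> S"
    and minus: "\<And>a. a \<in> S \<Longrightarrow> - a \<in> S"
  shows "\<exists>d\<in>S. \<forall>n\<in>S. d dvd n"
proof (cases "S = {0}")
  case False
  then obtain n where n: "n \<in> S" "n \<noteq> 0" using zero by blast
  then have "\<exists>k. k > 0 \<and> int k \<in> S"
    using minus[OF n(1)] by (intro exI[of _ "nat \<bar>n\<bar>"]) (auto simp: abs_if)
  define d where "d = (LEAST k. k > 0 \<and> int k \<in> S)"
  have d: "d > 0" "int d \<in> S"
    using LeastI_ex[OF \<open>\<exists>k. k > 0 \<and> int k \<in> S\<close>] by (auto simp: d_def)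
  have mult: "k * int d \<in> S" for k
  proof (induction k rule: int_induct[where k = 0])
    case (step1 k)
    then show ?case using add[OF step1(2) d(2)] by (simp add: algebra_simps)
  next
    case (step2 k)
    then show ?case using add[OF step2(2) minus[OF d(2)]] by (simp add: algebra_simps)
  qed (simp add: zero)
  have "int d dvd n" if n: "n \<in> S" for n
  proof -
    have "n mod int d = n + - ((n div int d) * int d)"
      by (simp add: minus_div_mult_eq_mod)
    then have "n mod int d \<in> S" using add[OF n minus[OF mult]] by metis
    moreover have "0 \<le> n mod int d" "n mod int d < int d" using d(1) by simp_all
    ultimately have "n mod int d = 0"
      using not_less_Least[of "nat (n mod int d)" "\<lambda>k. k > 0 \<and> int k \<in> S"]
      by (auto simp: d_def[symmetric])
    then show ?thesis by (rule dvd_eq_mod_eq_0[THEN iffD2])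
  qed
  then show ?thesis using d(2) by blast
qed auto

text \<open>Coordinates on the lattice can be chosen such that the last coordinate is either a linear
  function of the others (\<open>d = 0\<close>) or becomes independent of them after subtraction of a linear
  function and division by \<open>d\<close>.\<close>

lemma lattice_last_coordinate:
  fixes L :: "(nat \<Rightarrow> int) set"
  assumes zero: "0 \<in> L" and add: "\<And>a b. a \<in> L \<Longrightarrow> b \<in> L \<Longrightarrow> a + b \<in> L"
    and minus: "\<And>a. a \<in> L \<Longrightarrow> - a \<in> L"
    and sub: "L \<subseteq> exponents (Suc r)"
    and unit: "\<And>j. j < r \<Longrightarrow> \<exists>c\<in>L. c(r := 0) = single j 1"
  shows "\<exists>h d. single r d \<in> L \<and> (\<forall>j<r. (single j 1)(r := h j) \<in> L) \<and>
    (\<forall>c\<in>L. d dvd c r - (\<Sum>j<r. h j * c j))"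
proof -
  have "\<exists>k. (single j 1)(r := k) \<in> L" if j: "j < r" for j
  proof -
    obtain c where c: "c \<in> L" "c(r := 0) = single j 1" using unit[OF j] by blast
    then have "(single j 1)(r := c r) = c" by (metis fun_upd_triv fun_upd_upd)
    then have "(single j 1)(r := c r) \<in> L" using c(1) by simp
    then show ?thesis ..
  qed
  then obtain h where h: "\<And>j. j < r \<Longrightarrow> (single j 1)(r := h j) \<in> L" by metis
  define N where "N = {n. single r n \<in> L}"
  have "\<exists>d\<in>N. \<forall>n\<in>N. d dvd n"
  proof (rule int_subgroup_generator)
    have "single r 0 = 0" by (auto simp: single_def fun_eq_iff)
    then show "0 \<in> N" using zero unfolding N_def by (metis mem_Collect_eq)
    show "k + l \<in> N" if "k \<in> N" "l \<in> N" for k l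
      using that add unfolding N_def mem_Collect_eq single_add by blast
    show "- k \<in> N" if "k \<in> N" for k
    proof -
      have "single r (- k) = - single r k" by (auto simp: single_def fun_eq_iff)
      then show ?thesis using that minus unfolding N_def by (metis mem_Collect_eq)
    qed
  qed
  then obtain d where d: "d \<in> N" "\<And>n. n \<in> N \<Longrightarrow> d dvd n" by blast
  have "d dvd c r - (\<Sum>j<r. h j * c j)" if c: "c \<in> L" for c
  proof -
    \<comment> \<open>Eliminate the first \<open>r\<close> coordinates one after the other.\<close>
    let ?c = "\<lambda>n i. if i < n then 0 else if i = r then c r - (\<Sum>j<n. h j * c j) else c i"
    have "?c n \<in> L" if "n \<le> r" for n
      using that
    proof (induction n)
      case 0
      have "?c 0 = c" by (auto simp: fun_eq_iff)
      then show ?case using c by metis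
    next
      case (Suc n)
      then have n: "n < r" "?c n \<in> L" by auto
      have "(\<lambda>i. (- c n) * ((single n 1)(r := h n)) i) \<in> L"
        using int_multiple_closed[OF zero add minus h[OF n(1)]] .
      from add[OF n(2) this] have "?c n + (\<lambda>i. (- c n) * ((single n 1)(r := h n)) i) \<in> L" .
      moreover have "?c (Suc n) = ?c n + (\<lambda>i. (- c n) * ((single n 1)(r := h n)) i)"
        using n(1) by (auto simp: fun_eq_iff single_def less_Suc_eq algebra_simps)
      ultimately show ?case by metis
    qed
    then have "?c r \<in> L" by simp
    moreover have "?c r = single r (c r - (\<Sum>j<r. h j * c j))"
    proof -
      have "c i = 0" if "i > r" for i
        using c sub that by (auto simp: exponents_def)
      then show ?thesis by (auto simp: fun_eq_iff single_def)
    qed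
    ultimately have "c r - (\<Sum>j<r. h j * c j) \<in> N" unfolding N_def by (metis mem_Collect_eq)
    then show ?thesis by (rule d(2))
  qed
  then show ?thesis using h d(1) unfolding N_def by blast
qed

section \<open>Torus weights on the kernel of a maximal locally nilpotent derivation\<close>

locale maximal_torus_isotropy = coordinate_algebra scale X ev
  for scale :: "'k::{alg_closed_field, field_char_0} \<Rightarrow> 'b::idom \<Rightarrow> 'b"
    and X :: "('n::finite \<Rightarrow> 'k) set" and ev +
  fixes \<delta> :: "'b \<Rightarrow> 'b" and T :: "('b \<Rightarrow> 'b) set"
    and r :: nat and \<theta> :: "(nat \<Rightarrow> 'k) \<Rightarrow> 'b \<Rightarrow> 'b" and d :: nat
  assumes max: "maximal_LND scale \<delta>"
    and max_torus: "maximal_torus_in scale X ev (isotropy scale \<delta>) T"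
    and iso: "torus_iso scale X ev T r \<theta>"
    and bounded: "T \<subseteq> Aut_filtration scale X ev d"
begin

abbreviation W :: "(nat \<Rightarrow> int) \<Rightarrow> 'b set" where
  "W \<equiv> weight_space r \<theta>"

sublocale W: grading scale W
  by (rule torus_grading[OF iso bounded])

lemma T_eq: "T = \<theta> ` carrier (std_torus r)"
  using iso by (auto simp: torus_iso_def iso_def bij_betw_def)

lemma T_isotropy: "T \<subseteq> isotropy scale \<delta>"
  using max_torus by (simp add: maximal_torus_in_def torus_in_def)

lemma LND_\<delta>: "LND scale \<delta>"
  using max by (simp add: maximal_LND_def)

lemma lin_\<delta>: "lin \<delta>"
  using LND_\<delta> by (simp add: LND_def derivation_lin)

lemma \<delta>_W:
  assumes "f \<in> W a"
  shows "\<delta> f \<in> W a"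
proof -
  have "\<theta> t (\<delta> f) = scale (chr r a t) (\<delta> f)" if t: "t \<in> carrier (std_torus r)" for t
  proof -
    have "\<theta> t \<in> isotropy scale \<delta>" using T_eq T_isotropy t by blast
    then have "\<theta> t (\<delta> f) = \<delta> (\<theta> t f)" by (simp add: isotropy_def fun_eq_iff)
    also have "\<theta> t f = scale (chr r a t) f" using assms t by (simp add: weight_space_def)
    finally show ?thesis by (simp add: lin_scale[OF lin_\<delta>])
  qed
  moreover have "a \<in> exponents r" if "\<delta> f \<noteq> 0"
    using assms that lin_zero[OF lin_\<delta>] by (auto simp: weight_space_def)
  ultimately show ?thesis by (simp add: weight_space_def)
qed

lemma W_exponents: "f \<in> W a \<Longrightarrow> f \<noteq> 0 \<Longrightarrow> a \<in> exponents r"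
  by (simp add: weight_space_def)

text \<open>The torus separates its weights, so a semi-invariant has a single weight.\<close>

lemma semi_invariant_iff:
  "f \<in> semi_invariants scale T (Ker \<delta>) \<longleftrightarrow> \<delta> f = 0 \<and> (\<exists>a. f \<in> W a)"
proof
  assume f: "f \<in> semi_invariants scale T (Ker \<delta>)"
  have chr: "chr r a t = chr r b t"
    if t: "t \<in> carrier (std_torus r)" and ab: "a \<in> W.supp f" "b \<in> W.supp f" for t :: "nat \<Rightarrow> 'k" and a b
  proof -
    have "\<theta> t \<in> T" using T_eq t by blast
    then obtain c where c: "\<theta> t f = scale c f" using f unfolding semi_invariants_def by blast
    have "chr r a t = c" if a: "a \<in> W.supp f" for a
    proof -
      have "scale c (W.proj a f) = W.proj a (\<theta> t f)" by (simp add: c W.proj_scale)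
      also have "\<dots> = (\<Sum>b\<in>W.supp f. scale (chr r b t) (W.proj a (W.proj b f)))"
        by (simp add: torus_expand[OF iso bounded t] W.proj_sum W.proj_scale)
      also have "\<dots> = (\<Sum>b\<in>W.supp f. if b = a then scale (chr r a t) (W.proj a f) else 0)"
        using W.proj_homogeneous[OF W.proj_in_W] by (intro sum.cong) auto
      also have "\<dots> = scale (chr r a t) (W.proj a f)" using a by simp
      finally have "scale c (W.proj a f) = scale (chr r a t) (W.proj a f)" .
      moreover have "W.proj a f \<noteq> 0" using a by (simp add: W.supp_def)
      ultimately show ?thesis by simp
    qed
    then show ?thesis using ab by metis
  qed
  have single: "a = b" if "a \<in> W.supp f" "b \<in> W.supp f" for a b
  proof (rule ccontr)
    assume "a \<noteq> b"
    moreover have "a \<in> exponents r" "b \<in> exponents r"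
      using that W_exponents[OF W.proj_in_W] by (auto simp: W.supp_def)
    ultimately show False using chr_separate[of a r b] chr[OF _ that] by metis
  qed
  have "\<exists>a. W.supp f \<subseteq> {a}" using single by blast
  then obtain a where "W.supp f \<subseteq> {a}" ..
  then have "f \<in> W a" unfolding W.homogeneous_iff by (auto simp: W.supp_def)
  then show "\<delta> f = 0 \<and> (\<exists>a. f \<in> W a)" using f by (auto simp: semi_invariants_def Ker_def)
next
  assume "\<delta> f = 0 \<and> (\<exists>a. f \<in> W a)"
  then show "f \<in> semi_invariants scale T (Ker \<delta>)"
    unfolding T_eq semi_invariants_def Ker_def weight_space_def by blast
qed

context
  fixes D :: "'b \<Rightarrow> 'b"
  assumes D: "derivation scale D" and diag: "diagonalizable D"
    and comm: "\<And>f. D (\<delta> f) = \<delta> (D f)"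
begin

lemma lin_D: "lin D"
  by (rule derivation_lin[OF D])

text \<open>The \<open>\<int>\<close>-gradings by the single coordinates of the weight together determine the weight.\<close>

lemma D_homogeneous_on_kernel:
  assumes "f \<in> W a" and "\<delta> f = 0"
  shows "D f \<in> W a"
proof (cases "f = 0")
  case True
  then show ?thesis using lin_zero[OF lin_D] by simp
next
  case False
  have coarse: "D f \<in> W.coarsen (\<lambda>a. a i) (a i)" for i
  proof (rule homogeneous_on_kernel_of_maximal_LND[where D = D and \<delta> = \<delta> and f = f and k = "a i"])
    show grading: "grading scale (W.coarsen (\<lambda>a. a i))"
      by (rule W.grading_coarsen) simp
    show "\<delta> g \<in> W.coarsen (\<lambda>a. a i) k" if g: "g \<in> W.coarsen (\<lambda>a. a i) k" for g k
      unfolding W.coarsen_def mem_Collect_eq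
    proof (intro allI impI)
      fix a assume "W.proj a (\<delta> g) \<noteq> 0"
      then have "\<delta> (W.proj a g) \<noteq> 0" by (simp add: W.proj_commute[OF lin_\<delta> \<delta>_W])
      then have "W.proj a g \<noteq> 0" using lin_zero[OF lin_\<delta>] by metis
      then show "a i = k" using g unfolding W.coarsen_def by blast
    qed
    show "finite {l. \<exists>f. grading.hcomp (W.coarsen (\<lambda>a. a i)) D l f \<noteq> 0}"
      by (rule finite_hcomp_degrees[OF grading D])
    show "maximal_LND scale \<delta>" "derivation scale D" "diagonalizable D" "D (\<delta> g) = \<delta> (D g)" "\<delta> f = 0" for g
      by (rule max D diag comm assms)+
    show "f \<in> W.coarsen (\<lambda>a. a i) (a i)"
      using W.W_subset_coarsen[of a "\<lambda>a. a i"] assms(1) by blast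
  qed
  have "b = a" if "W.proj b (D f) \<noteq> 0" for b
  proof
    fix i show "b i = a i" using coarse[of i] that unfolding W.coarsen_def by blast
  qed
  then show ?thesis unfolding W.homogeneous_iff by blast
qed

text \<open>On \<open>B\<close> the derivation \<open>D\<close> need not commute with the torus. Its component \<open>D'\<close> of degree zero
  does, commutes with \<open>\<delta>\<close> and agrees with \<open>D\<close> on \<open>Ker \<delta>\<close>, but it is not obvious that \<open>D'\<close> is
  diagonalizable. Its generalized eigenspaces suffice: induction on the order of nilpotency under
  \<open>\<delta>\<close> shows that they span \<open>B\<close> and that the eigenvalues are integers.\<close>

definition D' :: "'b \<Rightarrow> 'b" where
  "D' = W.hcomp D 0"

lemma D'_derivation: "derivation scale D'"
  unfolding D'_def by (rule W.hcomp_derivation[OF D])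

lemma lin_D': "lin D'"
  by (rule derivation_lin[OF D'_derivation])

lemma D'_W: "f \<in> W a \<Longrightarrow> D' f \<in> W a"
  unfolding D'_def using W.hcomp_in_W[OF lin_D, of f a 0] by simp

lemma D'_comm: "D' (\<delta> f) = \<delta> (D' f)"
  unfolding D'_def by (intro W.hcomp_commute lin_D lin_\<delta> \<delta>_W comm)

lemma D'_eq: "f \<in> W a \<Longrightarrow> \<delta> f = 0 \<Longrightarrow> D' f = D f"
  unfolding D'_def using W.hcomp_homogeneous[OF lin_D, of f a 0]
    W.proj_homogeneous[OF D_homogeneous_on_kernel, of f a a] by simp

lemma shift_W: "f \<in> W a \<Longrightarrow> shift D' c f \<in> W a"
  unfolding shift_def by (intro W.diff_W W.scale_W D'_W)

lemma shift_\<delta>: "\<delta> (shift D' c f) = shift D' c (\<delta> f)"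
  by (simp add: shift_def lin_diff[OF lin_\<delta>] lin_scale[OF lin_\<delta>] D'_comm)

lemma split_on_kernel:
  assumes "f \<in> W a" and "\<delta> f = 0"
  shows "split_vector D' f"
proof -
  have "split_vector D' f"
    if "finite F" "f \<in> W a" "\<delta> f = 0" "f = sum y F" "\<And>m. m \<in> F \<Longrightarrow> D (y m) = scale (of_int m) (y m)"
    for F y f
    using that
  proof (induction F arbitrary: y f rule: finite_induct)
    case empty
    then show ?case by (auto intro: split_vector.zero)
  next
    case (insert b F)
    let ?z = "\<lambda>m. scale (of_int (m - b)) (y m)"
    have "shift D' b f = shift D b f"
      using D'_eq[OF insert.prems(1,2)] by (simp add: shift_def)
    also have "\<dots> = (\<Sum>m\<in>insert b F. shift D b (y m))"
      unfolding insert.prems(3) by (rule lin_sum[OF shift_lin[OF lin_D]])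
    also have "\<dots> = (\<Sum>m\<in>insert b F. ?z m)"
      using insert.prems(4) by (intro sum.cong) (simp_all add: shift_def scale_left_diff_distrib)
    also have "\<dots> = sum ?z F" using insert.hyps by simp
    finally have "shift D' b f = sum ?z F" .
    moreover have "\<delta> (shift D' b f) = 0"
      unfolding shift_\<delta> insert.prems(2) by (rule lin_zero[OF shift_lin[OF lin_D']])
    moreover have "D (?z m) = scale (of_int m) (?z m)" if "m \<in> F" for m
      using insert.prems(4)[of m] that by (simp add: lin_scale[OF lin_D] mult.commute)
    ultimately have "split_vector D' (shift D' b f)"
      using insert.IH[of "shift D' b f" ?z] shift_W[OF insert.prems(1)] by blast
    then show ?case by (rule split_vector.shift)
  qed
  moreover obtain F y where "finite F" "f = sum y F" "\<And>m. m \<in> F \<Longrightarrow> D (y m) = scale (of_int m) (y m)"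
    using diag unfolding diagonalizable_def by metis
  ultimately show ?thesis using assms by blast
qed

text \<open>If a polynomial in \<open>D'\<close> kills \<open>\<delta> f\<close>, it maps \<open>f\<close> into \<open>Ker \<delta>\<close>, where the preceding lemma
  applies.\<close>

lemma split_homogeneous:
  assumes "f \<in> W a"
  shows "split_vector D' f"
proof -
  have lift: "split_vector D' f" if "split_vector D' g" "f \<in> W a" "\<delta> f = g" for f g
    using that
  proof (induction arbitrary: f)
    case zero
    then show ?case using split_on_kernel by blast
  next
    case (shift c g)
    have "split_vector D' (shift D' c f)"
      using shift.prems shift_W shift_\<delta> by (intro shift.IH) auto
    then show ?case by (rule split_vector.shift)
  qed
  have "split_vector D' f" if "(\<delta> ^^ n) f = 0" "f \<in> W a" for n f
    using that
  proof (induction n arbitrary: f)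
    case 0
    then show ?case by (auto intro: split_vector.zero)
  next
    case (Suc n)
    then have "split_vector D' (\<delta> f)" by (intro Suc.IH \<delta>_W) (simp add: funpow_swap1)
    then show ?case using lift Suc.prems(2) by blast
  qed
  then show ?thesis using assms LND_\<delta> unfolding LND_def by blast
qed

text \<open>The torus weights are recorded in the coordinates below \<open>r\<close> and the generalized eigenvalue in
  coordinate \<open>r\<close>.\<close>

definition W2 :: "(nat \<Rightarrow> int) \<Rightarrow> 'b set" where
  "W2 c = gen_eigenspace D' (c r) \<inter> W (c(r := 0))"

lemma W2_upd: 
  assumes "a \<in> exponents r"
  shows "W2 (a(r := k)) = gen_eigenspace D' k \<inter> W a"
proof -
  have "a(r := 0) = a" using assms by (auto simp: exponents_def)
  then show ?thesis by (simp add: W2_def)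
qed

lemma grading_W2: "grading scale W2"
proof
  show "subspace (W2 c)" for c
    unfolding W2_def by (intro subspace_inter subspace_gen_eigenspace lin_D' W.subspace_W)
  have "f \<in> span (\<Union>c. W2 c)" if f: "f \<in> W a" for f a
  proof (cases "f = 0")
    case False
    then have a: "a \<in> exponents r" using W_exponents f by blast
    have "f \<in> span (\<Union>k. gen_eigenspace D' k \<inter> W a)"
      by (rule split_vector_span[OF lin_D' split_homogeneous[OF f] W.subspace_W D'_W f])
    moreover have "(\<Union>k. gen_eigenspace D' k \<inter> W a) \<subseteq> (\<Union>c. W2 c)"
      using W2_upd[OF a] by blast
    ultimately show ?thesis using span_mono by blast
  qed (simp add: span_zero)
  then have "span (\<Union>a. W a) \<subseteq> span (\<Union>c. W2 c)" by (intro span_minimal subspace_span) blast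
  then show "span (\<Union>c. W2 c) = UNIV" using W.span_W by blast
  show "y c = 0" if F: "finite F" "\<And>c. c \<in> F \<Longrightarrow> y c \<in> W2 c" "sum y F = 0" "c \<in> F" for F y c
  proof -
    let ?a = "c(r := 0)"
    let ?F = "{e \<in> F. e(r := 0) = ?a}"
    have "0 = (\<Sum>e\<in>F. W.proj ?a (y e))" using F(3) by (simp flip: W.proj_sum)
    also have "\<dots> = (\<Sum>e\<in>?F. y e)"
    proof (rule sum.mono_neutral_cong_right)
      show "\<forall>e\<in>F - ?F. W.proj ?a (y e) = 0"
      proof
        fix e assume "e \<in> F - ?F"
        then have "e \<in> F" "?a \<noteq> e(r := 0)" by auto
        moreover from this have "y e \<in> W (e(r := 0))" using F(2) by (simp add: W2_def)
        ultimately show "W.proj ?a (y e) = 0" using W.proj_homogeneous[of "y e" "e(r := 0)" ?a] by simp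
      qed
      show "W.proj ?a (y e) = y e" if "e \<in> ?F" for e
        using F(2)[of e] that W.proj_homogeneous[of "y e" ?a ?a] unfolding W2_def by auto
    qed (use F(1) in auto)
    finally have sum0: "(\<Sum>e\<in>?F. y e) = 0" by simp
    have upd: "?a(r := e r) = e" if "e \<in> ?F" for e
    proof -
      have "?a(r := e r) = (e(r := 0))(r := e r)" using that by simp
      then show ?thesis by simp
    qed
    have inj: "inj_on (\<lambda>e. e r) ?F"
    proof (rule inj_onI)
      fix e e' assume "e \<in> ?F" "e' \<in> ?F" "e r = e' r"
      then show "e = e'" using upd[of e] upd[of e'] by simp
    qed
    have "(\<Sum>k\<in>(\<lambda>e. e r) ` ?F. y (?a(r := k))) = (\<Sum>e\<in>?F. y (?a(r := e r)))"
      using sum.reindex[OF inj, of "\<lambda>k. y (?a(r := k))"] by (simp only: o_def)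
    also have "\<dots> = (\<Sum>e\<in>?F. y e)" by (rule sum.cong[OF refl]) (simp only: upd)
    also note sum0
    finally have "y (?a(r := c r)) = 0"
    proof (rule gen_eigenspace_independent[OF lin_D', rotated 2])
      show "finite ((\<lambda>e. e r) ` ?F)" using F(1) by simp
      show "y (?a(r := k)) \<in> gen_eigenspace D' k" if k: "k \<in> (\<lambda>e. e r) ` ?F" for k
      proof -
        obtain e where e: "e \<in> ?F" "k = e r" using k by blast
        then show ?thesis using F(2)[of e] by (simp only: e(2) upd[OF e(1)]) (simp add: W2_def)
      qed
      show "c r \<in> (\<lambda>e. e r) ` ?F" using F(4) by blast
    qed
    then show ?thesis by simp
  qed
  have "(0 :: nat \<Rightarrow> int)(r := 0) = 0" by (simp add: fun_eq_iff)
  then show "1 \<in> W2 0"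
    using W.one_W gen_eigenspace_one[OF D'_derivation] by (simp add: W2_def)
  show "f * g \<in> W2 (b + c)" if "f \<in> W2 b" "g \<in> W2 c" for f g b c
  proof -
    have "(b + c)(r := 0) = b(r := 0) + c(r := 0)" by (simp add: fun_eq_iff)
    then show ?thesis
      using that gen_eigenspace_mult[OF D'_derivation] W.mult_W by (auto simp: W2_def)
  qed
qed

interpretation W2: grading scale W2 by (rule grading_W2)

lemma proj_W2:
  assumes "f \<in> W a" and "W2.proj c f \<noteq> 0"
  shows "c(r := 0) = a"
proof -
  have "W.proj a g \<in> W2 c" if "g \<in> W2 c" for g c
  proof -
    have "W.proj a g = (if a = c(r := 0) then g else 0)"
      using that by (intro W.proj_homogeneous) (simp add: W2_def)
    then show ?thesis using that by simp
  qed
  then have "W.proj a (W2.proj c f) = W2.proj c (W.proj a f)"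
    by (rule W2.proj_commute[OF W.proj_lin, symmetric])
  also have "W.proj a f = f" using W.proj_homogeneous[OF assms(1)] by simp
  finally have "W.proj a (W2.proj c f) \<noteq> 0" using assms(2) by simp
  moreover have "W2.proj c f \<in> W (c(r := 0))" using W2.proj_in_W by (simp add: W2_def)
  ultimately show ?thesis using W.proj_homogeneous by metis
qed

lemma W2_weights: "W2.weights \<subseteq> exponents (Suc r)"
proof
  fix c assume "c \<in> W2.weights"
  then obtain f where "f \<in> W (c(r := 0))" "f \<noteq> 0" by (auto simp: W2.weights_def W2_def)
  then have "c(r := 0) \<in> exponents r" by (rule W_exponents)
  then show "c \<in> exponents (Suc r)" by (rule exponents_upd)
qed

lemma W2_lattice: "W2.weight_lattice \<subseteq> exponents (Suc r)"
proof
  fix c assume "c \<in> W2.weight_lattice"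
  then obtain a b where "c = a - b" "a \<in> W2.weights" "b \<in> W2.weights"
    by (auto simp: W2.weight_lattice_def)
  moreover from this have "a \<in> exponents (Suc r)" "b \<in> exponents (Suc r)" using W2_weights by blast+
  ultimately show "c \<in> exponents (Suc r)" by (simp add: exponents_def)
qed

lemma W2_lattice_unit:
  assumes "j < r"
  shows "\<exists>c \<in> W2.weight_lattice. c(r := 0) = single j 1"
proof -
  have lift: "\<exists>c \<in> W2.weights. c(r := 0) = a" if a: "a \<in> W.weights" for a
  proof -
    obtain f where f: "f \<in> W a" "f \<noteq> 0" using a unfolding W.weights_def by blast
    then have "W2.supp f \<noteq> {}" using W2.sum_proj[of f] by auto
    then obtain c where c: "c \<in> W2.supp f" by blast
    then have "c(r := 0) = a" using proj_W2[OF f(1)] by (simp add: W2.supp_def)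
    then show ?thesis using c W2.supp_subset_weights by blast
  qed
  obtain a b where "single j 1 = a - b" "a \<in> W.weights" "b \<in> W.weights"
    using torus_weight_lattice[OF iso bounded assms] unfolding W.weight_lattice_def by blast
  moreover from this obtain a' b' where "a' \<in> W2.weights" "a'(r := 0) = a" "b' \<in> W2.weights" "b'(r := 0) = b"
    using lift by metis
  moreover have "(a' - b')(r := 0) = a'(r := 0) - b'(r := 0)" by (simp add: fun_eq_iff)
  ultimately show ?thesis unfolding W2.weight_lattice_def
    by (intro bexI[of _ "a' - b'"]) auto
qed

lemma \<delta>_W2:
  assumes "f \<in> W2 c"
  shows "\<delta> f \<in> W2 c"
  using assms \<delta>_W gen_eigenspace_commute[of D' \<delta>, OF lin_D' lin_\<delta> D'_comm] by (auto simp: W2_def)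

text \<open>Suppose that the eigenvalue of \<open>D'\<close> is not a linear function of the torus weight. Then it
  can be normalized to a further coordinate such that the weights generate \<open>\<int>\<^sup>r\<^sup>+\<^sup>1\<close>, and the torus
  of the resulting grading properly contains \<open>T\<close>.\<close>

lemma eigenvalue_linear_in_weight:
  "\<exists>h. \<forall>c \<in> W2.weights. c r = (\<Sum>j<r. h j * c j)"
proof -
  have "\<exists>h n. single r n \<in> W2.weight_lattice \<and>
    (\<forall>j<r. (single j 1)(r := h j) \<in> W2.weight_lattice) \<and>
    (\<forall>c\<in>W2.weight_lattice. n dvd c r - (\<Sum>j<r. h j * c j))"
    by (rule lattice_last_coordinate)
      (fact W2.weight_lattice_zero W2.weight_lattice_add W2.weight_lattice_minus W2_lattice W2_lattice_unit)+
  then obtain h n where hn: "single r n \<in> W2.weight_lattice \<and>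
    (\<forall>j<r. (single j 1)(r := h j) \<in> W2.weight_lattice) \<and>
    (\<forall>c\<in>W2.weight_lattice. n dvd c r - (\<Sum>j<r. h j * c j))"
    by (elim exE) (rule that)
  have n: "single r n \<in> W2.weight_lattice" using hn by (elim conjE)
  have h: "(single j 1)(r := h j) \<in> W2.weight_lattice" if "j < r" for j
    using hn that by (elim conjE) blast
  have dvd: "n dvd c r - (\<Sum>j<r. h j * c j)" if "c \<in> W2.weight_lattice" for c
    using hn that by (elim conjE) blast
  show ?thesis
  proof (cases "n = 0")
    case True
    then show ?thesis using dvd W2.weight_lattice_weights by (intro exI[of _ h]) fastforce
  next
    case False
    define u where "u c = c r - (\<Sum>j<r. h j * c j)" for c :: "nat \<Rightarrow> int"
    define g where "g c = c(r := u c div n)" for c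
    have u_add: "u (a + b) = u a + u b" for a b
      by (simp add: u_def sum.distrib algebra_simps)
    have u_diff: "u (a - b) = u a - u b" for a b
      by (simp add: u_def sum_subtractf algebra_simps)
    have udvd: "n dvd u c" if "c \<in> W2.weight_lattice" for c
      using dvd[OF that] by (simp add: u_def)
    have g_add: "g (a + b) = g a + g b" if "a \<in> W2.weight_lattice" "b \<in> W2.weight_lattice" for a b
      using udvd[OF that(1)] udvd[OF that(2)] by (auto simp: g_def u_add fun_eq_iff div_plus_div_distrib_dvd_left)
    have g_diff: "g (a - b) = g a - g b" if "a \<in> W2.weight_lattice" "b \<in> W2.weight_lattice" for a b
      using g_add[of "a - b" b] W2.weight_lattice_add[OF that(1) W2.weight_lattice_minus[OF that(2)]] that
      by simp
    let ?W3 = "W2.coarsen g"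
    have grading3: "grading scale ?W3"
      using g_add W2.weight_lattice_weights by (intro W2.grading_coarsen) blast
    interpret W3: grading scale ?W3 by (rule grading3)
    have W3_W: "f \<in> W (c(r := 0))" if f: "f \<in> ?W3 c" for f c
    proof -
      have "W2.proj e f \<in> W (c(r := 0))" if e: "e \<in> W2.supp f" for e
      proof -
        have "g e = c" using f e by (simp add: W2.coarsen_def W2.supp_def)
        then have "e(r := 0) = c(r := 0)" by (auto simp: g_def)
        moreover have "W2.proj e f \<in> W (e(r := 0))" using W2.proj_in_W by (simp add: W2_def)
        ultimately show ?thesis by simp
      qed
      then have "(\<Sum>e\<in>W2.supp f. W2.proj e f) \<in> W (c(r := 0))" by (rule W.sum_W)
      then show ?thesis by (simp only: W2.sum_proj)
    qed
    have weights3: "g c \<in> W3.weights" if "c \<in> W2.weights" for c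
      using that W2.W_subset_coarsen[of c g] unfolding W2.weights_def W3.weights_def by blast
    have lattice3: "g c \<in> W3.weight_lattice" if c: "c \<in> W2.weight_lattice" for c
    proof -
      obtain a b where ab: "c = a - b" "a \<in> W2.weights" "b \<in> W2.weights"
        using c by (auto simp: W2.weight_lattice_def)
      then have "g c = g a - g b" using g_diff W2.weight_lattice_weights by blast
      then show ?thesis using weights3 ab unfolding W3.weight_lattice_def by blast
    qed
    have unit3: "single j 1 \<in> W3.weight_lattice" if j: "j < Suc r" for j
    proof (cases "j = r")
      case True
      have "u (single r n) = n" by (simp add: u_def single_def)
      then have "g (single r n) = single r 1" using False by (auto simp: g_def single_def fun_eq_iff)
      then show ?thesis using lattice3[OF n] True by simp
    next
      case False
      then have j: "j < r" using j by simp
      have "(\<Sum>i<r. h i * ((single j 1)(r := h j)) i) = (\<Sum>i<r. if i = j then h j else 0)"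
        by (intro sum.cong) (auto simp: single_def)
      then have "u ((single j 1)(r := h j)) = 0" using j by (simp add: u_def)
      then have "g ((single j 1)(r := h j)) = single j 1"
        using j by (auto simp: g_def single_def fun_eq_iff)
      then show ?thesis using lattice3[OF h[OF j]] by simp
    qed
    have exp3: "W3.weights \<subseteq> exponents (Suc r)"
    proof
      fix c assume "c \<in> W3.weights"
      then obtain f where f: "f \<in> ?W3 c" "f \<noteq> 0" unfolding W3.weights_def by blast
      then have "c(r := 0) \<in> exponents r" using W_exponents W3_W by blast
      then show "c \<in> exponents (Suc r)" by (rule exponents_upd)
    qed
    interpret T3: full_grading scale X ev ?W3 "Suc r"
      by (intro full_grading.intro full_grading_axioms.intro coordinate_algebra_axioms grading3
          exp3 unit3)
    have \<delta>3: "\<delta> f \<in> ?W3 c" if f: "f \<in> ?W3 c" for f c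
      unfolding W2.coarsen_def mem_Collect_eq
    proof (intro allI impI)
      fix a assume "W2.proj a (\<delta> f) \<noteq> 0"
      then have "\<delta> (W2.proj a f) \<noteq> 0" by (simp add: W2.proj_commute[OF lin_\<delta> \<delta>_W2])
      then have "W2.proj a f \<noteq> 0" using lin_zero[OF lin_\<delta>] by metis
      then show "g a = c" using f unfolding W2.coarsen_def by blast
    qed
    have "T3.scalar_automorphisms \<subseteq> isotropy scale \<delta>"
    proof
      fix \<psi> assume \<psi>: "\<psi> \<in> T3.scalar_automorphisms"
      then have Aut: "\<psi> \<in> carrier (Aut scale)" by (simp add: T3.scalar_automorphisms_def)
      then have lin: "lin \<psi>" by (simp add: Aut_iff)
      obtain \<mu> where \<mu>: "\<And>c f. f \<in> ?W3 c \<Longrightarrow> \<psi> f = scale (\<mu> c) f"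
        using T3.scalar_character[OF \<psi>] by blast
      have "\<psi> (\<delta> f) = \<delta> (\<psi> f)" for f
      proof (induction f rule: W3.homogeneous_induct)
        case (homogeneous c f)
        show ?case by (simp add: \<mu>[OF homogeneous] \<mu>[OF \<delta>3[OF homogeneous]] lin_scale[OF lin_\<delta>])
      next
        case (add f f')
        then show ?case by (simp add: lin_add[OF lin] lin_add[OF lin_\<delta>])
      qed
      then show "\<psi> \<in> isotropy scale \<delta>" using Aut by (simp add: isotropy_def fun_eq_iff)
    qed
    then have torus3: "torus_in scale X ev (isotropy scale \<delta>) T3.scalar_automorphisms"
      by (rule T3.scalar_automorphisms_torus)
    have "T \<subseteq> T3.scalar_automorphisms"
    proof
      fix \<psi> assume \<psi>: "\<psi> \<in> T"
      then obtain t where t: "t \<in> carrier (std_torus r)" "\<psi> = \<theta> t" using T_eq by blast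
      have "\<psi> f = scale (chr r (c(r := 0)) t) f" if "f \<in> ?W3 c" for f c
        using W3_W[OF that] t by (simp add: weight_space_def)
      then show "\<psi> \<in> T3.scalar_automorphisms"
        using \<psi> bounded unfolding T3.scalar_automorphisms_def Aut_filtration_def by blast
    qed
    moreover have "T \<noteq> T3.scalar_automorphisms"
    proof
      assume eq: "T = T3.scalar_automorphisms"
      \<comment> \<open>This element acts on weight \<open>c\<close> by \<open>2\<close> to the power \<open>c r\<close>, whereas the action of an element
        of \<open>T\<close> depends on the other coordinates of \<open>c\<close> only.\<close>
      define s :: "nat \<Rightarrow> 'k" where "s = (\<lambda>i\<in>{..<Suc r}. if i = r then 2 else 1)"
      have s: "s \<in> carrier (std_torus (Suc r))" by (auto simp: s_def torus_carrier)
      then have "T3.act s \<in> T" unfolding eq T3.scalar_automorphisms_eq by blast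
      then obtain t where t: "t \<in> carrier (std_torus r)" "T3.act s = \<theta> t" using T_eq by blast
      have chr_s: "chr (Suc r) c s = 2 powi c r" for c
      proof -
        have "chr (Suc r) c s = (\<Prod>i<Suc r. if i = r then 2 powi c r else 1)"
          unfolding chr_def by (intro prod.cong) (auto simp: s_def)
        then show ?thesis by simp
      qed
      have act: "2 powi c r = chr r (c(r := 0)) t" if c: "c \<in> W3.weights" for c
      proof -
        obtain f where f: "f \<in> ?W3 c" "f \<noteq> 0" using T3.weight_vector[OF c] by blast
        have "scale (2 powi c r) f = T3.act s f"
          using T3.act_homogeneous[OF f(1), of s] by (simp add: chr_s)
        also have "\<dots> = scale (chr r (c(r := 0)) t) f"
          using W3_W[OF f(1)] t by (simp add: weight_space_def)
        finally show ?thesis using f(2) by simp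
      qed
      obtain a b where ab: "single r 1 = a - b" "a \<in> W3.weights" "b \<in> W3.weights"
        using unit3[of r] unfolding W3.weight_lattice_def by blast
      have diff: "a i - b i = single r 1 i" for i using ab(1) by simp
      have "a i = b i" if "i \<noteq> r" for i using diff[of i] that by (simp add: single_def)
      then have "a(r := 0) = b(r := 0)" by (auto simp: fun_eq_iff)
      then have "(2 :: 'k) powi a r = 2 powi b r" using act[OF ab(2)] act[OF ab(3)] by simp
      then have "a r = b r" by (rule two_powi_inject)
      then show False using diff[of r] by (simp add: single_def)
    qed
    ultimately have False using max_torus torus3 unfolding maximal_torus_in_def by blast
    then show ?thesis ..
  qed
qed

text \<open>The homogeneous elements of degree \<open>a\<close> lie in a single generalized eigenspace of \<open>D'\<close>. On
  \<open>Ker \<delta>\<close> this is a generalized eigenspace of \<open>D\<close>, and \<open>D\<close> is diagonalizable.\<close>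

lemma eigenvector_on_kernel:
  assumes f: "f \<in> W a" "\<delta> f = 0"
  shows "\<exists>k. D f = scale (of_int k) f"
proof -
  obtain h where h: "\<And>c. c \<in> W2.weights \<Longrightarrow> c r = (\<Sum>j<r. h j * c j)"
    using eigenvalue_linear_in_weight by blast
  define k where "k = (\<Sum>j<r. h j * a j)"
  have "c = a(r := k)" if "W2.proj c f \<noteq> 0" for c
  proof -
    have c: "c(r := 0) = a" by (rule proj_W2[OF f(1) that])
    have "c \<in> W2.weights" using that W2.supp_subset_weights by (auto simp: W2.supp_def)
    then have "c r = (\<Sum>j<r. h j * c j)" by (rule h)
    also have "\<dots> = k" unfolding k_def c[symmetric] by (intro sum.cong) auto
    finally have "c r = k" .
    have "c = (c(r := 0))(r := c r)" by simp
    then show ?thesis unfolding c \<open>c r = k\<close> .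
  qed
  then have "f \<in> W2 (a(r := k))" unfolding W2.homogeneous_iff by blast
  then obtain n where n: "(shift D' k ^^ n) f = 0" by (auto simp: W2_def gen_eigenspace_def)
  have "(shift D' k ^^ i) f \<in> W a \<and> \<delta> ((shift D' k ^^ i) f) = 0 \<and>
      (shift D k ^^ i) f = (shift D' k ^^ i) f" for i
  proof (induction i)
    case (Suc i)
    let ?g = "(shift D' k ^^ i) f"
    have g: "?g \<in> W a" "\<delta> ?g = 0" "(shift D k ^^ i) f = ?g" using Suc.IH by blast+
    have "shift D k ?g = shift D' k ?g" using D'_eq[OF g(1,2)] by (simp add: shift_def)
    moreover have "\<delta> (shift D' k ?g) = 0"
      unfolding shift_\<delta> g(2) by (rule lin_zero[OF shift_lin[OF lin_D']])
    ultimately show ?case using shift_W[OF g(1)] g(3) by simp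
  qed (use f in simp)
  then have "(shift D k ^^ n) f = 0" using n by simp
  then have "f \<in> gen_eigenspace D k" unfolding gen_eigenspace_def by blast
  then show ?thesis using diagonalizable_gen_eigenvector[OF lin_D diag] by blast
qed

end

text \<open>The infinitesimal generators of the conjugate torus \<open>\<phi> T \<phi>\<^sup>-\<^sup>1\<close> are conjugate to the derivations
  that multiply each weight vector by a coordinate of its weight. A homogeneous element of \<open>Ker \<delta>\<close>
  is an eigenvector of all of them, so its image under \<open>\<phi>\<^sup>-\<^sup>1\<close> has a single weight.\<close>

lemma isotropy_inverse_homogeneous:
  assumes \<phi>: "\<phi> \<in> isotropy scale \<delta>" and f: "f \<in> W a" "\<delta> f = 0"
  shows "\<exists>b. inv_into UNIV \<phi> f \<in> W b"
proof -
  let ?\<psi> = "inv_into UNIV \<phi>"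
  have Aut: "\<phi> \<in> carrier (Aut scale)" and \<phi>_\<delta>: "\<phi> (\<delta> g) = \<delta> (\<phi> g)" for g
    using \<phi> by (auto simp: isotropy_def fun_eq_iff)
  have Aut': "?\<psi> \<in> carrier (Aut scale)" by (rule Aut_inv[OF Aut])
  have lin: "lin \<phi>" "lin ?\<psi>" using Aut Aut' by (auto simp: Aut_iff)
  have bij: "bij \<phi>" using Aut by (simp add: Aut_iff)
  have inv: "\<phi> (?\<psi> g) = g" "?\<psi> (\<phi> g) = g" for g
    using bij by (simp_all add: bij_is_surj surj_f_inv_f bij_is_inj)
  have \<psi>_\<delta>: "?\<psi> (\<delta> g) = \<delta> (?\<psi> g)" for g
    using \<phi>_\<delta>[of "?\<psi> g"] inv by metis
  have "\<exists>k. \<forall>b \<in> W.supp (?\<psi> f). b j = k" for j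
  proof -
    define E where "E = W.degree_derivation (\<lambda>a. a j)"
    define D where "D g = \<phi> (E (?\<psi> g))" for g
    have E: "derivation scale E" unfolding E_def by (rule W.degree_derivation) simp
    have linE: "lin E" by (rule derivation_lin[OF E])
    have "derivation scale D"
    proof (rule derivationI)
      show "lin D"
        unfolding D_def by (rule linI) (simp_all add: lin_add[OF lin(1)] lin_add[OF lin(2)] lin_add[OF linE]
            lin_scale[OF lin(1)] lin_scale[OF lin(2)] lin_scale[OF linE])
      show "D (g * g') = D g * g' + g * D g'" for g g'
        using Aut Aut' by (simp add: D_def Aut_iff derivation_mult[OF E] lin_add[OF lin(1)] inv)
    qed
    moreover have "diagonalizable D"
      unfolding diagonalizable_def
    proof
      fix g
      interpret Wj: grading scale "W.coarsen (\<lambda>a. a j)" by (rule W.grading_coarsen) simp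
      have eig: "E h = scale (of_int m) h" if "h \<in> W.coarsen (\<lambda>a. a j) m" for h m
      proof -
        have "E h = (\<Sum>a\<in>W.supp h. scale (of_int m) (W.proj a h))"
          unfolding E_def W.degree_derivation_def using that
          by (intro sum.cong) (auto simp: W.coarsen_def W.supp_def)
        then show ?thesis by (simp add: W.sum_proj flip: scale_sum_right)
      qed
      let ?y = "\<lambda>m. \<phi> (Wj.proj m (?\<psi> g))"
      have "g = \<phi> (\<Sum>m\<in>Wj.supp (?\<psi> g). Wj.proj m (?\<psi> g))" by (simp only: Wj.sum_proj inv)
      also have "\<dots> = (\<Sum>m\<in>Wj.supp (?\<psi> g). ?y m)" by (rule lin_sum[OF lin(1)])
      finally have "g = (\<Sum>m\<in>Wj.supp (?\<psi> g). ?y m)" .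
      moreover have "D (?y m) = scale (of_int m) (?y m)" for m
        using eig[OF Wj.proj_in_W] by (simp add: D_def inv lin_scale[OF lin(1)])
      ultimately show "\<exists>F y. finite F \<and> g = sum y F \<and> (\<forall>m\<in>F. D (y m) = scale (of_int m) (y m))"
        by (intro exI[of _ "Wj.supp (?\<psi> g)"] exI[of _ ?y] conjI ballI Wj.finite_supp)
    qed
    moreover have "D (\<delta> g) = \<delta> (D g)" for g
      unfolding D_def E_def using W.degree_derivation_commute[OF lin_\<delta> \<delta>_W] \<phi>_\<delta> \<psi>_\<delta> by simp
    ultimately obtain k where k: "D f = scale (of_int k) f"
      using eigenvector_on_kernel[OF _ _ _ f] by blast
    have "E (?\<psi> f) = ?\<psi> (D f)" by (simp add: D_def inv)
    also have "\<dots> = scale (of_int k) (?\<psi> f)" by (simp add: k lin_scale[OF lin(2)])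
    finally have Ek: "E (?\<psi> f) = scale (of_int k) (?\<psi> f)" .
    have "b j = k" if b: "b \<in> W.supp (?\<psi> f)" for b
    proof -
      have E_W: "E g \<in> W c" if "g \<in> W c" for g c
        unfolding E_def W.degree_derivation_homogeneous[OF that] by (rule W.scale_W[OF that])
      have "scale (of_int (b j)) (W.proj b (?\<psi> f)) = E (W.proj b (?\<psi> f))"
        unfolding E_def by (rule W.degree_derivation_homogeneous[OF W.proj_in_W, symmetric])
      also have "\<dots> = W.proj b (E (?\<psi> f))" by (rule W.proj_commute[OF linE E_W, symmetric])
      also have "\<dots> = scale (of_int k) (W.proj b (?\<psi> f))" by (simp add: Ek W.proj_scale)
      finally have "scale (of_int (b j)) (W.proj b (?\<psi> f)) = scale (of_int k) (W.proj b (?\<psi> f))" .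
      moreover have "W.proj b (?\<psi> f) \<noteq> 0" using b by (simp add: W.supp_def)
      ultimately have "(of_int (b j) :: 'k) = of_int k" by simp
      then show ?thesis by simp
    qed
    then show ?thesis by blast
  qed
  then obtain b where b: "\<And>j c. c \<in> W.supp (?\<psi> f) \<Longrightarrow> c j = b j" by metis
  have "c = b" if "W.proj c (?\<psi> f) \<noteq> 0" for c
    using b that by (auto simp: W.supp_def fun_eq_iff)
  then have "?\<psi> f \<in> W b" unfolding W.homogeneous_iff by blast
  then show ?thesis by blast
qed

lemma isotropy_inverse_semi_invariant:
  assumes \<phi>: "\<phi> \<in> isotropy scale \<delta>" and f: "f \<in> semi_invariants scale T (Ker \<delta>)"
  shows "inv_into UNIV \<phi> f \<in> semi_invariants scale T (Ker \<delta>)"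
proof -
  have bij: "bij \<phi>" and lin: "lin \<phi>" and comm: "\<phi> (\<delta> g) = \<delta> (\<phi> g)" for g
    using \<phi> by (auto simp: isotropy_def Aut_iff fun_eq_iff)
  have "\<phi> (\<delta> (inv_into UNIV \<phi> f)) = \<phi> 0"
    using comm bij f by (simp add: semi_invariant_iff bij_is_surj surj_f_inv_f lin_zero[OF lin])
  then have "\<delta> (inv_into UNIV \<phi> f) = 0" using bij by (simp add: bij_is_inj inj_eq)
  then show ?thesis
    using f isotropy_inverse_homogeneous[OF \<phi>] by (auto simp: semi_invariant_iff)
qed

lemma isotropy_inv:
  assumes "\<phi> \<in> isotropy scale \<delta>"
  shows "inv_into UNIV \<phi> \<in> isotropy scale \<delta>"
proof -
  have Aut: "\<phi> \<in> carrier (Aut scale)" and comm: "\<phi> (\<delta> g) = \<delta> (\<phi> g)" for g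
    using assms by (auto simp: isotropy_def fun_eq_iff)
  have bij: "bij \<phi>" using Aut by (simp add: Aut_iff)
  have "inv_into UNIV \<phi> (\<delta> g) = \<delta> (inv_into UNIV \<phi> g)" for g
    using comm[of "inv_into UNIV \<phi> g"] bij by (metis bij_inv_eq_iff)
  then show ?thesis using Aut_inv[OF Aut] by (simp add: isotropy_def fun_eq_iff)
qed

lemma isotropy_image_semi_invariants:
  assumes "\<phi> \<in> isotropy scale \<delta>"
  shows "\<phi> ` semi_invariants scale T (Ker \<delta>) = semi_invariants scale T (Ker \<delta>)"
proof -
  have bij: "bij \<phi>" using assms by (auto simp: isotropy_def Aut_iff)
  then have inv: "inv_into UNIV (inv_into UNIV \<phi>) = \<phi>" by (rule inv_inv_eq)
  show ?thesis
  proof (intro equalityI subsetI)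
    fix g assume "g \<in> \<phi> ` semi_invariants scale T (Ker \<delta>)"
    then obtain f where f: "f \<in> semi_invariants scale T (Ker \<delta>)" "g = \<phi> f" by (rule imageE)
    show "g \<in> semi_invariants scale T (Ker \<delta>)"
      using isotropy_inverse_semi_invariant[OF isotropy_inv[OF assms] f(1)] unfolding inv f(2) .
  next
    fix g assume "g \<in> semi_invariants scale T (Ker \<delta>)"
    then have "inv_into UNIV \<phi> g \<in> semi_invariants scale T (Ker \<delta>)"
      by (rule isotropy_inverse_semi_invariant[OF assms])
    moreover have "g = \<phi> (inv_into UNIV \<phi> g)" using bij by (simp add: bij_is_surj surj_f_inv_f)
    ultimately show "g \<in> \<phi> ` semi_invariants scale T (Ker \<delta>)" by (rule rev_image_eqI)
  qed
qed

end

theorem proposition4p2: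
  fixes scale :: "'k::{alg_closed_field, field_char_0} \<Rightarrow> 'b::idom \<Rightarrow> 'b"
    and X :: "('n::finite \<Rightarrow> 'k) set"
    and ev :: "'b \<Rightarrow> ('n \<Rightarrow> 'k) \<Rightarrow> 'k"
    and \<delta> \<phi> :: "'b \<Rightarrow> 'b"
    and T :: "('b \<Rightarrow> 'b) set"
  assumes "coordinate_algebra scale X ev"
    and "maximal_LND scale \<delta>"
    and "maximal_torus_in scale X ev (isotropy scale \<delta>) T"
    and "\<phi> \<in> isotropy scale \<delta>"
  shows "\<phi> ` semi_invariants scale T (Ker \<delta>) = semi_invariants scale T (Ker \<delta>)"
proof -
  have T: "torus_in scale X ev (isotropy scale \<delta>) T"
    using assms(3) by (simp add: maximal_torus_in_def)
  then obtain r \<theta> where \<theta>: "torus_iso scale X ev T r \<theta>" by (auto simp: torus_in_def)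
  from T obtain d where d: "T \<subseteq> Aut_filtration scale X ev d"
    by (auto simp: torus_in_def closed_algebraic_subgroup_def)
  interpret maximal_torus_isotropy scale X ev \<delta> T r \<theta> d
    by (intro maximal_torus_isotropy.intro maximal_torus_isotropy_axioms.intro assms(1-3) \<theta> d)
  show ?thesis by (rule isotropy_image_semi_invariants[OF assms(4)])
qed

end
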